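(* Let $\mathbb F$ be $\mathbb R$ or $\mathbb C$. For any integer $p\ge 2$ and any quasianalytic Denjoy-Carleman class $\mathcal C^M$ which is not the class of analytic functions, there exists $f\in\mathcal C^\infty(\mathbb R^p,\mathbb F)$ such that for every open $U\subseteq\mathbb R$ and every curve $\gamma\in\mathcal C^M(U,\mathbb R^p)$ one has $f\circ\gamma\in\mathcal C^M(U,\mathbb F)$, but $f\notin\mathcal C^M(\mathbb R^p,\mathbb F)$.
   Context: $\mathbb N$ is the set of non-negative integers. A weight sequence is a non-decreasing sequence $M=(M_n)_{n\ge 0}$ of positive real numbers with $M_0=1$ that is logarithmically convex, i.e. the ratios $M_{n+1}/M_n$ form a non-decreasing sequence; every Denjoy-Carleman class is taken with respect to such a sequence. $\mathcal C^\infty(U,\mathbb F)$ is the algebra of smooth $\mathbb F$-valued functions on an open set $U$. For $U\subseteq\mathbb R^p$ open ($p\ge1$), $\mathcal C^M(U,\mathbb F)$ is the set of $f\in\mathcal C^\infty(U,\mathbb F)$ such that for every $x\in U$ there are an open $V\subseteq U$ containing $x$ and constants $A,B>0$ with $|D^\alpha f(y)|\le A B^{|\alpha|}|\alpha|!\,M_{|\alpha|}$ for all $\alpha\in\mathbb N^p$ and all $y\in V$. The class $\mathcal C^M$ determined in this way is called a Denjoy-Carleman class; it is the class of (real-)analytic functions if and only if $\sup_{n\ge1}M_n^{1/n}<\infty$. For $U\subseteq\mathbb R$ open, $\gamma=(\gamma_1,\dots,\gamma_p)\in\mathcal C^M(U,\mathbb R^p)$ means that each $\gamma_i\in\mathcal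 C^M(U,\mathbb R)$. A class $\mathcal C$ of smooth functions is quasianalytic if whenever $U\subseteq\mathbb R^p$ is open and $f\in\mathcal C(U,\mathbb F)$ satisfies $D^\alpha f(x)=0$ for all $\alpha\in\mathbb N^p$ and some $x\in U$, then $f$ is identically $0$ in a neighbourhood of $x$. *)

theory Defs
  imports "HOL-Analysis.Analysis"
begin

(* R^p is the space Euclidean_space p of HOL-Analysis: its points are the sequences x :: nat => real
   with x i = 0 for all i >= p, with the product topology. The dimension is thus a natural number that
   can be quantified over, as is needed in the definition of quasianalyticity. R is identified
   with R^1. Functions on an open set U of R^p are total HOL functions; all notions below depend
   only on their values on U. *)

abbreviation RR :: "nat \<Rightarrow> (nat \<Rightarrow> real) set" where
  "RR p \<equiv> topspace (Euclidean_space p)"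

definition weight_sequence :: "(nat \<Rightarrow> real) \<Rightarrow> bool" where
  "weight_sequence M \<longleftrightarrow> M 0 = 1 \<and> (\<forall>n. 0 < M n) \<and> mono M \<and> mono (\<lambda>n. M (Suc n) / M n)"

definition partial_deriv ::
    "nat \<Rightarrow> ((nat \<Rightarrow> real) \<Rightarrow> 'f::real_normed_vector) \<Rightarrow> (nat \<Rightarrow> real) \<Rightarrow> 'f" where
  "partial_deriv i f x = vector_derivative (\<lambda>t. f (x(i := t))) (at (x i))"

definition iterated_partial ::
    "nat list \<Rightarrow> ((nat \<Rightarrow> real) \<Rightarrow> 'f::real_normed_vector) \<Rightarrow> (nat \<Rightarrow> real) \<Rightarrow> 'f" where
  "iterated_partial js f = foldr partial_deriv js f"

(* vector_derivative is an arbitrary value where the derivative does not exist, so the existence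
   of every iterated partial derivative has to be required explicitly. *)
definition smooth_class ::
    "nat \<Rightarrow> (nat \<Rightarrow> real) set \<Rightarrow> ((nat \<Rightarrow> real) \<Rightarrow> 'f::real_normed_vector) set" where
  "smooth_class p U = {f. \<forall>js. set js \<subseteq> {..<p} \<longrightarrow>
     continuous_on U (iterated_partial js f) \<and>
     (\<forall>x\<in>U. \<forall>i<p. (\<lambda>t. iterated_partial js f (x(i := t))) differentiable (at (x i)))}"

(* Only the entries \<alpha> 0, ..., \<alpha> (p - 1) of a multi-index \<alpha> :: nat => nat matter in mi_size p \<alpha>
   and in mi_deriv p \<alpha>; the latter is d_0^(\<alpha> 0) ... d_(p-1)^(\<alpha> (p-1)). *)
definition mi_size :: "nat \<Rightarrow> (nat \<Rightarrow> nat) \<Rightarrow> nat" where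
  "mi_size p \<alpha> = (\<Sum>i<p. \<alpha> i)"

primrec mi_deriv ::
    "nat \<Rightarrow> (nat \<Rightarrow> nat) \<Rightarrow> ((nat \<Rightarrow> real) \<Rightarrow> 'f::real_normed_vector) \<Rightarrow> (nat \<Rightarrow> real) \<Rightarrow> 'f" where
  "mi_deriv 0 \<alpha> f = f"
| "mi_deriv (Suc p) \<alpha> f = mi_deriv p \<alpha> ((partial_deriv p ^^ \<alpha> p) f)"

definition denjoy_carleman ::
    "(nat \<Rightarrow> real) \<Rightarrow> nat \<Rightarrow> (nat \<Rightarrow> real) set \<Rightarrow> ((nat \<Rightarrow> real) \<Rightarrow> 'f::real_normed_vector) set" where
  "denjoy_carleman M p U = {f \<in> smooth_class p U.
     \<forall>x\<in>U. \<exists>V A B. openin (Euclidean_space p) V \<and> x \<in> V \<and> V \<subseteq> U \<and> 0 < A \<and> 0 < B \<and>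
       (\<forall>\<alpha>. \<forall>y\<in>V. norm (mi_deriv p \<alpha> f y)
          \<le> A * B ^ mi_size p \<alpha> * fact (mi_size p \<alpha>) * M (mi_size p \<alpha>))}"

definition denjoy_carleman_curves ::
    "(nat \<Rightarrow> real) \<Rightarrow> (nat \<Rightarrow> real) set \<Rightarrow> nat \<Rightarrow> ((nat \<Rightarrow> real) \<Rightarrow> (nat \<Rightarrow> real)) set" where
  "denjoy_carleman_curves M U p = {\<gamma>. \<gamma> ` U \<subseteq> RR p \<and>
     (\<forall>i<p. (\<lambda>t. \<gamma> t i) \<in> denjoy_carleman M 1 U)}"

definition analytic_class ::
    "nat \<Rightarrow> (nat \<Rightarrow> real) set \<Rightarrow> ((nat \<Rightarrow> real) \<Rightarrow> 'f::real_normed_vector) set" where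
  "analytic_class p U = {f. \<forall>x\<in>U. \<exists>V c. openin (Euclidean_space p) V \<and> x \<in> V \<and> V \<subseteq> U \<and>
     (\<forall>y\<in>V. ((\<lambda>\<alpha>. (\<Prod>i<p. (y i - x i) ^ \<alpha> i) *\<^sub>R c \<alpha>) has_sum f y)
        {\<alpha> :: nat \<Rightarrow> nat. \<forall>i\<ge>p. \<alpha> i = 0})}"

(* A class of functions C assigns to p and to an open set U of R^p a set C p U of functions. *)
definition quasianalytic ::
    "(nat \<Rightarrow> (nat \<Rightarrow> real) set \<Rightarrow> ((nat \<Rightarrow> real) \<Rightarrow> 'f::real_normed_vector) set) \<Rightarrow> bool" where
  "quasianalytic C \<longleftrightarrow> (\<forall>p\<ge>1. \<forall>U f x. openin (Euclidean_space p) U \<and> f \<in> C p U \<and> x \<in> U \<and>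
     (\<forall>\<alpha>. mi_deriv p \<alpha> f x = 0) \<longrightarrow>
     (\<exists>V. openin (Euclidean_space p) V \<and> x \<in> V \<and> V \<subseteq> U \<and> (\<forall>y\<in>V. f y = 0)))"

definition is_analytic_class ::
    "(nat \<Rightarrow> (nat \<Rightarrow> real) set \<Rightarrow> ((nat \<Rightarrow> real) \<Rightarrow> 'f::real_normed_vector) set) \<Rightarrow> bool" where
  "is_analytic_class C \<longleftrightarrow>
     (\<forall>p\<ge>1. \<forall>U. openin (Euclidean_space p) U \<longrightarrow> C p U = analytic_class p U)"

end

theory Submission
  imports Defs
begin

text \<open>If the weights are bounded by a geometric sequence, the class is the analytic one, so \<open>M\<close>
  dominates every geometric sequence. The function is a sum of narrow Gaussian bumps centred at points
  \<open>(a_k, b_k)\<close> tending to the origin along a flat curve. The class being quasianalytic, a curve in it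
  through the origin has finite order of contact with the first axis or runs inside it, so it
  stays at distance at least \<open>b_k / 2\<close> from almost all centres. The heights decay so fast that
  at this distance the bumps satisfy the Denjoy-Carleman estimates uniformly, while the widths are so
  small that the derivative of order \<open>2 * k\<close> at the \<open>k\<close>-th centre is too large.\<close>

subsection \<open>Open sets and boxes in Euclidean space\<close>

text \<open>Heights and widths seem to conflict: a bump of width \<open>e k\<close> has derivatives
  growing with powers of \<open>l = 1 / (e k)\<^sup>2\<close>, so a height that tames them should
  have to know the width. The way out is \<open>z ^ i \<le> fact i * exp z\<close> at
  \<open>z = l * u\<close>: it bounds \<open>l ^ i * exp (- l * u)\<close> by
  \<open>fact i / u ^ i\<close>, with no \<open>l\<close> left. At squared distance
  \<open>u \<ge> (bpoint k / 2)\<^sup>2\<close> there remain powers of a number fixed by the centre,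
  which \<open>M\<close> dominates. A height depending on the centre alone therefore suffices far
  away, and the width stays free. Lowering the height further by \<open>e k ^ (2 * k - 1)\<close>
  keeps the derivatives of order below \<open>2 * k\<close> small, while order \<open>2 * k\<close>
  still blows up as the width shrinks. The obstacle is to extend the bound from the value to all
  derivatives along a curve with a geometric rate free of \<open>l\<close>; a recursion for Taylor
  coefficients that carries spare powers of \<open>l\<close> achieves this. Flatness comes from
  \<open>bpoint k = apoint k ^ k\<close>, which is eventually far below any fixed power of
  \<open>apoint k\<close>.\<close>

lemma RR_iff: "x \<in> RR p \<longleftrightarrow> (\<forall>i\<ge>p. x i = 0)"
  by (simp add: topspace_Euclidean_space)

lemma update_in_RR: "x \<in> RR p \<Longrightarrow> i < p \<Longrightarrow> x(i := t) \<in> RR p"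
  by (auto simp: RR_iff)

lemma openin_RR_iff: "openin (Euclidean_space p) U \<longleftrightarrow> (\<exists>T. open T \<and> U = T \<inter> RR p)"
  by (simp add: Euclidean_space_def openin_subtopology euclidean_product_topology)

lemma openin_imp_RR: "openin (Euclidean_space p) U \<Longrightarrow> x \<in> U \<Longrightarrow> x \<in> RR p"
  by (auto simp: openin_RR_iff)

lemma continuous_on_update:
  fixes x :: "nat \<Rightarrow> real"
  shows "continuous_on S (\<lambda>t. x(i := t))"
proof (rule continuous_on_coordinatewise_then_product)
  show "continuous_on S (\<lambda>t. (x(i := t)) j)" for j
    by (cases "j = i") (auto intro!: continuous_intros)
qed

lemma open_update:
  assumes "openin (Euclidean_space p) U" "x \<in> RR p" "i < p"
  shows "open {t. x(i := t) \<in> U}"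
proof -
  obtain T where T: "open T" "U = T \<inter> RR p"
    using assms(1) by (auto simp: openin_RR_iff)
  have "{t. x(i := t) \<in> U} = (\<lambda>t. x(i := t)) -` T"
    using T(2) update_in_RR[OF assms(2,3)] by auto
  then show ?thesis
    using T(1) continuous_on_update open_vimage by metis
qed

text \<open>Boxes rather than balls: changing one coordinate within its interval stays inside, as
  the coordinatewise Taylor expansion requires.\<close>

definition coord_box :: "nat \<Rightarrow> (nat \<Rightarrow> real) \<Rightarrow> real \<Rightarrow> (nat \<Rightarrow> real) set" where
  "coord_box p x r = {y \<in> RR p. \<forall>i<p. \<bar>y i - x i\<bar> < r}"

lemma openin_coord_box: "openin (Euclidean_space p) (coord_box p x r)"
proof -
  have "open {f. \<forall>i\<in>{..<p}. f (id i) \<in> ball (x i) r}"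
    by (rule product_topology_basis') auto
  moreover have "coord_box p x r = {f. \<forall>i\<in>{..<p}. f (id i) \<in> ball (x i) r} \<inter> RR p"
    by (auto simp: coord_box_def dist_real_def abs_minus_commute)
  ultimately show ?thesis
    unfolding openin_RR_iff by blast
qed

lemma coord_box_center: "x \<in> RR p \<Longrightarrow> r > 0 \<Longrightarrow> x \<in> coord_box p x r"
  by (simp add: coord_box_def)

lemma coord_box_mono: "r \<le> s \<Longrightarrow> coord_box p x r \<subseteq> coord_box p x s"
  by (auto simp: coord_box_def)

lemma coord_box_subset_open:
  assumes "openin (Euclidean_space p) U" "x \<in> U"
  obtains r where "r > 0" "coord_box p x r \<subseteq> U"
proof -
  obtain T where T: "open T" "U = T \<inter> RR p"
    using assms(1) by (auto simp: openin_RR_iff)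
  have "x \<in> T" using T assms by auto
  from product_topology_open_contains_basis[of "\<lambda>i. euclidean" UNIV T x] T(1) this
  obtain X where X: "x \<in> (\<Pi>\<^sub>E i\<in>UNIV. X i)" "\<And>i. open (X i)" "(\<Pi>\<^sub>E i\<in>UNIV. X i) \<subseteq> T"
    by (auto simp: open_fun_def)
  \<comment> \<open>Only finitely many coordinates need a common radius; from the dimension on, all
    points of the space vanish and agree with \<open>x\<close>.\<close>
  have "\<exists>r>0. \<forall>i<p. ball (x i) r \<subseteq> X i" for p
  proof (induction p)
    case (Suc p)
    then obtain r where r: "r > 0" "\<forall>i<p. ball (x i) r \<subseteq> X i" by auto
    have "x p \<in> X p" using X(1) by auto
    then obtain s where s: "s > 0" "ball (x p) s \<subseteq> X p"
      using X(2) open_contains_ball by blast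
    have "ball (x i) (min r s) \<subseteq> X i" if "i < Suc p" for i
    proof (cases "i = p")
      case True
      then show ?thesis using s(2) by (simp add: subset_iff)
    next
      case False
      then have "ball (x i) r \<subseteq> X i" using that r(2) by simp
      then show ?thesis by (simp add: subset_iff)
    qed
    then show ?case using r(1) s(1) by (intro exI[of _ "min r s"]) simp
  qed (auto intro: exI[of _ 1])
  from this[of p] obtain r where r: "r > 0" "\<forall>i<p. ball (x i) r \<subseteq> X i" by blast
  have "x \<in> RR p" using T assms by auto
  have "coord_box p x r \<subseteq> U"
  proof
    fix y assume y: "y \<in> coord_box p x r"
    have "y i \<in> X i" for i
    proof (cases "i < p")
      case True
      then have "y i \<in> ball (x i) r" using y by (auto simp: coord_box_def dist_real_def abs_minus_commute)
      then show ?thesis using r(2) True by blast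
    next
      case False
      then have "y i = x i" using y \<open>x \<in> RR p\<close> by (auto simp: coord_box_def RR_iff)
      then show ?thesis using X(1) by auto
    qed
    then have "y \<in> T" using X(3) by blast
    then show "y \<in> U" using y T(2) by (auto simp: coord_box_def)
  qed
  then show ?thesis using r(1) that by blast
qed

subsection \<open>Smooth functions and iterated partial derivatives\<close>

lemma iterated_partial_Nil [simp]: "iterated_partial [] f = f"
  and iterated_partial_Cons: "iterated_partial (i # js) f = partial_deriv i (iterated_partial js f)"
  and iterated_partial_append:
    "iterated_partial (js @ ks) f = iterated_partial js (iterated_partial ks f)"
  by (simp_all add: iterated_partial_def)

lemma iterated_partial_replicate: "iterated_partial (replicate n i) f = (partial_deriv i ^^ n) f"
  by (induction n) (simp_all add: iterated_partial_Cons)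

lemma smooth_class_has_deriv:
  assumes "f \<in> smooth_class p U" "set js \<subseteq> {..<p}" "x \<in> U" "i < p"
  shows "((\<lambda>t. iterated_partial js f (x(i := t))) has_vector_derivative
           iterated_partial (i # js) f x) (at (x i))"
  using assms by (auto simp: smooth_class_def iterated_partial_Cons partial_deriv_def
      vector_derivative_works[symmetric])

lemma smooth_class_continuous:
  "f \<in> smooth_class p U \<Longrightarrow> set js \<subseteq> {..<p} \<Longrightarrow> continuous_on U (iterated_partial js f)"
  by (auto simp: smooth_class_def)

text \<open>A partial derivative sees only nearby values along a line, so agreement with the
  candidate family \<open>G\<close> on an open set passes from \<open>js\<close> to
  \<open>i # js\<close>.\<close>

lemma iterated_partial_eqI:
  assumes U: "openin (Euclidean_space p) U"
    and f: "\<And>x. x \<in> U \<Longrightarrow> f x = G [] x"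
    and G: "\<And>js x i. set js \<subseteq> {..<p} \<Longrightarrow> x \<in> U \<Longrightarrow> i < p \<Longrightarrow>
       ((\<lambda>t. G js (x(i := t))) has_vector_derivative G (i # js) x) (at (x i))"
    and "set js \<subseteq> {..<p}" "x \<in> U"
  shows "iterated_partial js f x = G js x"
  using assms(4,5)
proof (induction js arbitrary: x)
  case Nil
  then show ?case using f by simp
next
  case (Cons i js)
  have i: "i < p" "set js \<subseteq> {..<p}" using Cons.prems by auto
  have "((\<lambda>t. iterated_partial js f (x(i := t))) has_vector_derivative G (i # js) x) (at (x i))"
  proof (rule has_vector_derivative_transform_within_open)
    show "open {t. x(i := t) \<in> U}"
      using open_update[OF U openin_imp_RR[OF U Cons.prems(2)] i(1)] .
  qed (use G Cons i in auto)
  then show ?case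
    by (simp add: iterated_partial_Cons partial_deriv_def vector_derivative_at)
qed

lemma smooth_classI:
  assumes U: "openin (Euclidean_space p) U"
    and f: "\<And>x. x \<in> U \<Longrightarrow> f x = G [] x"
    and G: "\<And>js x i. set js \<subseteq> {..<p} \<Longrightarrow> x \<in> U \<Longrightarrow> i < p \<Longrightarrow>
       ((\<lambda>t. G js (x(i := t))) has_vector_derivative G (i # js) x) (at (x i))"
    and C: "\<And>js. set js \<subseteq> {..<p} \<Longrightarrow> continuous_on U (G js)"
  shows "f \<in> smooth_class p U"
  unfolding smooth_class_def
proof (intro CollectI allI impI conjI ballI)
  fix js assume js: "set js \<subseteq> {..<p}"
  have eq: "iterated_partial js f x = G js x" if "x \<in> U" for x
    by (rule iterated_partial_eqI[of p U f G]) (use U f G js that in auto)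
  show "continuous_on U (iterated_partial js f)"
    using C[OF js] eq by (subst continuous_on_cong[OF refl]) auto
  fix x i assume x: "x \<in> U" "i < p"
  have "((\<lambda>t. iterated_partial js f (x(i := t))) has_vector_derivative G (i # js) x) (at (x i))"
  proof (rule has_vector_derivative_transform_within_open)
    show "open {t. x(i := t) \<in> U}"
      using open_update[OF U openin_imp_RR[OF U x(1)] x(2)] .
  qed (use G js x eq in auto)
  then show "(\<lambda>t. iterated_partial js f (x(i := t))) differentiable (at (x i))"
    by (rule differentiableI_vector)
qed

text \<open>Differentiability is required at single points, so only continuity needs care: the limit
  within \<open>V\<close> has to become a limit within \<open>U\<close>.\<close>

lemma smooth_class_local:
  assumes "\<And>x. x \<in> U \<Longrightarrow> \<exists>V. openin (Euclidean_space p) V \<and> x \<in> V \<and> V \<subseteq> U \<and> f \<in> smooth_class p V"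
  shows "f \<in> smooth_class p U"
  unfolding smooth_class_def
proof (intro CollectI allI impI conjI ballI)
  fix js assume js: "set js \<subseteq> {..<p}"
  show "continuous_on U (iterated_partial js f)"
    unfolding continuous_on_def
  proof
    fix x assume "x \<in> U"
    then obtain V where V: "openin (Euclidean_space p) V" "x \<in> V" "V \<subseteq> U" "f \<in> smooth_class p V"
      using assms by blast
    obtain T where T: "open T" "V = T \<inter> RR p" using V(1) by (auto simp: openin_RR_iff)
    have "continuous_on V (iterated_partial js f)"
      using smooth_class_continuous[OF V(4) js] .
    then have lim: "(iterated_partial js f \<longlongrightarrow> iterated_partial js f x) (at x within V)"
      using V(2) by (auto simp: continuous_on_def)
    have "U \<inter> T \<subseteq> V"
    proof
      fix y assume y: "y \<in> U \<inter> T"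
      then obtain W where "openin (Euclidean_space p) W" "y \<in> W" using assms by blast
      then have "y \<in> RR p" using openin_imp_RR by blast
      then show "y \<in> V" using y T by auto
    qed
    then have "(iterated_partial js f \<longlongrightarrow> iterated_partial js f x) (at x within U \<inter> T)"
      using lim tendsto_within_subset by blast
    moreover have "at x within U \<inter> T = at x within U"
      using T V(2) by (intro at_within_nhd[of x T]) auto
    ultimately show "(iterated_partial js f \<longlongrightarrow> iterated_partial js f x) (at x within U)"
      by simp
  qed
  fix x i assume x: "x \<in> U" "i < p"
  obtain V where "x \<in> V" "f \<in> smooth_class p V"
    using assms[OF x(1)] by blast
  then show "(\<lambda>t. iterated_partial js f (x(i := t))) differentiable (at (x i))"
    using js x(2) unfolding smooth_class_def by blast
qed

lemma smooth_class_subset: "f \<in> smooth_class p U \<Longrightarrow> V \<subseteq> U \<Longrightarrow> f \<in> smooth_class p V"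
  unfolding smooth_class_def by (auto intro: continuous_on_subset)

section \<open>Termwise differentiation of series\<close>

lemma has_vector_derivative_suminf:
  fixes F :: "nat \<Rightarrow> real \<Rightarrow> 'f::banach"
  assumes S: "open S" "convex S" "t0 \<in> S"
    and F: "\<And>n t. t \<in> S \<Longrightarrow> (F n has_vector_derivative F' n t) (at t)"
    and b: "\<And>n. norm (F n t0) \<le> b n" "summable b"
    and b': "\<And>n t. t \<in> S \<Longrightarrow> norm (F' n t) \<le> b' n" "summable b'"
  shows "((\<lambda>t. \<Sum>n. F n t) has_vector_derivative (\<Sum>n. F' n t0)) (at t0)"
proof -
  define g' where "g' t = (\<Sum>n. F' n t)" for t
  have ul: "uniform_limit S (\<lambda>n t. \<Sum>i<n. F' i t) g' sequentially"
    unfolding g'_def by (rule Weierstrass_m_test[OF b'])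
  have "summable (\<lambda>n. F n t0)"
    by (rule summable_comparison_test'[OF b(2)]) (use b(1) in auto)
  then have s: "(\<lambda>n. F n t0) sums (\<Sum>n. F n t0)" by blast
  have "\<exists>g. \<forall>x\<in>S. (\<lambda>n. F n x) sums (g x) \<and>
      (g has_derivative (\<lambda>h. h *\<^sub>R g' x)) (at x within S)"
  proof (rule has_derivative_series[where f' = "\<lambda>n x h. h *\<^sub>R F' n x" and x = t0])
    show "(F n has_derivative (\<lambda>h. h *\<^sub>R F' n x)) (at x within S)" if "x \<in> S" for n x
      using F[OF that, of n] has_derivative_at_withinI unfolding has_vector_derivative_def by blast
    fix e :: real assume "e > 0"
    from uniform_limitD[OF ul this]
    show "\<forall>\<^sub>F n in sequentially. \<forall>x\<in>S. \<forall>h. norm ((\<Sum>i<n. h *\<^sub>R F' i x) - h *\<^sub>R g' x) \<le> e * norm h"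
    proof eventually_elim
      case (elim n)
      show ?case
      proof (intro ballI allI)
        fix x h assume "x \<in> S"
        then have "norm ((\<Sum>i<n. F' i x) - g' x) \<le> e" using elim by (force simp: dist_norm)
        then have "\<bar>h\<bar> * norm ((\<Sum>i<n. F' i x) - g' x) \<le> \<bar>h\<bar> * e" by (intro mult_left_mono) auto
        moreover have "(\<Sum>i<n. h *\<^sub>R F' i x) - h *\<^sub>R g' x = h *\<^sub>R ((\<Sum>i<n. F' i x) - g' x)"
          by (simp add: scaleR_sum_right scaleR_diff_right)
        ultimately show "norm ((\<Sum>i<n. h *\<^sub>R F' i x) - h *\<^sub>R g' x) \<le> e * norm h"
          by (simp add: mult.commute)
      qed
    qed
  qed (use S s in auto)
  then obtain g where g: "\<And>x. x \<in> S \<Longrightarrow> (\<lambda>n. F n x) sums (g x)"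
     "\<And>x. x \<in> S \<Longrightarrow> (g has_derivative (\<lambda>h. h *\<^sub>R g' x)) (at x within S)" by blast
  have "(g has_vector_derivative g' t0) (at t0)"
    using g(2)[OF S(3)] by (simp add: has_vector_derivative_def at_within_open[OF S(3) S(1)])
  then show ?thesis unfolding g'_def
    by (rule has_vector_derivative_transform_within_open[OF _ S(1) S(3)])
       (use g(1) in \<open>auto simp: sums_iff\<close>)
qed

text \<open>Serves both power series and the sum of bumps. The bound for \<open>js\<close> gives
  convergence at the point itself, the bound for \<open>i # js\<close> uniform convergence of the
  derivatives along the line in direction \<open>i\<close>.\<close>

lemma smooth_class_suminf:
  fixes F :: "nat \<Rightarrow> nat list \<Rightarrow> (nat \<Rightarrow> real) \<Rightarrow> 'f::banach"
  assumes U: "openin (Euclidean_space p) U"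
    and f: "\<And>x. x \<in> U \<Longrightarrow> f x = (\<Sum>n. F n [] x)"
    and F: "\<And>n js x i. set js \<subseteq> {..<p} \<Longrightarrow> x \<in> U \<Longrightarrow> i < p \<Longrightarrow>
       ((\<lambda>t. F n js (x(i := t))) has_vector_derivative F n (i # js) x) (at (x i))"
    and C: "\<And>n js. set js \<subseteq> {..<p} \<Longrightarrow> continuous_on U (F n js)"
    and B: "\<And>js x. set js \<subseteq> {..<p} \<Longrightarrow> x \<in> U \<Longrightarrow>
       \<exists>V b. openin (Euclidean_space p) V \<and> x \<in> V \<and> V \<subseteq> U \<and> summable b \<and>
         (\<forall>n. \<forall>y\<in>V. norm (F n js y) \<le> b n)"
  shows "f \<in> smooth_class p U"
    and "\<And>js x. set js \<subseteq> {..<p} \<Longrightarrow> x \<in> U \<Longrightarrow> iterated_partial js f x = (\<Sum>n. F n js x)"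
proof -
  define G where "G js x = (\<Sum>n. F n js x)" for js x
  have G: "((\<lambda>t. G js (x(i := t))) has_vector_derivative G (i # js) x) (at (x i))"
    if js: "set js \<subseteq> {..<p}" and x: "x \<in> U" and i: "i < p" for js x i
  proof -
    obtain V b where V: "openin (Euclidean_space p) V" "x \<in> V" "V \<subseteq> U" "summable b"
      "\<forall>n. \<forall>y\<in>V. norm (F n js y) \<le> b n" using B[OF js x] by blast
    have "set (i # js) \<subseteq> {..<p}" using js i by auto
    from B[OF this x]
    obtain V' b' where V': "openin (Euclidean_space p) V'" "x \<in> V'" "V' \<subseteq> U" "summable b'"
      "\<forall>n. \<forall>y\<in>V'. norm (F n (i # js) y) \<le> b' n" by blast
    have xp: "x \<in> RR p" using openin_imp_RR[OF U x] .
    have "open {t. x(i := t) \<in> V \<inter> V'}"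
      using open_update[OF openin_Int[OF V(1) V'(1)] xp i] .
    moreover have "x i \<in> {t. x(i := t) \<in> V \<inter> V'}" using V V' by simp
    ultimately obtain e where e: "e > 0" "ball (x i) e \<subseteq> {t. x(i := t) \<in> V \<inter> V'}"
      using open_contains_ball by blast
    have "((\<lambda>t. \<Sum>n. F n js (x(i := t))) has_vector_derivative (\<Sum>n. F n (i # js) (x(i := x i)))) (at (x i))"
    proof (rule has_vector_derivative_suminf[where S = "ball (x i) e" and b = b and b' = b'
          and F' = "\<lambda>n t. F n (i # js) (x(i := t))"])
      fix n t assume t: "t \<in> ball (x i) e"
      then have "x(i := t) \<in> U" using e V by blast
      from F[OF js this i, of n]
      show "((\<lambda>t. F n js (x(i := t))) has_vector_derivative F n (i # js) (x(i := t))) (at t)" by simp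
    qed (use e V V' in auto)
    then show ?thesis by (simp add: G_def)
  qed
  have C': "continuous_on U (G js)" if js: "set js \<subseteq> {..<p}" for js
    unfolding continuous_on_def
  proof
    fix x assume x: "x \<in> U"
    obtain V b where V: "openin (Euclidean_space p) V" "x \<in> V" "V \<subseteq> U" "summable b"
      "\<forall>n. \<forall>y\<in>V. norm (F n js y) \<le> b n" using B[OF js x] by blast
    obtain T where T: "open T" "V = T \<inter> RR p" using V(1) by (auto simp: openin_RR_iff)
    have "uniform_limit V (\<lambda>n y. \<Sum>k<n. F k js y) (G js) sequentially"
      unfolding G_def using V by (intro Weierstrass_m_test) auto
    moreover have "continuous_on V (\<lambda>y. \<Sum>k<n. F k js y)" for n
      using C[OF js] V(3) by (intro continuous_on_sum) (auto intro: continuous_on_subset)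
    ultimately have "continuous_on V (G js)"
      by (intro uniform_limit_theorem[where F = sequentially]) auto
    then have "(G js \<longlongrightarrow> G js x) (at x within V)" using V(2) by (auto simp: continuous_on_def)
    moreover have "U \<inter> T = V \<inter> T" using T V openin_imp_RR[OF U] by auto
    moreover have "at x within V \<inter> T = at x within V" "at x within U \<inter> T = at x within U"
      using T V(2) by (auto intro!: at_within_nhd[of x T])
    ultimately show "(G js \<longlongrightarrow> G js x) (at x within U)" by simp
  qed
  have G0: "f x = G [] x" if "x \<in> U" for x
    using f that by (simp add: G_def)
  show "f \<in> smooth_class p U"
    by (rule smooth_classI[where G = G and U = U, OF U G0 G C'])
  show "iterated_partial js f x = (\<Sum>n. F n js x)" if "set js \<subseteq> {..<p}" "x \<in> U" for js x
    unfolding G_def[symmetric] by (rule iterated_partial_eqI[where G = G and U = U, OF U G0 G that])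
qed

text \<open>The list keeps the order of \<open>mi_deriv\<close>, with the highest direction applied
  first.\<close>

primrec mi_list :: "nat \<Rightarrow> (nat \<Rightarrow> nat) \<Rightarrow> nat list" where
  "mi_list 0 \<alpha> = []"
| "mi_list (Suc p) \<alpha> = mi_list p \<alpha> @ replicate (\<alpha> p) p"

lemma mi_deriv_eq_iterated_partial: "mi_deriv p \<alpha> f = iterated_partial (mi_list p \<alpha>) f"
  by (induction p arbitrary: f)
    (simp_all add: iterated_partial_append iterated_partial_replicate)

lemma set_mi_list: "set (mi_list p \<alpha>) \<subseteq> {..<p}"
  by (induction p) auto

lemma count_list_mi_list: "i < p \<Longrightarrow> count_list (mi_list p \<alpha>) i = \<alpha> i"
proof (induction p)
  case (Suc p)
  have "count_list (mi_list p \<alpha>) p = 0"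
    using set_mi_list[of p \<alpha>] by (auto simp: count_list_0_iff)
  moreover have "count_list (replicate n j) i = (if i = j then n else 0)" for n j
    by (induction n) auto
  ultimately show ?case using Suc by (auto simp: less_Suc_eq)
qed simp

lemma mi_deriv_cong: "(\<And>i. i < p \<Longrightarrow> \<alpha> i = \<beta> i) \<Longrightarrow> mi_deriv p \<alpha> f = mi_deriv p \<beta> f"
  by (induction p arbitrary: f) auto

lemma mi_deriv_0: "(\<And>i. i < p \<Longrightarrow> \<alpha> i = 0) \<Longrightarrow> mi_deriv p \<alpha> f = f"
  by (induction p arbitrary: f) auto

lemma denjoy_carleman_bounds:
  assumes f: "f \<in> denjoy_carleman M p U" and x: "x \<in> U"
  obtains V A B where "openin (Euclidean_space p) V" "x \<in> V" "V \<subseteq> U" "0 < A" "0 < B"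
    "\<And>\<alpha> y. y \<in> V \<Longrightarrow> norm (mi_deriv p \<alpha> f y)
       \<le> A * B ^ mi_size p \<alpha> * fact (mi_size p \<alpha>) * M (mi_size p \<alpha>)"
proof -
  have "\<forall>x\<in>U. \<exists>V A B. openin (Euclidean_space p) V \<and> x \<in> V \<and> V \<subseteq> U \<and> 0 < A \<and> 0 < B \<and>
       (\<forall>\<alpha>. \<forall>y\<in>V. norm (mi_deriv p \<alpha> f y)
          \<le> A * B ^ mi_size p \<alpha> * fact (mi_size p \<alpha>) * M (mi_size p \<alpha>))"
    using f by (simp add: denjoy_carleman_def)
  from bspec[OF this x] show thesis
    by (elim exE conjE) (rule that, assumption+, simp)
qed

section \<open>Embedding real-valued functions into the scalars\<close>

lemma smooth_class_of_real:
  fixes f :: "(nat \<Rightarrow> real) \<Rightarrow> real"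
  assumes U: "openin (Euclidean_space p) U" and f: "f \<in> smooth_class p U"
  shows "(\<lambda>x. of_real (f x) :: 'f::real_normed_algebra_1) \<in> smooth_class p U"
    and "\<And>js x. set js \<subseteq> {..<p} \<Longrightarrow> x \<in> U \<Longrightarrow>
      iterated_partial js (\<lambda>x. of_real (f x) :: 'f) x = of_real (iterated_partial js f x)"
proof -
  define G where "G js x = (of_real (iterated_partial js f x) :: 'f)" for js x
  have G: "((\<lambda>t. G js (x(i := t))) has_vector_derivative G (i # js) x) (at (x i))"
    if "set js \<subseteq> {..<p}" "x \<in> U" "i < p" for js x i
    unfolding G_def
    using bounded_linear.has_vector_derivative[OF bounded_linear_of_real smooth_class_has_deriv[OF f that]] .
  have C: "continuous_on U (G js)" if "set js \<subseteq> {..<p}" for js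
    unfolding G_def using smooth_class_continuous[OF f that] by (intro continuous_intros)
  have G0: "of_real (f x) = G [] x" if "x \<in> U" for x
    by (simp add: G_def)
  show "(\<lambda>x. of_real (f x) :: 'f) \<in> smooth_class p U"
    by (rule smooth_classI[where G = G and U = U, OF U G0 G C])
  show "iterated_partial js (\<lambda>x. of_real (f x) :: 'f) x = of_real (iterated_partial js f x)"
    if "set js \<subseteq> {..<p}" "x \<in> U" for js x
    unfolding G_def[symmetric] by (rule iterated_partial_eqI[where G = G and U = U, OF U G0 G that])
qed

text \<open>Allows the counterexample to be built with real values: \<open>of_real\<close> preserves
  norms and commutes with every partial derivative.\<close>

lemma denjoy_carleman_of_real_iff:
  fixes f :: "(nat \<Rightarrow> real) \<Rightarrow> real"
  assumes U: "openin (Euclidean_space p) U" and f: "f \<in> smooth_class p U"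
  shows "(\<lambda>x. of_real (f x) :: 'f::real_normed_algebra_1) \<in> denjoy_carleman M p U
     \<longleftrightarrow> f \<in> denjoy_carleman M p U"
proof -
  have eq: "norm (mi_deriv p \<alpha> (\<lambda>x. of_real (f x) :: 'f) y) = norm (mi_deriv p \<alpha> f y)" if "y \<in> U" for y \<alpha>
    using smooth_class_of_real(2)[OF U f set_mi_list that, where 'f = 'f]
    by (simp add: mi_deriv_eq_iterated_partial)
  have cong: "(\<forall>\<alpha>. \<forall>y\<in>V. norm (mi_deriv p \<alpha> (\<lambda>x. of_real (f x) :: 'f) y) \<le> c \<alpha>) \<longleftrightarrow>
      (\<forall>\<alpha>. \<forall>y\<in>V. norm (mi_deriv p \<alpha> f y) \<le> c \<alpha>)" if "V \<subseteq> U" for V c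
    using eq that by (metis subsetD)
  show ?thesis
    unfolding denjoy_carleman_def mem_Collect_eq
    by (intro conj_cong ball_cong arg_cong[where f = Ex] ext cong refl)
      (use smooth_class_of_real(1)[OF U f, where 'f = 'f] f in auto)
qed

subsection \<open>Power series in several variables\<close>

text \<open>For vector values there is no Lagrange remainder with a single intermediate point.
  Instead the base point \<open>s\<close> of the Taylor polynomial at \<open>y\<close> is moved: its
  derivative in \<open>s\<close> telescopes to one term, and the mean value inequality between
  \<open>x\<close> and \<open>y\<close> bounds the remainder.\<close>

lemma taylor_sums:
  fixes h :: "nat \<Rightarrow> real \<Rightarrow> 'f::real_normed_vector"
  assumes h: "\<And>k t. \<bar>t - x\<bar> < r \<Longrightarrow> (h k has_vector_derivative h (Suc k) t) (at t)"
    and b: "\<And>k t. \<bar>t - x\<bar> < r \<Longrightarrow> norm (h k t) \<le> A * C ^ k * fact k"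
    and C: "0 \<le> C" "C * r \<le> 1" and y: "\<bar>y - x\<bar> < r"
  shows "(\<lambda>k. ((y - x) ^ k / fact k) *\<^sub>R h k x) sums h 0 y"
proof -
  define R where "R n s = (\<Sum>k<n. ((y - s) ^ k / fact k) *\<^sub>R h k s)" for n s
  have R': "(R (Suc n) has_vector_derivative ((y - s) ^ n / fact n) *\<^sub>R h (Suc n) s) (at s)"
    if s: "\<bar>s - x\<bar> < r" for n s
  proof (induction n)
    case 0
    then show ?case using h[OF s, of 0] by (simp add: R_def)
  next
    case (Suc n)
    have p: "((\<lambda>s. (y - s) ^ Suc n / fact (Suc n)) has_real_derivative - ((y - s) ^ n / fact n)) (at s)"
    proof -
      have "((\<lambda>s. (y - s) ^ Suc n / fact (Suc n)) has_real_derivative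
          (real (Suc n) * (y - s) ^ n * (- 1)) / fact (Suc n)) (at s)"
        by (auto intro!: derivative_eq_intros simp del: power_Suc fact_Suc)
      moreover have "(real (Suc n) * (y - s) ^ n * (- 1)) / fact (Suc n) = - ((y - s) ^ n / fact n)"
        by (simp add: fact_Suc del: of_nat_Suc)
      ultimately show ?thesis by simp
    qed
    have "((\<lambda>s. R (Suc n) s + ((y - s) ^ Suc n / fact (Suc n)) *\<^sub>R h (Suc n) s) has_vector_derivative
       ((y - s) ^ n / fact n) *\<^sub>R h (Suc n) s +
       (((y - s) ^ Suc n / fact (Suc n)) *\<^sub>R h (Suc (Suc n)) s + (- ((y - s) ^ n / fact n)) *\<^sub>R h (Suc n) s)) (at s)"
      by (intro has_vector_derivative_add Suc has_vector_derivative_scaleR p h s)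
    then show ?case by (simp add: R_def)
  qed
  define q where "q = C * \<bar>y - x\<bar>"
  have A: "0 \<le> A"
    using order_trans[OF norm_ge_zero b[of x 0]] y by simp
  have q: "0 \<le> q" "q < 1"
  proof -
    show "0 \<le> q" using C(1) by (simp add: q_def)
    show "q < 1"
    proof (cases "C = 0")
      case False
      then have "q < C * r" using C y unfolding q_def by (intro mult_strict_left_mono) auto
      then show ?thesis using C by simp
    qed (simp add: q_def)
  qed
  \<comment> \<open>Bounding the derivative by its supremum instead of integrating costs a factor
    \<open>Suc n\<close>, harmless since \<open>n * q ^ n\<close> tends to \<open>0\<close>.\<close>
  have err: "norm (R (Suc n) y - R (Suc n) x) \<le> A * (of_nat (Suc n) * q ^ Suc n)" for n
  proof -
    have seg: "\<bar>s - x\<bar> < r \<and> \<bar>y - s\<bar> \<le> \<bar>y - x\<bar>" if "s \<in> closed_segment x y" for s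
      using that y by (auto simp: closed_segment_eq_real_ivl split: if_splits)
    have "norm (R (Suc n) y - R (Suc n) x) \<le>
        (A * C ^ Suc n * real (Suc n) * \<bar>y - x\<bar> ^ n) * norm (y - x)"
    proof (rule differentiable_bound[where S = "closed_segment x y"])
      fix s assume s: "s \<in> closed_segment x y"
      show "(R (Suc n) has_derivative (\<lambda>h'. h' *\<^sub>R (((y - s) ^ n / fact n) *\<^sub>R h (Suc n) s))) (at s within closed_segment x y)"
        using R'[of s n] seg[OF s] has_derivative_at_withinI unfolding has_vector_derivative_def by blast
      have "norm (((y - s) ^ n / fact n) *\<^sub>R h (Suc n) s) \<le> (\<bar>y - x\<bar> ^ n / fact n) * (A * C ^ Suc n * fact (Suc n))"
        unfolding norm_scaleR using seg[OF s] b[of s "Suc n"]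
        by (intro mult_mono) (auto simp: power_abs intro!: divide_right_mono power_mono)
      also have "\<dots> = A * C ^ Suc n * real (Suc n) * \<bar>y - x\<bar> ^ n"
        by (simp add: field_simps)
      finally have nb: "norm (((y - s) ^ n / fact n) *\<^sub>R h (Suc n) s) \<le> A * C ^ Suc n * real (Suc n) * \<bar>y - x\<bar> ^ n" .
      show "onorm (\<lambda>h'. h' *\<^sub>R (((y - s) ^ n / fact n) *\<^sub>R h (Suc n) s)) \<le> A * C ^ Suc n * real (Suc n) * \<bar>y - x\<bar> ^ n"
        by (rule order_trans[OF onorm_le[where b = "norm (((y - s) ^ n / fact n) *\<^sub>R h (Suc n) s)"] nb])
          (simp add: abs_mult mult_ac)
    qed auto
    also have "\<dots> = A * (of_nat (Suc n) * q ^ Suc n)"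
      by (simp add: q_def power_mult_distrib field_simps)
    finally show ?thesis .
  qed
  have "(\<lambda>n. of_nat n * q ^ n) \<longlonglongrightarrow> 0"
    by (rule powser_times_n_limit_0) (use q in auto)
  from tendsto_mult_left[OF this, of A]
  have "(\<lambda>n. A * (of_nat n * q ^ n)) \<longlonglongrightarrow> 0" by simp
  then have lim: "(\<lambda>n. A * (of_nat (Suc n) * q ^ Suc n)) \<longlonglongrightarrow> 0"
    by (rule filterlim_compose[OF _ filterlim_Suc])
  have "R (Suc n) y = h 0 y" for n
    by (simp add: R_def sum.lessThan_Suc_shift del: sum.lessThan_Suc)
  then have "(\<lambda>n. h 0 y - R (Suc n) x) \<longlonglongrightarrow> 0"
    using err by (intro Lim_null_comparison[OF _ lim] always_eventually) auto
  from tendsto_diff[OF tendsto_const[of "h 0 y"] this]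
  have "(\<lambda>n. R (Suc n) x) \<longlonglongrightarrow> h 0 y" by simp
  then have "(\<lambda>n. R n x) \<longlonglongrightarrow> h 0 y" by (rule LIMSEQ_imp_Suc)
  then show ?thesis by (simp add: sums_def R_def)
qed

section \<open>Sums over multi-indices\<close>

definition multi_indices :: "nat \<Rightarrow> (nat \<Rightarrow> nat) set" where
  "multi_indices p = {\<alpha>. \<forall>i\<ge>p. \<alpha> i = 0}"

lemma multi_indices_0: "multi_indices 0 = {\<lambda>_. 0}"
  by (auto simp: multi_indices_def)

lemma bij_multi_indices_Suc:
  "bij_betw (\<lambda>(k, \<beta>). \<beta>(p := k)) (UNIV \<times> multi_indices p) (multi_indices (Suc p))"
proof (rule bij_betw_byWitness[where f' = "\<lambda>\<alpha>. (\<alpha> p, \<alpha>(p := 0))"])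
  show "\<forall>a\<in>UNIV \<times> multi_indices p. (\<lambda>\<alpha>. (\<alpha> p, \<alpha>(p := 0))) ((\<lambda>(k, \<beta>). \<beta>(p := k)) a) = a"
    by (auto simp: multi_indices_def)
  show "(\<lambda>\<alpha>. (\<alpha> p, \<alpha>(p := 0))) ` multi_indices (Suc p) \<subseteq> UNIV \<times> multi_indices p"
    by (force simp: multi_indices_def)
qed (auto simp: multi_indices_def)

lemma countable_multi_indices: "countable (multi_indices p)"
proof (induction p)
  case (Suc p)
  then show ?case
    using countable_image[of "UNIV \<times> multi_indices p"] bij_betw_imp_surj_on[OF bij_multi_indices_Suc[of p]]
    by (metis countable_SIGMA countableI_type)
qed (simp add: multi_indices_0)

lemma infinite_multi_indices:
  assumes "1 \<le> p"
  shows "infinite (multi_indices p)"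
proof
  assume "finite (multi_indices p)"
  moreover have "(\<lambda>k i. if i = 0 then k else 0) ` UNIV \<subseteq> multi_indices p"
    using assms by (auto simp: multi_indices_def)
  ultimately have "finite (range (\<lambda>k i::nat. if i = 0 then k else 0 :: nat))"
    using finite_subset by blast
  moreover have "inj (\<lambda>k i::nat. if i = 0 then k else 0 :: nat)"
    by (auto simp: inj_def fun_eq_iff split: if_splits)
  ultimately show False using finite_imageD by blast
qed

lemma summable_geometric_multi:
  fixes q :: real
  assumes "0 \<le> q" "q < 1"
  shows "(\<lambda>\<alpha>. \<Prod>i<p. q ^ \<alpha> i) summable_on multi_indices p"
proof (induction p)
  case 0
  then show ?case by (simp add: multi_indices_0)
next
  case (Suc p)
  have "(\<lambda>(k, \<beta>). q ^ k * (\<Prod>i<p. q ^ \<beta> i)) summable_on (UNIV \<times> multi_indices p)"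
  proof (rule summable_on_SigmaI)
    show "((\<lambda>\<beta>. case (k, \<beta>) of (k, \<beta>) \<Rightarrow> q ^ k * (\<Prod>i<p. q ^ \<beta> i)) has_sum
       q ^ k * infsum (\<lambda>\<alpha>. \<Prod>i<p. q ^ \<alpha> i) (multi_indices p)) (multi_indices p)" for k
      using has_sum_cmult_right[OF has_sum_infsum[OF Suc]] by simp
    have "(\<lambda>k. q ^ k) summable_on UNIV"
      using assms by (subst summable_on_UNIV_nonneg_real_iff) (auto intro: summable_geometric)
    then show "(\<lambda>k. q ^ k * infsum (\<lambda>\<alpha>. \<Prod>i<p. q ^ \<alpha> i) (multi_indices p)) summable_on UNIV"
      by (rule summable_on_cmult_left)
  qed (use assms in \<open>auto intro!: mult_nonneg_nonneg prod_nonneg\<close>)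
  also have "(\<lambda>(k, \<beta>). q ^ k * (\<Prod>i<p. q ^ \<beta> i)) =
      (\<lambda>a. \<Prod>i<Suc p. q ^ (case a of (k, \<beta>) \<Rightarrow> \<beta>(p := k)) i)"
    by (auto simp: fun_eq_iff)
  finally show ?case
    by (subst (asm) summable_on_reindex_bij_betw[OF bij_multi_indices_Suc])
qed

text \<open>Induction on the number \<open>q\<close> of coordinates in which \<open>y\<close> may
  differ from \<open>x\<close>. The last one is expanded by the one-variable series; its
  coefficients are again derivatives of \<open>f\<close>, now at a point with one more coordinate
  equal to that of \<open>x\<close>, which is why the claim is made for all
  \<open>js\<close>.\<close>

lemma taylor_has_sum:
  fixes f :: "(nat \<Rightarrow> real) \<Rightarrow> 'f::banach"
  assumes f: "f \<in> smooth_class p U" "coord_box p x r \<subseteq> U" "x \<in> RR p"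
    and C: "0 \<le> C" "C * r < 1"
    and "q \<le> p" "set js \<subseteq> {..<p}"
    and "\<And>\<alpha> y. y \<in> coord_box p x r \<Longrightarrow>
      norm (mi_deriv q \<alpha> (iterated_partial js f) y) \<le> A * (\<Prod>i<q. C ^ \<alpha> i * fact (\<alpha> i))"
    and "y \<in> coord_box p x r" "\<And>i. i \<ge> q \<Longrightarrow> y i = x i"
  shows "((\<lambda>\<alpha>. (\<Prod>i<q. (y i - x i) ^ \<alpha> i / fact (\<alpha> i)) *\<^sub>R mi_deriv q \<alpha> (iterated_partial js f) x)
     has_sum iterated_partial js f y) (multi_indices q)"
  using assms(6-)
proof (induction q arbitrary: js A y)
  case 0
  then have "y = x" by auto
  then show ?case
    using has_sum_finite[of "{\<lambda>_. 0}" "\<lambda>_. iterated_partial js f x"] by (simp add: multi_indices_0)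
next
  case (Suc q)
  define g where "g = iterated_partial js f"
  define h where "h k t = iterated_partial (replicate k q @ js) f (y(q := t))" for k t
  have qp: "q < p" using Suc.prems by simp
  have js: "set (replicate k q @ js) \<subseteq> {..<p}" for k
    using Suc.prems(2) qp by auto
  have h_eq: "iterated_partial (replicate k q @ js) f = (partial_deriv q ^^ k) g" for k
    by (simp add: iterated_partial_append iterated_partial_replicate g_def)
  have r: "r > 0" using Suc.prems(4) qp by (auto simp: coord_box_def)
  have coord_box: "y(q := t) \<in> coord_box p x r" if "\<bar>t - x q\<bar> < r" for t
    using Suc.prems(4) that qp by (auto simp: coord_box_def update_in_RR)
  have A: "0 \<le> A"
  proof -
    have "norm (mi_deriv (Suc q) (\<lambda>_. 0) g y) \<le> A * (\<Prod>i<Suc q. C ^ 0 * fact 0)"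
      using Suc.prems(3)[OF Suc.prems(4), of "\<lambda>_. 0"] unfolding g_def .
    then show ?thesis by simp (meson norm_ge_zero order_trans)
  qed
  have bound: "norm ((partial_deriv q ^^ k) g z) \<le> A * C ^ k * fact k" if "z \<in> coord_box p x r" for k z
  proof -
    define \<alpha> where "\<alpha> = (\<lambda>i. if i = q then k else 0)"
    have "mi_deriv (Suc q) \<alpha> g = mi_deriv q \<alpha> ((partial_deriv q ^^ k) g)" by (simp add: \<alpha>_def)
    also have "\<dots> = (partial_deriv q ^^ k) g" by (rule mi_deriv_0) (simp add: \<alpha>_def)
    finally have "norm ((partial_deriv q ^^ k) g z) \<le> A * (\<Prod>i<Suc q. C ^ \<alpha> i * fact (\<alpha> i))"
      using Suc.prems(3)[OF that, of \<alpha>] unfolding g_def by simp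
    also have "(\<Prod>i<q. C ^ \<alpha> i * fact (\<alpha> i)) = 1"
      by (rule prod.neutral) (simp add: \<alpha>_def)
    then have "A * (\<Prod>i<Suc q. C ^ \<alpha> i * fact (\<alpha> i)) = A * C ^ k * fact k"
      by (simp add: \<alpha>_def)
    finally show ?thesis .
  qed
  have yq: "\<bar>y q - x q\<bar> < r" using Suc.prems(4) qp by (auto simp: coord_box_def)
  have "(\<lambda>k. ((y q - x q) ^ k / fact k) *\<^sub>R h k (x q)) sums h 0 (y q)"
  proof (rule taylor_sums[where A = A and C = C and r = r])
    show "(h k has_vector_derivative h (Suc k) t) (at t)" if "\<bar>t - x q\<bar> < r" for k t
    proof -
      have "y(q := t) \<in> U" using coord_box[OF that] f(2) by blast
      from smooth_class_has_deriv[OF f(1) js[of k] this qp]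
      show ?thesis by (simp add: h_def[abs_def])
    qed
    show "norm (h k t) \<le> A * C ^ k * fact k" if "\<bar>t - x q\<bar> < r" for k t
      unfolding h_def h_eq by (rule bound[OF coord_box[OF that]])
  qed (use C yq in auto)
  moreover have "summable (\<lambda>k. norm (((y q - x q) ^ k / fact k) *\<^sub>R h k (x q)))"
  proof (rule summable_comparison_test')
    have "summable (\<lambda>k. (C * \<bar>y q - x q\<bar>) ^ k)"
      by (rule summable_geometric)
        (use mult_left_mono[OF less_imp_le[OF yq] C(1)] C in \<open>auto simp: abs_mult\<close>)
    then show "summable (\<lambda>k. A * (C * \<bar>y q - x q\<bar>) ^ k)" by (rule summable_mult)
    fix k
    have "norm (h k (x q)) \<le> A * C ^ k * fact k"
      unfolding h_def h_eq by (rule bound[OF coord_box]) (use r in auto)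
    then have "(\<bar>y q - x q\<bar> ^ k / fact k) * norm (h k (x q)) \<le> (\<bar>y q - x q\<bar> ^ k / fact k) * (A * C ^ k * fact k)"
      by (intro mult_left_mono) auto
    then show "norm (norm (((y q - x q) ^ k / fact k) *\<^sub>R h k (x q))) \<le> A * (C * \<bar>y q - x q\<bar>) ^ k"
      by (simp add: power_mult_distrib power_abs mult.commute mult.left_commute)
  qed
  ultimately have outer: "((\<lambda>k. ((y q - x q) ^ k / fact k) *\<^sub>R h k (x q)) has_sum g y) UNIV"
    using norm_summable_imp_has_sum by (fastforce simp: h_def g_def)
  define F where "F \<alpha> = (\<Prod>i<Suc q. (y i - x i) ^ \<alpha> i / fact (\<alpha> i)) *\<^sub>R mi_deriv (Suc q) \<alpha> g x" for \<alpha>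
  have inner: "((\<lambda>\<beta>. F (case (k, \<beta>) of (k, \<beta>) \<Rightarrow> \<beta>(q := k))) has_sum ((y q - x q) ^ k / fact k) *\<^sub>R h k (x q))
     (multi_indices q)" for k
  proof -
    have mi: "mi_deriv q \<beta> (iterated_partial (replicate k q @ js) f) = mi_deriv (Suc q) (\<beta>(q := k)) g" for \<beta>
      unfolding h_eq by (simp, rule mi_deriv_cong, simp)
    have "((\<lambda>\<beta>. (\<Prod>i<q. ((y(q := x q)) i - x i) ^ \<beta> i / fact (\<beta> i)) *\<^sub>R
        mi_deriv q \<beta> (iterated_partial (replicate k q @ js) f) x)
        has_sum iterated_partial (replicate k q @ js) f (y(q := x q))) (multi_indices q)"
    \<comment> \<open>The \<open>k\<close> derivatives in direction \<open>q\<close> are paid for by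
      the constant, so the rate \<open>C\<close> stays the same.\<close>
    proof (rule Suc.IH[where A = "A * (C ^ k * fact k)"])
      fix \<alpha> z assume z: "z \<in> coord_box p x r"
      have "norm (mi_deriv (Suc q) (\<alpha>(q := k)) g z) \<le> A * (\<Prod>i<Suc q. C ^ (\<alpha>(q := k)) i * fact ((\<alpha>(q := k)) i))"
        using Suc.prems(3)[OF z, of "\<alpha>(q := k)"] unfolding g_def .
      then show "norm (mi_deriv q \<alpha> (iterated_partial (replicate k q @ js) f) z)
         \<le> A * (C ^ k * fact k) * (\<Prod>i<q. C ^ \<alpha> i * fact (\<alpha> i))"
        unfolding mi by (simp add: mult_ac)
    next
      show "(y(q := x q)) i = x i" if "i \<ge> q" for i using Suc.prems(5)[of i] that by auto
      show "y(q := x q) \<in> coord_box p x r" using coord_box[of "x q"] r by simp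
    qed (use qp js in auto)
    from has_sum_bounded_linear[OF bounded_linear_scaleR_right this, of "(y q - x q) ^ k / fact k"]
    have "((\<lambda>\<beta>. ((y q - x q) ^ k / fact k) *\<^sub>R (\<Prod>i<q. ((y(q := x q)) i - x i) ^ \<beta> i / fact (\<beta> i)) *\<^sub>R
        mi_deriv (Suc q) (\<beta>(q := k)) g x) has_sum ((y q - x q) ^ k / fact k) *\<^sub>R h k (x q)) (multi_indices q)"
      unfolding mi h_def by (simp add: o_def)
    then show ?thesis
      by (simp add: F_def mult.commute del: mi_deriv.simps)
  qed
  \<comment> \<open>Iterated sums give the joint sum only under summability over all multi-indices;
    a product of geometric series with ratio \<open>C * r\<close> dominates.\<close>
  have "F summable_on multi_indices (Suc q)"
  proof (rule abs_summable_summable, rule Infinite_Sum.abs_summable_on_comparison_test')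
    show "(\<lambda>\<alpha>. A * (\<Prod>i<Suc q. (C * r) ^ \<alpha> i)) summable_on multi_indices (Suc q)"
      by (intro summable_on_cmult_right summable_geometric_multi) (use C r in auto)
    fix \<alpha>
    have "norm (F \<alpha>) \<le> (\<Prod>i<Suc q. r ^ \<alpha> i / fact (\<alpha> i)) * (A * (\<Prod>i<Suc q. C ^ \<alpha> i * fact (\<alpha> i)))"
      unfolding F_def norm_scaleR
    proof (rule mult_mono)
      show "norm (mi_deriv (Suc q) \<alpha> g x) \<le> A * (\<Prod>i<Suc q. C ^ \<alpha> i * fact (\<alpha> i))"
        using Suc.prems(3)[OF coord_box_center[OF f(3) r], of \<alpha>] unfolding g_def .
      have "\<bar>y i - x i\<bar> ^ \<alpha> i \<le> r ^ \<alpha> i" if "i < Suc q" for i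
        using Suc.prems(1,4) that by (intro power_mono) (auto simp: coord_box_def less_imp_le)
      then show "\<bar>\<Prod>i<Suc q. (y i - x i) ^ \<alpha> i / fact (\<alpha> i)\<bar> \<le> (\<Prod>i<Suc q. r ^ \<alpha> i / fact (\<alpha> i))"
        unfolding abs_prod by (intro prod_mono) (auto simp: power_abs divide_right_mono)
    qed (use r in \<open>auto intro!: prod_nonneg simp del: prod.lessThan_Suc\<close>)
    also have "\<dots> = A * (\<Prod>i<Suc q. (C * r) ^ \<alpha> i)"
      unfolding mult.left_commute[of _ A] prod.distrib[symmetric]
      by (intro arg_cong2[where f = "(*)"] prod.cong) (auto simp: power_mult_distrib)
    finally show "norm (F \<alpha>) \<le> A * (\<Prod>i<Suc q. (C * r) ^ \<alpha> i)" .
  qed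
  then have "(\<lambda>a. F (case a of (k, \<beta>) \<Rightarrow> \<beta>(q := k))) summable_on (UNIV \<times> multi_indices q)"
    by (subst summable_on_reindex_bij_betw[OF bij_multi_indices_Suc])
  from has_sum_SigmaI[OF inner outer this]
  have "(F has_sum g y) (multi_indices (Suc q))"
    by (subst (asm) has_sum_reindex_bij_betw[OF bij_multi_indices_Suc])
  then show ?case unfolding F_def g_def .
qed

lemma binomial_le_power_two: "real (n choose k) \<le> 2 ^ n"
  using of_nat_mono[OF binomial_le_pow2[of n k], where 'a = real] by simp

text \<open>Every binomial coefficient that arises on adding a coordinate is at most a power of two.
  The loss is geometric, so it only shrinks the radius of convergence.\<close>

lemma fact_sum_le_prod: "fact (\<Sum>i<p. \<alpha> i) \<le> (2::real) ^ (p * (\<Sum>i<p. \<alpha> i)) * (\<Prod>i<p. fact (\<alpha> i))"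
proof (induction p)
  case (Suc p)
  let ?n = "\<Sum>i<p. \<alpha> i"
  have "(fact (?n + \<alpha> p) :: real) = fact ?n * fact (\<alpha> p) * real ((?n + \<alpha> p) choose ?n)"
    using binomial_fact[of ?n "?n + \<alpha> p", where 'a = real] by simp
  also have "\<dots> \<le> fact ?n * fact (\<alpha> p) * 2 ^ (?n + \<alpha> p)"
    by (intro mult_left_mono binomial_le_power_two) auto
  also have "\<dots> \<le> (2 ^ (p * ?n) * (\<Prod>i<p. fact (\<alpha> i))) * fact (\<alpha> p) * 2 ^ (?n + \<alpha> p)"
    by (intro mult_right_mono Suc) auto
  also have "\<dots> = 2 ^ (p * ?n + (?n + \<alpha> p)) * (\<Prod>i<Suc p. fact (\<alpha> i))"
    by (simp add: power_add mult_ac)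
  also have "\<dots> \<le> 2 ^ (Suc p * (?n + \<alpha> p)) * (\<Prod>i<Suc p. fact (\<alpha> i))"
    by (intro mult_right_mono power_increasing prod_nonneg) (auto simp: algebra_simps)
  finally show ?case by simp
qed simp

lemma prod_fact_le_fact_sum:
  fixes p :: nat and \<alpha> :: "nat \<Rightarrow> nat"
  shows "(\<Prod>i<p. fact (\<alpha> i)) \<le> (fact (\<Sum>i<p. \<alpha> i) :: real)"
proof (induction p)
  case (Suc p)
  let ?n = "\<Sum>i<p. \<alpha> i"
  have "(\<Prod>i<Suc p. fact (\<alpha> i)) \<le> (fact ?n * fact (\<alpha> p) :: real)"
    using Suc by (simp add: mult_right_mono)
  also have "(fact ?n * fact (\<alpha> p) :: nat) \<le> fact (?n + \<alpha> p)"
    by (rule dvd_imp_le[OF fact_fact_dvd_fact]) simp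
  then have "fact ?n * fact (\<alpha> p) \<le> (fact (?n + \<alpha> p) :: real)"
    by (metis of_nat_fact of_nat_le_iff of_nat_mult)
  finally show ?case by simp
qed simp

lemma denjoy_carleman_subset_analytic:
  fixes M :: "nat \<Rightarrow> real"
  assumes M: "\<And>n. 0 < M n" "\<And>n. M n \<le> R ^ n" and U: "openin (Euclidean_space p) U"
    and f: "f \<in> denjoy_carleman M p U"
  shows "(f :: (nat \<Rightarrow> real) \<Rightarrow> 'f::banach) \<in> analytic_class p U"
  unfolding analytic_class_def
proof (intro CollectI ballI)
  fix x assume x: "x \<in> U"
  have R: "R > 0" using M(1)[of 1] M(2)[of 1] by simp
  have sm: "f \<in> smooth_class p U" using f by (simp add: denjoy_carleman_def)
  obtain V A B where V: "openin (Euclidean_space p) V" "x \<in> V" "V \<subseteq> U" "0 < A" "0 < B"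
    and b: "\<And>\<alpha> y. y \<in> V \<Longrightarrow> norm (mi_deriv p \<alpha> f y)
          \<le> A * B ^ mi_size p \<alpha> * fact (mi_size p \<alpha>) * M (mi_size p \<alpha>)"
    using denjoy_carleman_bounds[OF f x] by metis
  obtain r' where r': "r' > 0" "coord_box p x r' \<subseteq> V" using coord_box_subset_open[OF V(1,2)] .
  \<comment> \<open>\<open>R\<close> comes from the geometric bound on \<open>M\<close>, and
    \<open>2 ^ p\<close> from replacing the factorial of the total order by the product of
    factorials.\<close>
  define C where "C = B * R * 2 ^ p"
  have C: "C > 0" using V(5) R by (simp add: C_def)
  define r where "r = min r' (1 / (2 * C))"
  have r: "r > 0" "coord_box p x r \<subseteq> V" "C * r < 1"
  proof -
    show "r > 0" using C r' by (simp add: r_def)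
    show "coord_box p x r \<subseteq> V" using coord_box_mono[of r r' p x] r' by (auto simp: r_def)
    have "C * r \<le> C * (1 / (2 * C))" using C by (intro mult_left_mono) (auto simp: r_def)
    then show "C * r < 1" using C by simp
  qed
  have xR: "x \<in> RR p" using openin_imp_RR[OF U x] .
  have bound: "norm (mi_deriv p \<alpha> f y) \<le> A * (\<Prod>i<p. C ^ \<alpha> i * fact (\<alpha> i))" if "y \<in> coord_box p x r" for \<alpha> y
  proof -
    let ?n = "mi_size p \<alpha>"
    have "norm (mi_deriv p \<alpha> f y) \<le> A * B ^ ?n * fact ?n * M ?n"
      using b that r(2) by blast
    also have "\<dots> \<le> A * B ^ ?n * fact ?n * R ^ ?n"
      using M V by (intro mult_left_mono) auto
    also have "\<dots> \<le> A * B ^ ?n * (2 ^ (p * ?n) * (\<Prod>i<p. fact (\<alpha> i))) * R ^ ?n"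
      using V R fact_sum_le_prod[of \<alpha> p] by (intro mult_left_mono mult_right_mono) (auto simp: mi_size_def)
    also have "\<dots> = A * (C ^ ?n * (\<Prod>i<p. fact (\<alpha> i)))"
      by (simp add: C_def power_mult_distrib power_mult mult_ac)
    also have "C ^ ?n = (\<Prod>i<p. C ^ \<alpha> i)" by (simp add: mi_size_def power_sum)
    finally show ?thesis by (simp add: prod.distrib)
  qed
  have "((\<lambda>\<alpha>. (\<Prod>i<p. (y i - x i) ^ \<alpha> i) *\<^sub>R ((1 / (\<Prod>i<p. fact (\<alpha> i))) *\<^sub>R mi_deriv p \<alpha> f x)) has_sum f y)
        {\<alpha> :: nat \<Rightarrow> nat. \<forall>i\<ge>p. \<alpha> i = 0}" if y: "y \<in> coord_box p x r" for y
  proof -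
    have "((\<lambda>\<alpha>. (\<Prod>i<p. (y i - x i) ^ \<alpha> i / fact (\<alpha> i)) *\<^sub>R mi_deriv p \<alpha> (iterated_partial [] f) x)
     has_sum iterated_partial [] f y) (multi_indices p)"
    proof (rule taylor_has_sum[where r = r and C = C and A = A])
      show "y i = x i" if "i \<ge> p" for i using that y xR by (auto simp: coord_box_def RR_iff)
    qed (use smooth_class_subset[OF sm V(3)] r C bound y xR in auto)
    then show ?thesis by (simp add: multi_indices_def prod_dividef)
  qed
  then show "\<exists>V c. openin (Euclidean_space p) V \<and> x \<in> V \<and> V \<subseteq> U \<and>
     (\<forall>y\<in>V. ((\<lambda>\<alpha>. (\<Prod>i<p. (y i - x i) ^ \<alpha> i) *\<^sub>R c \<alpha>) has_sum f y)
        {\<alpha> :: nat \<Rightarrow> nat. \<forall>i\<ge>p. \<alpha> i = 0})"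
    using openin_coord_box[of p x r] coord_box_center[OF xR r(1)] r(2) V(3)
    by (intro exI[of _ "coord_box p x r"] exI[of _ "\<lambda>\<alpha>. (1 / (\<Prod>i<p. fact (\<alpha> i))) *\<^sub>R mi_deriv p \<alpha> f x"]) auto
qed

section \<open>Products of functions of single coordinates, and Cauchy estimates for power
  series\<close>

lemma prod_has_vector_derivative:
  fixes \<Phi> :: "nat \<Rightarrow> nat \<Rightarrow> real \<Rightarrow> real" and c :: "'f::real_normed_vector"
  assumes \<Phi>: "\<And>j k t. (\<Phi> j k has_real_derivative \<Phi> j (Suc k) t) (at t)" and i: "i < p"
  shows "((\<lambda>t. (\<Prod>j<p. \<Phi> j (count_list js j) ((x(i := t)) j)) *\<^sub>R c) has_vector_derivative
     (\<Prod>j<p. \<Phi> j (count_list (i # js) j) (x j)) *\<^sub>R c) (at (x i))"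
proof -
  define P where "P = (\<Prod>j\<in>{..<p} - {i}. \<Phi> j (count_list js j) (x j))"
  \<comment> \<open>Only the factor with index \<open>i\<close> varies with \<open>t\<close>; hence
    a mixed derivative depends on \<open>js\<close> only through the number of occurrences of each
    direction.\<close>
  have "(\<Prod>j<p. \<Phi> j (count_list js j) ((x(i := t)) j)) = \<Phi> i (count_list js i) t * P" for t
    unfolding P_def by (subst prod.remove[of _ i]) (auto simp: i intro!: prod.cong)
  moreover have "(\<Prod>j<p. \<Phi> j (count_list (i # js) j) (x j)) = \<Phi> i (Suc (count_list js i)) (x i) * P"
    unfolding P_def by (subst prod.remove[of _ i]) (auto simp: i intro!: prod.cong)
  moreover have "((\<lambda>t. (\<Phi> i (count_list js i) t * P) *\<^sub>R c) has_vector_derivative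
      (\<Phi> i (Suc (count_list js i)) (x i) * P) *\<^sub>R c) (at (x i))"
    using has_vector_derivative_scaleR[OF DERIV_cmult_right[OF \<Phi>] has_vector_derivative_const]
    by simp
  ultimately show ?thesis by (simp only:)
qed

lemma continuous_on_prod_coordinates:
  fixes \<Phi> :: "nat \<Rightarrow> nat \<Rightarrow> real \<Rightarrow> real" and c :: "'f::real_normed_vector"
  assumes \<Phi>: "\<And>j k t. (\<Phi> j k has_real_derivative \<Phi> j (Suc k) t) (at t)"
  shows "continuous_on S (\<lambda>x. (\<Prod>j<p. \<Phi> j (k j) (x j)) *\<^sub>R c)"
proof -
  have "continuous_on UNIV (\<Phi> j k)" for j k
    by (rule continuous_at_imp_continuous_on) (simp add: DERIV_isCont[OF \<Phi>])
  then have "continuous_on S (\<lambda>x. \<Phi> j k (x j))" for j k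
    by (rule continuous_on_compose2[OF _ continuous_on_product_then_coordinatewise[OF continuous_on_id] subset_UNIV])
  then show ?thesis by (intro continuous_intros)
qed

text \<open>The \<open>k\<close>-th derivative of the monomial \<open>t ^ a\<close>.\<close>

definition power_deriv :: "nat \<Rightarrow> nat \<Rightarrow> real \<Rightarrow> real" where
  "power_deriv a k t = (if k \<le> a then fact a / fact (a - k) * t ^ (a - k) else 0)"

lemma has_real_derivative_power_deriv:
  "((\<lambda>t. power_deriv a k (t - x)) has_real_derivative power_deriv a (Suc k) (t - x)) (at t)"
proof (cases "Suc k \<le> a")
  case True
  then have "a - k = Suc (a - Suc k)" by simp
  then have "((\<lambda>t. fact a / fact (a - k) * (t - x) ^ (a - k)) has_real_derivative
     fact a / fact (a - Suc k) * (t - x) ^ (a - Suc k)) (at t)"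
  proof -
    have "((\<lambda>t. fact a / fact (a - k) * (t - x) ^ (a - k)) has_real_derivative
       fact a / fact (Suc (a - Suc k)) * (real (Suc (a - Suc k)) * (t - x) ^ (a - Suc k))) (at t)"
      unfolding \<open>a - k = Suc (a - Suc k)\<close>
      by (auto intro!: derivative_eq_intros simp del: power_Suc fact_Suc)
    then show ?thesis by (simp add: fact_Suc del: of_nat_Suc)
  qed
  then show ?thesis using True by (simp add: power_deriv_def)
next
  case False
  then have "power_deriv a k = (\<lambda>_. if k \<le> a then fact a else 0)"
    by (auto simp: power_deriv_def fun_eq_iff)
  then show ?thesis using False by (simp add: power_deriv_def)
qed

text \<open>Since \<open>fact a / fact (a - k)\<close> is \<open>fact k\<close> times a binomial
  coefficient, at most \<open>2 ^ a\<close>, the bound splits into a Cauchy factor in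
  \<open>k\<close> and a geometric factor in \<open>a\<close>.\<close>

lemma power_deriv_le:
  assumes "\<bar>t\<bar> \<le> s" "s > 0"
  shows "\<bar>power_deriv a k t\<bar> \<le> (fact k * (1 / s) ^ k) * (2 * s) ^ a"
proof (cases "k \<le> a")
  case True
  have "(fact a :: real) = fact k * fact (a - k) * real (a choose k)"
    using binomial_fact[OF True, where 'a = real] by simp
  then have eq: "fact a / fact (a - k) = (fact k * real (a choose k) :: real)" by (simp add: field_simps)
  have "\<bar>power_deriv a k t\<bar> \<le> (fact k * 2 ^ a) * s ^ (a - k)"
    using assms True
    by (auto simp: power_deriv_def eq abs_mult power_abs intro!: mult_mono power_mono binomial_le_power_two)
  also have "\<dots> = (fact k * (1 / s) ^ k) * (2 * s) ^ a"
    using assms True by (simp add: power_diff field_simps power_mult_distrib)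
  finally show ?thesis .
qed (use assms in \<open>auto simp: power_deriv_def\<close>)

text \<open>Convergence at the corner \<open>z\<close> bounds the coefficients by a multiple of
  powers of \<open>1 / (4 * s)\<close>. On the box of radius \<open>s\<close> the differentiated
  monomials grow at most like powers of \<open>2 * s\<close>, so the series of derivatives is
  dominated by one with ratio \<open>1/2\<close>.\<close>

lemma analytic_imp_local_bounds:
  fixes f :: "(nat \<Rightarrow> real) \<Rightarrow> 'f::banach"
  assumes p: "1 \<le> p" and U: "openin (Euclidean_space p) U" and f: "f \<in> analytic_class p U" and x: "x \<in> U"
  obtains W A B where "openin (Euclidean_space p) W" "x \<in> W" "W \<subseteq> U" "0 < A" "0 < B"
    "f \<in> smooth_class p W"
    "\<And>\<alpha> y. y \<in> W \<Longrightarrow> norm (mi_deriv p \<alpha> f y) \<le> A * B ^ mi_size p \<alpha> * fact (mi_size p \<alpha>)"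
proof -
  obtain V c where V: "openin (Euclidean_space p) V" "x \<in> V" "V \<subseteq> U"
    and c: "\<And>y. y \<in> V \<Longrightarrow> ((\<lambda>\<alpha>. (\<Prod>i<p. (y i - x i) ^ \<alpha> i) *\<^sub>R c \<alpha>) has_sum f y) (multi_indices p)"
  proof -
    have "\<forall>x\<in>U. \<exists>V c. openin (Euclidean_space p) V \<and> x \<in> V \<and> V \<subseteq> U \<and>
      (\<forall>y\<in>V. ((\<lambda>\<alpha>. (\<Prod>i<p. (y i - x i) ^ \<alpha> i) *\<^sub>R c \<alpha>) has_sum f y) (multi_indices p))"
      using f by (simp add: analytic_class_def multi_indices_def)
    from bspec[OF this x] show thesis
      by (elim exE conjE) (rule that, (assumption | erule (1) bspec)+)
  qed
  obtain r where r: "r > 0" "coord_box p x r \<subseteq> V" using coord_box_subset_open[OF V(1,2)] .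
  have xR: "x \<in> RR p" using openin_imp_RR[OF U x] .
  \<comment> \<open>Then \<open>4 * s = r / 2\<close>, and the corner \<open>z\<close> still lies in
    the box of radius \<open>r\<close>.\<close>
  define s where "s = r / 8"
  have s: "s > 0" using r by (simp add: s_def)
  \<comment> \<open>\<open>has_sum\<close> does not depend on the order, so any enumeration turns it
    into an ordinary series; \<open>1 \<le> p\<close> makes the index set infinite.\<close>
  define e where "e = from_nat_into (multi_indices p)"
  have bij: "bij_betw e UNIV (multi_indices p)"
    unfolding e_def by (intro bij_betw_from_nat_into countable_multi_indices infinite_multi_indices p)
  have sums: "(\<lambda>n. (\<Prod>i<p. (y i - x i) ^ e n i) *\<^sub>R c (e n)) sums f y" if "y \<in> V" for y
    using c[OF that] by (subst (asm) has_sum_reindex_bij_betw[OF bij, symmetric]) (rule has_sum_imp_sums)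
  define z where "z i = (if i < p then x i + 4 * s else 0)" for i
  have "z \<in> V" using r s by (auto simp: z_def coord_box_def RR_iff s_def intro!: subsetD[OF r(2)])
  from summable_LIMSEQ_zero[OF sums_summable[OF sums[OF this]]]
  have "Bseq (\<lambda>n. (\<Prod>i<p. (z i - x i) ^ e n i) *\<^sub>R c (e n))"
    by (intro convergent_imp_Bseq convergentI)
  then obtain K where K: "K > 0" "\<And>n. norm ((\<Prod>i<p. (z i - x i) ^ e n i) *\<^sub>R c (e n)) \<le> K"
    by (auto simp: Bseq_def)
  have Kc: "norm (c (e n)) \<le> K * (\<Prod>i<p. (1 / (4 * s)) ^ e n i)" for n
  proof -
    have "(\<Prod>i<p. (z i - x i) ^ e n i) = (\<Prod>i<p. (4 * s) ^ e n i)" by (simp add: z_def)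
    moreover have "(0::real) \<le> (\<Prod>i<p. (4 * s) ^ e n i)" using s by (intro prod_nonneg) auto
    ultimately have "(\<Prod>i<p. (4 * s) ^ e n i) * norm (c (e n)) \<le> K"
      using K(2)[of n] by (simp only: norm_scaleR real_norm_def abs_of_nonneg)
    then have "(\<Prod>i<p. (1 / (4 * s)) ^ e n i) * ((\<Prod>i<p. (4 * s) ^ e n i) * norm (c (e n)))
       \<le> (\<Prod>i<p. (1 / (4 * s)) ^ e n i) * K"
      using s by (intro mult_left_mono prod_nonneg) auto
    moreover have "(\<Prod>i<p. (1 / (4 * s)) ^ e n i) * (\<Prod>i<p. (4 * s) ^ e n i) = 1"
      unfolding prod.distrib[symmetric] power_mult_distrib[symmetric] using s
      by (intro prod.neutral) simp
    ultimately show ?thesis unfolding mult.assoc[symmetric] by (simp only: mult.commute mult_1_left)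
  qed
  define W where "W = coord_box p x s"
  have W: "openin (Euclidean_space p) W" "x \<in> W" "W \<subseteq> V"
    using openin_coord_box coord_box_center[OF xR s] coord_box_mono[of s r p x] r s by (auto simp: W_def s_def)
  define \<Phi> where "\<Phi> n j k t = power_deriv (e n j) k (t - x j)" for n j k t
  have \<Phi>: "(\<Phi> n j k has_real_derivative \<Phi> n j (Suc k) t) (at t)" for n j k t
    unfolding \<Phi>_def[abs_def] by (rule has_real_derivative_power_deriv)
  define F where "F n js y = (\<Prod>j<p. \<Phi> n j (count_list js j) (y j)) *\<^sub>R c (e n)" for n js y
  define G where "G js = (\<Prod>j<p. fact (count_list js j) * (1 / s) ^ count_list js j)" for js
  have G0: "G js \<ge> 0" for js unfolding G_def using s by (intro prod_nonneg) auto
  have Fb: "norm (F n js y) \<le> K * G js * (\<Prod>j<p. (1/2) ^ e n j)" if y: "y \<in> W" for n js y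
  proof -
    have \<Phi>_le: "\<bar>\<Phi> n j k (y j)\<bar> \<le> (fact k * (1 / s) ^ k) * (2 * s) ^ e n j" if "j < p" for j k
      unfolding \<Phi>_def using y s that
      by (intro power_deriv_le) (auto simp: W_def coord_box_def less_imp_le)
    have "norm (F n js y) \<le> (\<Prod>j<p. (fact (count_list js j) * (1 / s) ^ count_list js j) * (2 * s) ^ e n j) *
        (K * (\<Prod>i<p. (1 / (4 * s)) ^ e n i))"
      unfolding F_def norm_scaleR real_norm_def abs_prod
    proof (rule mult_mono)
      show "(\<Prod>j<p. \<bar>\<Phi> n j (count_list js j) (y j)\<bar>) \<le>
          (\<Prod>j<p. (fact (count_list js j) * (1 / s) ^ count_list js j) * (2 * s) ^ e n j)"
        by (rule prod_mono, rule conjI, rule abs_ge_zero, rule \<Phi>_le, simp)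
    qed (use s Kc[of n] in \<open>simp_all add: prod_nonneg\<close>)
    also have "\<dots> = K * G js * (\<Prod>j<p. (2 * s) ^ e n j * (1 / (4 * s)) ^ e n j)"
      by (simp add: prod.distrib G_def mult_ac)
    also have "(\<Prod>j<p. (2 * s) ^ e n j * (1 / (4 * s)) ^ e n j) = (\<Prod>j<p. (1/2) ^ e n j)"
      unfolding power_mult_distrib[symmetric] using s by simp
    finally show ?thesis .
  qed
  have "(\<lambda>\<alpha>. \<Prod>j<p. (1/2::real) ^ \<alpha> j) summable_on multi_indices p"
    by (rule summable_geometric_multi) auto
  then have sg: "summable (\<lambda>n. \<Prod>j<p. (1/2::real) ^ e n j)"
    by (subst (asm) summable_on_reindex_bij_betw[OF bij, symmetric]) (rule summable_on_imp_summable)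
  define Q where "Q = (\<Sum>n. \<Prod>j<p. (1/2::real) ^ e n j)"
  have Q: "Q \<ge> 0" unfolding Q_def by (intro suminf_nonneg sg prod_nonneg) auto
  have f_eq: "f y = (\<Sum>n. F n [] y)" if "y \<in> W" for y
  proof -
    have "F n [] y = (\<Prod>i<p. (y i - x i) ^ e n i) *\<^sub>R c (e n)" for n
      by (simp add: F_def \<Phi>_def power_deriv_def)
    then show ?thesis using sums[of y] W(3) that by (auto simp: sums_iff)
  qed
  have Fd: "((\<lambda>t. F n js (y(i := t))) has_vector_derivative F n (i # js) y) (at (y i))"
    if "set js \<subseteq> {..<p}" "y \<in> W" "i < p" for n js y i
    unfolding F_def by (rule prod_has_vector_derivative[where \<Phi> = "\<Phi> n", OF \<Phi> that(3)])
  have Fc: "continuous_on W (F n js)" for n js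
    unfolding F_def by (rule continuous_on_prod_coordinates[where \<Phi> = "\<Phi> n", OF \<Phi>])
  have Fbd: "\<exists>V b. openin (Euclidean_space p) V \<and> y \<in> V \<and> V \<subseteq> W \<and> summable b \<and>
         (\<forall>n. \<forall>y\<in>V. norm (F n js y) \<le> b n)" if "y \<in> W" for js y
    using W(1) that Fb sg by (intro exI[of _ W] exI[of _ "\<lambda>n. K * G js * (\<Prod>j<p. (1/2) ^ e n j)"])
      (auto intro: summable_mult)
  have sm: "f \<in> smooth_class p W"
    by (rule smooth_class_suminf(1)[where F = F, OF W(1)]) (rule f_eq Fd Fc Fbd; assumption)+
  have ip: "iterated_partial js f y = (\<Sum>n. F n js y)" if "set js \<subseteq> {..<p}" "y \<in> W" for js y
    by (rule smooth_class_suminf(2)[where F = F, OF W(1) _ _ _ _ that]) (rule f_eq Fd Fc Fbd; assumption)+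
  show thesis
  proof (rule that)
    show "f \<in> smooth_class p W" by (rule sm)
    show "W \<subseteq> U" using W V by auto
    show "0 < K * Q + 1" using K Q by (simp add: add_nonneg_pos)
    show "0 < 1 / s" using s by simp
    fix \<alpha> y assume y: "y \<in> W"
    define js where "js = mi_list p \<alpha>"
    have G: "G js = (\<Prod>j<p. fact (\<alpha> j)) * (1 / s) ^ mi_size p \<alpha>"
      unfolding G_def js_def by (simp add: count_list_mi_list prod.distrib mi_size_def power_sum)
    have "G js \<le> fact (mi_size p \<alpha>) * (1 / s) ^ mi_size p \<alpha>"
      unfolding G mi_size_def using s by (intro mult_right_mono prod_fact_le_fact_sum) auto
    then have G': "(K * Q + 1) * G js \<le> (K * Q + 1) * (fact (mi_size p \<alpha>) * (1 / s) ^ mi_size p \<alpha>)"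
      using K Q by (intro mult_left_mono) auto
    have "norm (mi_deriv p \<alpha> f y) = norm (\<Sum>n. F n js y)"
      using ip[OF set_mi_list y] by (simp add: mi_deriv_eq_iterated_partial js_def)
    also have "\<dots> \<le> (\<Sum>n. K * G js * (\<Prod>j<p. (1/2) ^ e n j))"
      by (rule norm_suminf_le[OF Fb[OF y] summable_mult[OF sg]])
    also have "\<dots> = K * G js * Q" unfolding Q_def by (rule suminf_mult[OF sg])
    also have "\<dots> \<le> (K * Q + 1) * G js" using G0[of js] by (simp add: algebra_simps)
    also note G'
    finally show "norm (mi_deriv p \<alpha> f y) \<le> (K * Q + 1) * (1 / s) ^ mi_size p \<alpha> * fact (mi_size p \<alpha>)"
      by (simp only: mult_ac)
  qed (use W in auto)
qed

lemma analytic_subset_denjoy_carleman: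
  fixes f :: "(nat \<Rightarrow> real) \<Rightarrow> 'f::banach"
  assumes M: "\<And>n. 1 \<le> M n" and p: "1 \<le> p" and U: "openin (Euclidean_space p) U"
    and f: "f \<in> analytic_class p U"
  shows "f \<in> denjoy_carleman M p U"
  unfolding denjoy_carleman_def
proof (intro CollectI conjI ballI)
  show "f \<in> smooth_class p U"
    by (rule smooth_class_local) (metis analytic_imp_local_bounds[OF p U f])
  fix x assume "x \<in> U"
  from analytic_imp_local_bounds[OF p U f this]
  obtain W A B where W: "openin (Euclidean_space p) W" "x \<in> W" "W \<subseteq> U" "0 < A" "0 < B"
    and b: "\<And>\<alpha> y. y \<in> W \<Longrightarrow> norm (mi_deriv p \<alpha> f y) \<le> A * B ^ mi_size p \<alpha> * fact (mi_size p \<alpha>)"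
    by metis
  have "norm (mi_deriv p \<alpha> f y) \<le> A * B ^ mi_size p \<alpha> * fact (mi_size p \<alpha>) * M (mi_size p \<alpha>)"
    if "y \<in> W" for \<alpha> y
  proof -
    have "A * B ^ mi_size p \<alpha> * fact (mi_size p \<alpha>) * 1
        \<le> A * B ^ mi_size p \<alpha> * fact (mi_size p \<alpha>) * M (mi_size p \<alpha>)"
      using W by (intro mult_left_mono M) auto
    then show ?thesis using b[OF that, of \<alpha>] by simp
  qed
  then show "\<exists>V A B. openin (Euclidean_space p) V \<and> x \<in> V \<and> V \<subseteq> U \<and> 0 < A \<and> 0 < B \<and>
       (\<forall>\<alpha>. \<forall>y\<in>V. norm (mi_deriv p \<alpha> f y)
          \<le> A * B ^ mi_size p \<alpha> * fact (mi_size p \<alpha>) * M (mi_size p \<alpha>))"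
    using W by blast
qed

lemma weight_sequence_ge_1: "weight_sequence M \<Longrightarrow> 1 \<le> M n"
  unfolding weight_sequence_def by (metis monoD zero_le)

text \<open>Used contrapositively, to turn the hypothesis that the class is not the analytic one
  into growth of \<open>M\<close>.\<close>

lemma is_analytic_class_if_bounded:
  assumes "weight_sequence M" "\<And>n. M n \<le> R ^ n"
  shows "is_analytic_class (denjoy_carleman M :: nat \<Rightarrow> _ \<Rightarrow> ((nat \<Rightarrow> real) \<Rightarrow> 'f::banach) set)"
  unfolding is_analytic_class_def
  using denjoy_carleman_subset_analytic[of M R] analytic_subset_denjoy_carleman[of M]
    weight_sequence_ge_1[OF assms(1)] assms by (auto simp: weight_sequence_def)

subsection \<open>Logarithmically convex sequences\<close>

text \<open>Raising \<open>b\<close> by one multiplies the left side by the ratio of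
  \<open>M\<close> at \<open>k + b\<close> and the right side by the larger ratio at
  \<open>k + a + b\<close>. The instance \<open>k = 0\<close> is submultiplicativity up to addition
  of indices; \<open>k = 1\<close> lowers the total index by one at the price of
  \<open>M 1\<close>.\<close>

lemma weight_sequence_mult_le:
  assumes M: "weight_sequence M"
  shows "M (k + a) * M (k + b) \<le> M k * M (k + a + b)"
proof (induction b)
  case (Suc b)
  have pos: "M n > 0" for n using M by (simp add: weight_sequence_def)
  have "mono (\<lambda>n. M (Suc n) / M n)" using M by (simp add: weight_sequence_def)
  then have r: "M (Suc (k + b)) / M (k + b) \<le> M (Suc (k + a + b)) / M (k + a + b)"
    by (rule monoD[where f = "\<lambda>n. M (Suc n) / M n"]) simp
  have "M (k + a) * M (k + Suc b) = (M (k + a) * M (k + b)) * (M (Suc (k + b)) / M (k + b))"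
    using pos[of "k + b"] by simp
  also have "\<dots> \<le> (M k * M (k + a + b)) * (M (Suc (k + a + b)) / M (k + a + b))"
    using pos by (intro mult_mono Suc r mult_nonneg_nonneg divide_nonneg_nonneg) (auto intro: less_imp_le)
  also have "\<dots> = M k * M (k + a + Suc b)"
    using pos[of "k + a + b"] by simp
  finally show ?case .
qed simp

text \<open>Were all ratios at most \<open>R'\<close>, then \<open>M n \<le> R' ^ n\<close>. Hence
  some ratio exceeds \<open>R'\<close>, and by monotonicity all later ones do; the constant absorbs
  the initial segment.\<close>

lemma weight_sequence_dominates_powers:
  assumes M: "weight_sequence M" and unb: "\<not> (\<exists>R. \<forall>n. M n \<le> R ^ n)"
  obtains L where "L \<ge> 1" "\<And>n. R ^ n \<le> L * M n"
proof -
  have pos: "M n > 0" for n using M by (simp add: weight_sequence_def)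
  have mono: "mono (\<lambda>n. M (Suc n) / M n)" using M by (simp add: weight_sequence_def)
  define R' where "R' = max 1 \<bar>R\<bar>"
  have "\<exists>n. R' < M (Suc n) / M n"
  proof (rule ccontr)
    assume "\<not> (\<exists>n. R' < M (Suc n) / M n)"
    then have *: "M (Suc n) / M n \<le> R'" for n by (meson not_less)
    have "M n \<le> R' ^ n" for n
    proof (induction n)
      case 0
      then show ?case using M by (simp add: weight_sequence_def)
    next
      case (Suc n)
      have "M (Suc n) \<le> R' * M n" using *[of n] pos[of n] by (simp add: divide_le_eq)
      also have "\<dots> \<le> R' * R' ^ n" using Suc by (intro mult_left_mono) (auto simp: R'_def)
      finally show ?case by simp
    qed
    then show False using unb by blast
  qed
  then obtain N where N: "R' < M (Suc N) / M N" by blast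
  have growth: "R' * M n \<le> M (Suc n)" if "n \<ge> N" for n
  proof -
    have "M (Suc N) / M N \<le> M (Suc n) / M n"
      by (rule monoD[OF mono that])
    then have "R' \<le> M (Suc n) / M n" using N by simp
    then show ?thesis using pos[of n] by (simp add: le_divide_eq)
  qed
  have R': "R' \<ge> 1" by (simp add: R'_def)
  have 1: "1 \<le> M n" for n using weight_sequence_ge_1[OF M] .
  have bound: "R' ^ n \<le> R' ^ N * M n" for n
  proof (cases "n \<le> N")
    case True
    have "R' ^ n * 1 \<le> R' ^ N * M n"
      using True R' 1 by (intro mult_mono power_increasing) auto
    then show ?thesis by simp
  next
    case False
    then have "N \<le> n" by simp
    then show ?thesis
    proof (induction n rule: dec_induct)
      case base
      show ?case using mult_left_mono[OF 1[of N], of "R' ^ N"] R' by simp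
    next
      case (step n)
      have "R' ^ Suc n \<le> R' * (R' ^ N * M n)" using step R' by (simp add: mult_left_mono)
      also have "\<dots> = R' ^ N * (R' * M n)" by simp
      also have "\<dots> \<le> R' ^ N * M (Suc n)"
        using R' growth[OF step(1)] by (intro mult_left_mono) auto
      finally show ?case .
    qed
  qed
  show thesis
  proof (rule that[of "R' ^ N"])
    show "R ^ n \<le> R' ^ N * M n" for n
    proof -
      have "R ^ n \<le> \<bar>R\<bar> ^ n" by (metis abs_ge_self power_abs)
      also have "\<dots> \<le> R' ^ n" by (intro power_mono) (auto simp: R'_def)
      finally show ?thesis using bound[of n] by simp
    qed
  qed (use R' in simp)
qed

subsection \<open>Taylor coefficients of exponentials\<close>

text \<open>The Leibniz rule for Taylor coefficients, that is, derivatives divided by factorials.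
  The hypotheses reach only up to \<open>n\<close> so that it can be applied within an
  induction.\<close>

lemma has_real_derivative_convolution:
  assumes X: "\<And>k. k \<le> n \<Longrightarrow> (X k has_real_derivative real (Suc k) * X (Suc k) t) (at t)"
    and Y: "\<And>k. k \<le> n \<Longrightarrow> (Y k has_real_derivative real (Suc k) * Y (Suc k) t) (at t)"
  shows "((\<lambda>t. \<Sum>j\<le>n. X j t * Y (n - j) t) has_real_derivative
     real (Suc n) * (\<Sum>j\<le>Suc n. X j t * Y (Suc n - j) t)) (at t)"
proof -
  have "((\<lambda>t. \<Sum>j\<le>n. X j t * Y (n - j) t) has_real_derivative
     (\<Sum>j\<le>n. real (Suc j) * X (Suc j) t * Y (n - j) t + real (Suc (n - j)) * Y (Suc (n - j)) t * X j t)) (at t)"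
    by (rule DERIV_sum, rule DERIV_mult; (rule X Y, simp))
  also have "(\<Sum>j\<le>n. real (Suc j) * X (Suc j) t * Y (n - j) t + real (Suc (n - j)) * Y (Suc (n - j)) t * X j t)
     = (\<Sum>j\<le>n. real (Suc j) * X (Suc j) t * Y (Suc n - Suc j) t)
       + (\<Sum>j\<le>n. real (Suc n - j) * X j t * Y (Suc n - j) t)"
    unfolding sum.distrib by (intro arg_cong2[where f = "(+)"] sum.cong) (auto simp: Suc_diff_le)
  also have "(\<Sum>j\<le>n. real (Suc j) * X (Suc j) t * Y (Suc n - Suc j) t) = (\<Sum>j\<le>Suc n. real j * X j t * Y (Suc n - j) t)"
    by (subst sum.atMost_Suc_shift) simp
  also have "(\<Sum>j\<le>n. real (Suc n - j) * X j t * Y (Suc n - j) t) = (\<Sum>j\<le>Suc n. real (Suc n - j) * X j t * Y (Suc n - j) t)"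
    by simp
  also have "(\<Sum>j\<le>Suc n. real j * X j t * Y (Suc n - j) t) + (\<Sum>j\<le>Suc n. real (Suc n - j) * X j t * Y (Suc n - j) t)
     = real (Suc n) * (\<Sum>j\<le>Suc n. X j t * Y (Suc n - j) t)"
    unfolding sum.distrib[symmetric] sum_distrib_left
    by (intro sum.cong) (auto simp: of_nat_diff algebra_simps)
  finally show ?thesis .
qed

text \<open>If \<open>v\<close> are the Taylor coefficients of a function \<open>u\<close> at a point, then
  \<open>exp_coeff l v\<close> are those of \<open>exp (- l * u)\<close>, computed from the differential equation
  \<open>w' = - l * u' * w\<close>.\<close>

fun exp_coeff :: "real \<Rightarrow> (nat \<Rightarrow> real) \<Rightarrow> nat \<Rightarrow> real" where
  "exp_coeff l v 0 = exp (- l * v 0)"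
| "exp_coeff l v (Suc n) =
     - (l / real (Suc n)) * (\<Sum>j\<le>n. (real (Suc j) * v (Suc j)) * exp_coeff l v (n - j))"

text \<open>The recursion is a Cauchy product of the coefficients of \<open>u'\<close> with earlier
  values of \<open>exp_coeff\<close>, so the Leibniz rule and strong induction apply.\<close>

lemma has_real_derivative_exp_coeff:
  assumes u: "\<And>k. (u k has_real_derivative real (Suc k) * u (Suc k) t) (at t)"
  shows "((\<lambda>t. exp_coeff l (\<lambda>k. u k t) n) has_real_derivative
     real (Suc n) * exp_coeff l (\<lambda>k. u k t) (Suc n)) (at t)"
proof (induction n rule: less_induct)
  case (less n)
  show ?case
  proof (cases n)
    case 0
    have "((\<lambda>t. exp (- l * u 0 t)) has_real_derivative exp (- l * u 0 t) * (- l * (real (Suc 0) * u (Suc 0) t))) (at t)"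
      by (rule DERIV_fun_exp, rule DERIV_cmult, rule u)
    then show ?thesis by (simp add: 0 mult_ac)
  next
    case (Suc m)
    have "((\<lambda>t. \<Sum>j\<le>m. (real (Suc j) * u (Suc j) t) * exp_coeff l (\<lambda>k. u k t) (m - j)) has_real_derivative
        real (Suc m) * (\<Sum>j\<le>Suc m. (real (Suc j) * u (Suc j) t) * exp_coeff l (\<lambda>k. u k t) (Suc m - j))) (at t)"
    proof (rule has_real_derivative_convolution[where X = "\<lambda>j t. real (Suc j) * u (Suc j) t"
          and Y = "\<lambda>k t. exp_coeff l (\<lambda>i. u i t) k"])
      show "((\<lambda>t. real (Suc k) * u (Suc k) t) has_real_derivative
          real (Suc k) * (real (Suc (Suc k)) * u (Suc (Suc k)) t)) (at t)" for k
        by (rule DERIV_cmult, rule u)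
      show "((\<lambda>t. exp_coeff l (\<lambda>i. u i t) k) has_real_derivative
          real (Suc k) * exp_coeff l (\<lambda>i. u i t) (Suc k)) (at t)" if "k \<le> m" for k
        by (rule less.IH) (use that Suc in simp)
    qed
    from DERIV_cmult[OF this, of "- (l / real (Suc m))"]
    have "((\<lambda>t. exp_coeff l (\<lambda>k. u k t) (Suc m)) has_real_derivative
       - (l / real (Suc m)) * (real (Suc m) * (\<Sum>j\<le>Suc m. (real (Suc j) * u (Suc j) t) * exp_coeff l (\<lambda>k. u k t) (Suc m - j)))) (at t)"
      by (simp only: exp_coeff.simps)
    moreover have "real (Suc (Suc m)) * exp_coeff l (\<lambda>k. u k t) (Suc (Suc m)) =
       - (l / real (Suc m)) * (real (Suc m) * (\<Sum>j\<le>Suc m. (real (Suc j) * u (Suc j) t) * exp_coeff l (\<lambda>k. u k t) (Suc m - j)))"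
      unfolding exp_coeff.simps(2)[of l _ "Suc m"] by (simp del: of_nat_Suc sum.atMost_Suc exp_coeff.simps)
    ultimately show ?thesis unfolding Suc by (simp only:)
  qed
qed

lemma fact_ratio_mono:
  assumes "a \<le> b"
  shows "fact (a + i) / fact a \<le> (fact (b + i) / fact b :: real)"
  using assms
proof (induction b rule: dec_induct)
  case (step b)
  have "fact (b + i) / fact b \<le> (fact (b + i) / fact b) * (real (Suc (b + i)) / real (Suc b))"
    by (intro mult_le_cancel_left1[THEN iffD2]) (simp add: divide_simps)
  also have "\<dots> = (fact (Suc b + i) / fact (Suc b) :: real)" by (simp add: mult_ac)
  finally show ?case using step by linarith
qed simp

text \<open>The extra powers of \<open>l\<close> make the induction on \<open>n\<close> work: each step of the recursion for
  \<open>exp_coeff\<close> costs one factor \<open>l\<close>, which logarithmic convexity absorbs.\<close>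

lemma exp_coeff_bound:
  assumes M: "weight_sequence M" and A: "0 \<le> A" and B: "0 \<le> B" and K: "0 \<le> K" and c: "0 \<le> c" and l: "0 \<le> l"
    and v: "\<And>j. 1 \<le> j \<Longrightarrow> \<bar>v j\<bar> \<le> A * B ^ j * M j"
    and base: "\<And>i. c * l ^ i * exp (- l * v 0) \<le> K * fact i * M i"
  shows "c * l ^ i * \<bar>exp_coeff l v n\<bar> \<le>
     K * (fact (n + i) / fact n) * (2 * B * (1 + A * M 1)) ^ n * M (n + i)"
proof (induction n arbitrary: i rule: less_induct)
  case (less n)
  \<comment> \<open>Chosen so that \<open>D - 2 * B = 2 * B * (A * M 1)\<close>, which makes the sum
    over \<open>j\<close> below a difference of powers of \<open>D\<close> and
    \<open>2 * B\<close>.\<close>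
  define D where "D = 2 * B * (1 + A * M 1)"
  have pos: "M k > 0" for k using M by (simp add: weight_sequence_def)
  have D: "D \<ge> 0" unfolding D_def using A B pos[of 1] by auto
  show ?case
  proof (cases n)
    case 0
    then show ?thesis using base[of i] by simp
  next
    case (Suc m)
    \<comment> \<open>\<open>fact (m + Suc i) / fact m\<close> is \<open>Suc m\<close> times the
      ratio wanted at \<open>Suc m\<close>; the denominator of the recursion cancels this
      factor.\<close>
    define T where "T = K * (fact (m + Suc i) / fact m) * M (Suc m + i)"
    have T: "T \<ge> 0" unfolding T_def using K pos[of "Suc m + i"] by (simp add: less_imp_le)
    have term_le: "(real (Suc j) * \<bar>v (Suc j)\<bar>) * (c * l ^ Suc i * \<bar>exp_coeff l v (m - j)\<bar>)
        \<le> T * (A * M 1 * ((2 * B) ^ Suc j * D ^ (m - j)))" if j: "j \<le> m" for j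
    proof -
      \<comment> \<open>The factor \<open>Suc j\<close> from differentiating \<open>u\<close> is
        absorbed by doubling \<open>B\<close>.\<close>
      have "real (Suc j) * \<bar>v (Suc j)\<bar> \<le> 2 ^ Suc j * (A * B ^ Suc j * M (Suc j))"
      proof (intro mult_mono v)
        have "real (Suc j) \<le> real (2 ^ Suc j)" using less_exp[of "Suc j"] by (simp only: of_nat_le_iff)
        then show "real (Suc j) \<le> 2 ^ Suc j" by simp
      qed auto
      moreover have "c * l ^ Suc i * \<bar>exp_coeff l v (m - j)\<bar>
          \<le> K * (fact (m - j + Suc i) / fact (m - j)) * D ^ (m - j) * M (m - j + Suc i)"
        unfolding D_def using less.IH[of "m - j" "Suc i"] Suc by simp
      ultimately have "(real (Suc j) * \<bar>v (Suc j)\<bar>) * (c * l ^ Suc i * \<bar>exp_coeff l v (m - j)\<bar>)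
         \<le> (2 ^ Suc j * (A * B ^ Suc j * M (Suc j))) *
           (K * (fact (m - j + Suc i) / fact (m - j)) * D ^ (m - j) * M (m - j + Suc i))"
        by (rule mult_mono) (use A B c l pos[of "Suc j"] in auto)
      also have "\<dots> = (A * ((2 * B) ^ Suc j * D ^ (m - j))) * K * (fact (m - j + Suc i) / fact (m - j)) *
           (M (Suc j) * M (m - j + Suc i))"
        by (simp only: power_mult_distrib mult_ac)
      also have "\<dots> \<le> (A * ((2 * B) ^ Suc j * D ^ (m - j))) * K * (fact (m + Suc i) / fact m) *
           (M 1 * M (Suc m + i))"
      proof (rule mult_mono)
        show "(A * ((2 * B) ^ Suc j * D ^ (m - j))) * K * (fact (m - j + Suc i) / fact (m - j))
            \<le> (A * ((2 * B) ^ Suc j * D ^ (m - j))) * K * (fact (m + Suc i) / fact m)"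
          by (rule mult_left_mono[OF fact_ratio_mono]) (use A B D K in auto)
        \<comment> \<open>The spare \<open>l\<close> has raised \<open>i\<close> by one, so the
          indices add up to \<open>m + i + 2\<close>, one more than wanted. Logarithmic convexity at
          \<open>k = 1\<close> removes the excess.\<close>
        show "M (Suc j) * M (m - j + Suc i) \<le> M 1 * M (Suc m + i)"
          using weight_sequence_mult_le[OF M, of 1 j "m - j + i"] j by simp
      qed (use A B D K pos in \<open>auto intro!: mult_nonneg_nonneg less_imp_le\<close>)
      also have "\<dots> = T * (A * M 1 * ((2 * B) ^ Suc j * D ^ (m - j)))"
        by (simp only: T_def mult_ac)
      finally show ?thesis .
    qed
    have geom: "(\<Sum>j\<le>m. A * M 1 * ((2 * B) ^ Suc j * D ^ (m - j))) \<le> D ^ Suc m"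
    proof -
      have "(\<Sum>j\<le>m. A * M 1 * ((2 * B) ^ Suc j * D ^ (m - j))) =
          (D - 2 * B) * (\<Sum>j<Suc m. (2 * B) ^ j * D ^ (m - j))"
        unfolding sum_distrib_left lessThan_Suc_atMost
        by (intro sum.cong) (auto simp: D_def algebra_simps)
      also have "\<dots> = D ^ Suc m - (2 * B) ^ Suc m"
        using diff_power_eq_sum[of "2 * B" m D] by (simp add: algebra_simps del: sum.lessThan_Suc power_Suc)
      also have "\<dots> \<le> D ^ Suc m" using B by simp
      finally show ?thesis .
    qed
    have "\<bar>exp_coeff l v (Suc m)\<bar> = (l / real (Suc m)) *
        \<bar>\<Sum>j\<le>m. (real (Suc j) * v (Suc j)) * exp_coeff l v (m - j)\<bar>"
      using l by (simp only: exp_coeff.simps abs_mult abs_minus_cancel abs_divide abs_of_nat abs_of_nonneg)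
    also have "\<dots> \<le> (l / real (Suc m)) * (\<Sum>j\<le>m. (real (Suc j) * \<bar>v (Suc j)\<bar>) * \<bar>exp_coeff l v (m - j)\<bar>)"
      using l by (intro mult_left_mono order_trans[OF sum_abs] sum_mono) (auto simp: abs_mult)
    finally have "c * l ^ i * \<bar>exp_coeff l v (Suc m)\<bar> \<le>
        c * l ^ i * ((l / real (Suc m)) * (\<Sum>j\<le>m. (real (Suc j) * \<bar>v (Suc j)\<bar>) * \<bar>exp_coeff l v (m - j)\<bar>))"
      using c l by (intro mult_left_mono) auto
    also have "\<dots> = (\<Sum>j\<le>m. (real (Suc j) * \<bar>v (Suc j)\<bar>) * (c * l ^ Suc i * \<bar>exp_coeff l v (m - j)\<bar>)) / real (Suc m)"
      by (simp add: sum_distrib_left sum_divide_distrib mult_ac del: of_nat_Suc)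
    also have "\<dots> \<le> (\<Sum>j\<le>m. T * (A * M 1 * ((2 * B) ^ Suc j * D ^ (m - j)))) / real (Suc m)"
      by (intro divide_right_mono sum_mono term_le) auto
    also have "\<dots> = T * (\<Sum>j\<le>m. A * M 1 * ((2 * B) ^ Suc j * D ^ (m - j))) / real (Suc m)"
      by (simp only: sum_distrib_left)
    also have "\<dots> \<le> T * D ^ Suc m / real (Suc m)"
      by (intro divide_right_mono mult_left_mono geom T) auto
    also have "\<dots> = K * (fact (Suc m + i) / fact (Suc m)) * D ^ Suc m * M (Suc m + i)"
      by (simp add: T_def fact_Suc field_simps del: of_nat_Suc)
    finally show ?thesis unfolding D_def Suc .
  qed
qed

text \<open>Logarithmic convexity with \<open>M 0 = 1\<close> bounds each of the
  \<open>Suc n\<close> terms equally, and \<open>Suc n \<le> 2 ^ n\<close> doubles the rate.\<close>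

lemma convolution_bound:
  assumes M: "weight_sequence M" and A: "0 \<le> A" and B: "0 \<le> B"
    and x: "\<And>n. \<bar>x n\<bar> \<le> A * B ^ n * M n"
  shows "\<bar>\<Sum>j\<le>n. x j * x (n - j)\<bar> \<le> A\<^sup>2 * (2 * B) ^ n * M n"
proof -
  have pos: "M k > 0" for k using M by (simp add: weight_sequence_def)
  have "\<bar>x j * x (n - j)\<bar> \<le> A\<^sup>2 * B ^ n * M n" if "j \<le> n" for j
  proof -
    have "\<bar>x j * x (n - j)\<bar> \<le> (A * B ^ j * M j) * (A * B ^ (n - j) * M (n - j))"
      unfolding abs_mult using A B pos[of j] by (intro mult_mono x) auto
    also have "\<dots> = A\<^sup>2 * (B ^ j * B ^ (n - j)) * (M j * M (n - j))"
      by (simp add: power2_eq_square mult_ac)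
    also have "B ^ j * B ^ (n - j) = B ^ n" using that by (simp flip: power_add)
    also have "A\<^sup>2 * B ^ n * (M j * M (n - j)) \<le> A\<^sup>2 * B ^ n * M n"
      using weight_sequence_mult_le[OF M, of 0 j "n - j"] that M B
      by (intro mult_left_mono) (auto simp: weight_sequence_def)
    finally show ?thesis .
  qed
  then have "\<bar>\<Sum>j\<le>n. x j * x (n - j)\<bar> \<le> (\<Sum>j\<le>n. A\<^sup>2 * B ^ n * M n)"
    by (intro order_trans[OF sum_abs] sum_mono) auto
  also have "\<dots> = real (Suc n) * (A\<^sup>2 * B ^ n * M n)" by simp
  also have "\<dots> \<le> 2 ^ n * (A\<^sup>2 * B ^ n * M n)"
  proof (rule mult_right_mono)
    have "Suc n \<le> 2 ^ n" using less_exp[of n] by (rule Suc_leI)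
    then have "real (Suc n) \<le> real (2 ^ n)" by (simp only: of_nat_le_iff)
    then show "real (Suc n) \<le> 2 ^ n" by simp
  qed (use B pos[of n] in auto)
  also have "\<dots> = A\<^sup>2 * (2 * B) ^ n * M n" by (simp add: power_mult_distrib)
  finally show ?thesis .
qed

subsection \<open>Denjoy-Carleman functions of one variable\<close>

definition emb :: "real \<Rightarrow> nat \<Rightarrow> real" where
  "emb t = (\<lambda>i. if i = 0 then t else 0)"

lemma emb_0 [simp]: "emb t 0 = t"
  and emb_update [simp]: "(emb s)(0 := t) = emb t"
  by (auto simp: emb_def)

lemma emb_in_RR: "emb t \<in> RR 1"
  by (simp add: RR_iff emb_def)

lemma RR_1_eq_emb: "x \<in> RR 1 \<Longrightarrow> emb (x 0) = x"
  by (auto simp: RR_iff emb_def fun_eq_iff)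

lemma open_emb:
  assumes "openin (Euclidean_space 1) U"
  shows "open {t. emb t \<in> U}"
  using open_update[OF assms emb_in_RR, of 0 0] by simp

lemma open_emb_ball:
  assumes "openin (Euclidean_space 1) U" "emb t0 \<in> U"
  obtains d where "d > 0" "\<And>t. \<bar>t - t0\<bar> < d \<Longrightarrow> emb t \<in> U"
proof -
  obtain d where "d > 0" "ball t0 d \<subseteq> {t. emb t \<in> U}"
    using open_emb[OF assms(1)] assms(2) open_contains_ball by blast
  then show thesis
    using that by (auto simp: subset_iff dist_real_def abs_minus_commute)
qed

lemma mi_deriv_1: "mi_deriv 1 \<alpha> f = (partial_deriv 0 ^^ \<alpha> 0) f"
  by simp

lemma mi_size_1: "mi_size 1 \<alpha> = \<alpha> 0"
  by (simp add: mi_size_def)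

lemma smooth_class_1_has_deriv:
  assumes "f \<in> smooth_class 1 U" "emb t \<in> U"
  shows "((\<lambda>t. (partial_deriv 0 ^^ n) f (emb t)) has_vector_derivative
     (partial_deriv 0 ^^ Suc n) f (emb t)) (at t)"
proof -
  have "set (replicate n 0) \<subseteq> {..<1::nat}" by (auto simp: set_replicate_conv_if)
  from smooth_class_has_deriv[OF assms(1) this assms(2), of 0]
  show ?thesis
    unfolding replicate_Suc[symmetric] iterated_partial_replicate by simp
qed

lemma denjoy_carleman_1_bounds:
  assumes U: "openin (Euclidean_space 1) U" and f: "f \<in> denjoy_carleman M 1 U" and t0: "emb t0 \<in> U"
  obtains d A B where "d > 0" "A > 0" "B > 0" "\<And>t. \<bar>t - t0\<bar> < d \<Longrightarrow> emb t \<in> U"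
    "\<And>t n. \<bar>t - t0\<bar> < d \<Longrightarrow> norm ((partial_deriv 0 ^^ n) f (emb t)) \<le> A * B ^ n * fact n * M n"
proof -
  obtain V A B where V: "openin (Euclidean_space 1) V" "emb t0 \<in> V" "V \<subseteq> U" "0 < A" "0 < B"
    and b: "\<And>\<alpha> y. y \<in> V \<Longrightarrow> norm (mi_deriv 1 \<alpha> f y)
       \<le> A * B ^ mi_size 1 \<alpha> * fact (mi_size 1 \<alpha>) * M (mi_size 1 \<alpha>)"
    using denjoy_carleman_bounds[OF f t0] by metis
  obtain d where d: "d > 0" "\<And>t. \<bar>t - t0\<bar> < d \<Longrightarrow> emb t \<in> V"
    using open_emb_ball[OF V(1,2)] by metis
  show thesis
  proof (rule that[of d A B])
    fix t n assume "\<bar>t - t0\<bar> < d"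
    from b[OF d(2)[OF this], of "\<lambda>_. n"]
    show "norm ((partial_deriv 0 ^^ n) f (emb t)) \<le> A * B ^ n * fact n * M n"
      unfolding mi_deriv_1 mi_size_1 .
  qed (use d V in auto)
qed

lemma denjoy_carleman_1I:
  fixes f :: "(nat \<Rightarrow> real) \<Rightarrow> 'f::real_normed_vector"
  assumes U: "openin (Euclidean_space 1) U"
    and f: "\<And>t. emb t \<in> U \<Longrightarrow> f (emb t) = H 0 t"
    and H: "\<And>n t. emb t \<in> U \<Longrightarrow> (H n has_vector_derivative H (Suc n) t) (at t)"
    and b: "\<And>t0. emb t0 \<in> U \<Longrightarrow> \<exists>d A B. d > 0 \<and> A > 0 \<and> B > 0 \<and>
       (\<forall>t n. emb t \<in> U \<and> \<bar>t - t0\<bar> < d \<longrightarrow> norm (H n t) \<le> A * B ^ n * fact n * M n)"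
  shows "f \<in> denjoy_carleman M 1 U"
proof -
  define G where "G js x = H (length js) (x 0)" for js :: "nat list" and x :: "nat \<Rightarrow> real"
  have G0: "f x = G [] x" if "x \<in> U" for x
    using f[of "x 0"] that RR_1_eq_emb[OF openin_imp_RR[OF U that]] by (simp add: G_def)
  have emb: "emb (x 0) \<in> U" if "x \<in> U" for x
    using that RR_1_eq_emb[OF openin_imp_RR[OF U that]] by simp
  have G: "((\<lambda>t. G js (x(i := t))) has_vector_derivative G (i # js) x) (at (x i))"
    if "set js \<subseteq> {..<1}" "x \<in> U" "i < 1" for js x i
    using H[OF emb[OF that(2)], of "length js"] that(3) by (simp add: G_def)
  have C: "continuous_on U (G js)" if "set js \<subseteq> {..<1}" for js
    unfolding G_def
  proof (rule continuous_on_compose2[where f = "\<lambda>x. x 0" and g = "H (length js)" and s = U])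
    show "continuous_on {t. emb t \<in> U} (H (length js))"
    proof (rule continuous_at_imp_continuous_on, rule ballI)
      fix t assume "t \<in> {t. emb t \<in> U}"
      then show "isCont (H (length js)) t" using has_vector_derivative_continuous[OF H] by simp
    qed
    show "continuous_on U (\<lambda>x. x 0)"
      by (rule continuous_on_product_then_coordinatewise[OF continuous_on_id])
  qed (use emb in auto)
  show ?thesis
    unfolding denjoy_carleman_def
  proof (intro CollectI conjI ballI)
    show "f \<in> smooth_class 1 U"
      by (rule smooth_classI[where G = G and U = U, OF U G0 G C])
    have eq: "(partial_deriv 0 ^^ n) f x = H n (x 0)" if "x \<in> U" for n x
    proof -
      have "set (replicate n 0) \<subseteq> {..<1::nat}" by (auto simp: set_replicate_conv_if)
      from iterated_partial_eqI[where G = G and U = U, OF U G0 G this that]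
      show ?thesis unfolding iterated_partial_replicate by (simp add: G_def)
    qed
    fix x assume x: "x \<in> U"
    obtain d A B where d: "d > 0" "A > 0" "B > 0"
      "\<And>t n. emb t \<in> U \<Longrightarrow> \<bar>t - x 0\<bar> < d \<Longrightarrow> norm (H n t) \<le> A * B ^ n * fact n * M n"
      using b[OF emb[OF x]] by metis
    have V: "openin (Euclidean_space 1) (U \<inter> coord_box 1 x d)"
      by (rule openin_Int[OF U openin_coord_box])
    have xV: "x \<in> U \<inter> coord_box 1 x d"
      using x coord_box_center[OF openin_imp_RR[OF U x] d(1)] by simp
    have "norm (mi_deriv 1 \<alpha> f y) \<le> A * B ^ mi_size 1 \<alpha> * fact (mi_size 1 \<alpha>) * M (mi_size 1 \<alpha>)"
      if "y \<in> U \<inter> coord_box 1 x d" for \<alpha> y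
    proof -
      have y: "y \<in> U" "\<bar>y 0 - x 0\<bar> < d" using that by (auto simp: coord_box_def)
      show ?thesis
        unfolding mi_deriv_1 mi_size_1 eq[OF y(1)] by (rule d(4)[OF emb[OF y(1)] y(2)])
    qed
    with V xV d show "\<exists>V A B. openin (Euclidean_space 1) V \<and> x \<in> V \<and> V \<subseteq> U \<and> 0 < A \<and> 0 < B \<and>
       (\<forall>\<alpha>. \<forall>y\<in>V. norm (mi_deriv 1 \<alpha> f y)
          \<le> A * B ^ mi_size 1 \<alpha> * fact (mi_size 1 \<alpha>) * M (mi_size 1 \<alpha>))"
      by (intro exI[of _ "U \<inter> coord_box 1 x d"] exI[of _ A] exI[of _ B]) simp
  qed
qed

lemma has_real_derivative_normalized:
  fixes f :: "(nat \<Rightarrow> real) \<Rightarrow> real"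
  assumes "f \<in> smooth_class 1 U" "emb t \<in> U"
  shows "((\<lambda>t. (partial_deriv 0 ^^ n) f (emb t) / fact n) has_real_derivative
     real (Suc n) * ((partial_deriv 0 ^^ Suc n) f (emb t) / fact (Suc n))) (at t)"
proof -
  have "((\<lambda>t. (partial_deriv 0 ^^ n) f (emb t)) has_real_derivative (partial_deriv 0 ^^ Suc n) f (emb t)) (at t)"
    using smooth_class_1_has_deriv[OF assms, of n] by (simp add: has_real_derivative_iff_has_vector_derivative)
  from DERIV_cdivide[OF this, of "fact n"]
  show ?thesis by (simp add: fact_Suc del: of_nat_Suc funpow.simps)
qed

text \<open>Here quasianalyticity acts. If all derivatives vanish at \<open>t0\<close>, so does the
  function nearby; otherwise Taylor's formula at the first order \<open>m\<close> with nonzero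
  derivative gives the lower bound.\<close>

lemma quasianalytic_zero_or_finite_order:
  fixes f :: "(nat \<Rightarrow> real) \<Rightarrow> real"
  assumes qa: "quasianalytic (denjoy_carleman M :: nat \<Rightarrow> _ \<Rightarrow> ((nat \<Rightarrow> real) \<Rightarrow> 'f::real_normed_algebra_1) set)"
    and U: "openin (Euclidean_space 1) U" and f: "f \<in> denjoy_carleman M 1 U" and t0: "emb t0 \<in> U"
  obtains d where "d > 0" "\<And>t. \<bar>t - t0\<bar> < d \<Longrightarrow> f (emb t) = 0"
  | d m \<kappa> where "d > 0" "\<kappa> > 0" "\<And>t. \<bar>t - t0\<bar> < d \<Longrightarrow> \<kappa> * \<bar>t - t0\<bar> ^ m \<le> \<bar>f (emb t)\<bar>"
proof (cases "\<forall>n. (partial_deriv 0 ^^ n) f (emb t0) = 0")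
  case True
  have sm: "f \<in> smooth_class 1 U" using f by (simp add: denjoy_carleman_def)
  \<comment> \<open>Quasianalyticity is assumed for values in \<open>'f\<close>, so the real
    function is embedded first.\<close>
  let ?g = "\<lambda>x. of_real (f x) :: 'f"
  have "?g \<in> denjoy_carleman M 1 U"
    using denjoy_carleman_of_real_iff[OF U sm] f by blast
  moreover have "mi_deriv 1 \<alpha> ?g (emb t0) = 0" for \<alpha>
  proof -
    have "mi_deriv 1 \<alpha> ?g (emb t0) = of_real (mi_deriv 1 \<alpha> f (emb t0))"
      unfolding mi_deriv_eq_iterated_partial by (rule smooth_class_of_real(2)[OF U sm set_mi_list t0])
    then show ?thesis using True unfolding mi_deriv_1 by simp
  qed
  ultimately have "\<exists>V. openin (Euclidean_space 1) V \<and> emb t0 \<in> V \<and> V \<subseteq> U \<and> (\<forall>y\<in>V. ?g y = 0)"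
    using qa[unfolded quasianalytic_def, rule_format, of 1 U ?g "emb t0"] U t0 by simp
  then obtain V where V: "openin (Euclidean_space 1) V" "emb t0 \<in> V" "\<forall>y\<in>V. ?g y = 0" by blast
  obtain d where "d > 0" "\<And>t. \<bar>t - t0\<bar> < d \<Longrightarrow> emb t \<in> V"
    using open_emb_ball[OF V(1,2)] by metis
  then show thesis using V(3) that(1) by simp
next
  case False
  have sm: "f \<in> smooth_class 1 U" using f by (simp add: denjoy_carleman_def)
  define h where "h n t = (partial_deriv 0 ^^ n) f (emb t)" for n t
  define m where "m = (LEAST n. h n t0 \<noteq> 0)"
  have m: "h m t0 \<noteq> 0" "\<And>j. j < m \<Longrightarrow> h j t0 = 0"
    using False LeastI_ex[of "\<lambda>n. h n t0 \<noteq> 0"] not_less_Least[of _ "\<lambda>n. h n t0 \<noteq> 0"]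
    unfolding m_def h_def by auto
  have deriv: "DERIV (h n) t :> h (Suc n) t" if "emb t \<in> U" for n t
    using smooth_class_1_has_deriv[OF sm that, of n]
    unfolding h_def[abs_def] has_real_derivative_iff_has_vector_derivative .
  obtain d1 where d1: "d1 > 0" "\<And>t. \<bar>t - t0\<bar> < d1 \<Longrightarrow> emb t \<in> U"
    using open_emb_ball[OF U t0] by metis
  define \<eta> where "\<eta> = \<bar>h m t0\<bar> / 2"
  have \<eta>: "\<eta> > 0" using m by (simp add: \<eta>_def)
  have "isCont (h m) t0" using DERIV_isCont[OF deriv[OF t0]] .
  then have "\<forall>e>0. \<exists>d>0. \<forall>t. \<bar>t - t0\<bar> < d \<longrightarrow> \<bar>h m t - h m t0\<bar> < e"
    by (simp add: continuous_at_eps_delta dist_real_def)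
  then obtain d2 where d2: "d2 > 0" "\<And>t. \<bar>t - t0\<bar> < d2 \<Longrightarrow> \<bar>h m t - h m t0\<bar> < \<eta>"
    using \<eta> by metis
  have low: "\<eta> \<le> \<bar>h m t\<bar>" if "\<bar>t - t0\<bar> < d2" for t
    using d2(2)[OF that] unfolding \<eta>_def by linarith
  show thesis
  proof (rule that(2))
    show "min d1 d2 > 0" using d1 d2 by simp
    show "\<eta> / fact m > 0" using \<eta> by simp
    fix t assume t: "\<bar>t - t0\<bar> < min d1 d2"
    show "\<eta> / fact m * \<bar>t - t0\<bar> ^ m \<le> \<bar>f (emb t)\<bar>"
    \<comment> \<open>The Lagrange form of the remainder needs positive order and two distinct
      points.\<close>
    proof (cases "m = 0 \<or> t = t0")
      case True
      show ?thesis
      proof (cases "m = 0")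
        case True
        then show ?thesis using low[of t] t by (simp add: h_def)
      next
        case False
        then show ?thesis using True by (simp add: zero_power)
      qed
    next
      case False
      have "\<exists>s. (if t < t0 then t < s \<and> s < t0 else t0 < s \<and> s < t) \<and>
        h 0 t = (\<Sum>j<m. (h j t0 / fact j) * (t - t0) ^ j) + (h m s / fact m) * (t - t0) ^ m"
      proof (rule Taylor[where a = "min t t0" and b = "max t t0"])
        show "\<forall>j s. j < m \<and> min t t0 \<le> s \<and> s \<le> max t t0 \<longrightarrow> DERIV (h j) s :> h (Suc j) s"
        proof (intro allI impI, elim conjE)
          fix j s assume "min t t0 \<le> s" "s \<le> max t t0"
          then have "\<bar>s - t0\<bar> < d1" using t by (auto simp: min_def max_def split: if_splits)
          then show "DERIV (h j) s :> h (Suc j) s" by (intro deriv d1)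
        qed
      qed (use False in auto)
      then obtain s where s: "if t < t0 then t < s \<and> s < t0 else t0 < s \<and> s < t"
        "h 0 t = (\<Sum>j<m. (h j t0 / fact j) * (t - t0) ^ j) + (h m s / fact m) * (t - t0) ^ m" by blast
      have "\<bar>s - t0\<bar> < d2" using s(1) t by (auto split: if_splits)
      from low[OF this] have "\<eta> / fact m * \<bar>t - t0\<bar> ^ m \<le> \<bar>h m s\<bar> / fact m * \<bar>t - t0\<bar> ^ m"
        by (intro mult_right_mono divide_right_mono) auto
      also have "\<dots> = \<bar>h 0 t\<bar>"
        using m(2) by (simp add: s(2) abs_mult power_abs)
      finally show ?thesis by (simp add: h_def)
    qed
  qed
qed

subsection \<open>Points that quasianalytic curves avoid\<close>

text \<open>The points \<open>(apoint k, bpoint k)\<close> converge to the origin along a flat curve.\<close>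

definition apoint :: "nat \<Rightarrow> real" where "apoint k = (1/2) ^ k"
definition bpoint :: "nat \<Rightarrow> real" where "bpoint k = apoint k ^ k"

lemma apoint_pos: "apoint k > 0" and apoint_le_1: "apoint k \<le> 1"
  by (simp_all add: apoint_def power_le_one)

lemma bpoint_pos: "bpoint k > 0"
  by (simp add: bpoint_def apoint_pos)

lemma bpoint_le_apoint: "bpoint k \<le> apoint k"
proof (cases "k = 0")
  case False
  then show ?thesis
    using power_decreasing[of 1 k "apoint k"] apoint_pos[of k] apoint_le_1[of k] by (simp add: bpoint_def)
qed (simp add: apoint_def bpoint_def)

lemma eventually_apoint_le:
  assumes "d > 0"
  obtains N where "\<And>k. k \<ge> N \<Longrightarrow> apoint k \<le> d"
proof -
  obtain N where N: "(1/2::real) ^ N < d" using real_arch_pow_inv[OF assms, of "1/2"] by auto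
  have "apoint k \<le> d" if "k \<ge> N" for k
  proof -
    have "(1/2::real) ^ k \<le> (1/2) ^ N" by (rule power_decreasing[OF that]) auto
    then show ?thesis unfolding apoint_def using N by linarith
  qed
  then show thesis using that by blast
qed

lemma avoid_if_coordinate_far:
  assumes "2 * apoint k \<le> d" and "d \<le> \<bar>x\<bar> \<or> d \<le> \<bar>y\<bar>"
  shows "(bpoint k / 2)\<^sup>2 \<le> (x - apoint k)\<^sup>2 + (y - bpoint k)\<^sup>2"
proof -
  have "bpoint k / 2 \<le> \<bar>x - apoint k\<bar> \<or> bpoint k / 2 \<le> \<bar>y - bpoint k\<bar>"
    using assms bpoint_le_apoint[of k] bpoint_pos[of k] by linarith
  then have "(bpoint k / 2)\<^sup>2 \<le> (x - apoint k)\<^sup>2 \<or> (bpoint k / 2)\<^sup>2 \<le> (y - bpoint k)\<^sup>2"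
    using bpoint_pos[of k] by (auto simp: abs_le_square_iff[symmetric])
  then show ?thesis by (auto intro: add_increasing add_increasing2)
qed

text \<open>Near the centre \<open>x\<close> is at least \<open>apoint k / 2\<close>, so
  \<open>s\<close> is at least \<open>apoint k / (2 * C)\<close> and \<open>\<bar>y\<bar>\<close> at
  least a constant times \<open>apoint k ^ m\<close>. But
  \<open>\<bar>y\<bar> < 2 * bpoint k\<close>, and for \<open>k > m\<close> this is at most
  \<open>2 * apoint k * apoint k ^ m\<close>.\<close>

lemma avoid_if_order:
  assumes C: "C > 0" "\<bar>x\<bar> \<le> C * s" and \<kappa>: "\<kappa> > 0" "\<kappa> * s ^ m \<le> \<bar>y\<bar>" and s: "s \<ge> 0"
    and k: "m < k" "2 * apoint k \<le> \<kappa> / (2 * C) ^ m"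
  shows "(bpoint k / 2)\<^sup>2 \<le> (x - apoint k)\<^sup>2 + (y - bpoint k)\<^sup>2"
proof (rule ccontr)
  assume *: "\<not> ?thesis"
  have abs_less: "\<bar>z\<bar> < bpoint k / 2" if "z\<^sup>2 < (bpoint k / 2)\<^sup>2" for z
    using power2_less_imp_less[of "\<bar>z\<bar>" "bpoint k / 2"] that bpoint_pos[of k] by simp
  have "(x - apoint k)\<^sup>2 < (bpoint k / 2)\<^sup>2" "(y - bpoint k)\<^sup>2 < (bpoint k / 2)\<^sup>2"
    using * zero_le_power2[of "x - apoint k"] zero_le_power2[of "y - bpoint k"] by linarith+
  then have "\<bar>x - apoint k\<bar> < bpoint k / 2" "\<bar>y - bpoint k\<bar> < bpoint k / 2"
    using abs_less by auto
  then have x: "apoint k / 2 \<le> C * s" and y: "\<bar>y\<bar> < 2 * bpoint k"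
    using bpoint_le_apoint[of k] bpoint_pos[of k] C by linarith+
  have "apoint k / (2 * C) \<le> s" using x C(1) by (simp add: field_simps)
  then have "(apoint k / (2 * C)) ^ m \<le> s ^ m"
    using C apoint_pos[of k] by (intro power_mono) (auto intro: less_imp_le)
  then have "\<kappa> * (apoint k / (2 * C)) ^ m \<le> \<bar>y\<bar>"
    using mult_left_mono[of "(apoint k / (2 * C)) ^ m" "s ^ m" \<kappa>] \<kappa> by linarith
  then have lt: "\<kappa> / (2 * C) ^ m * apoint k ^ m < 2 * bpoint k"
    using y by (simp add: power_divide)
  have "2 * bpoint k = 2 * (apoint k ^ (k - m) * apoint k ^ m)"
    using k(1) by (simp add: bpoint_def flip: power_add)
  also have "apoint k ^ (k - m) \<le> apoint k ^ 1"
    using k(1) apoint_pos[of k] apoint_le_1[of k] by (intro power_decreasing) auto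
  then have "2 * (apoint k ^ (k - m) * apoint k ^ m) \<le> (2 * apoint k) * apoint k ^ m"
    using apoint_pos[of k] by simp
  also have "\<dots> \<le> \<kappa> / (2 * C) ^ m * apoint k ^ m"
    using k(2) apoint_pos[of k] by (intro mult_right_mono) auto
  finally show False using lt by simp
qed

text \<open>Off the origin continuity suffices, as the centres tend to the origin. At the origin
  \<open>X\<close> is Lipschitz, and \<open>Y\<close> either vanishes nearby, so that the vertical
  distance is \<open>bpoint k\<close>, or is bounded below by a power of \<open>t - t0\<close>. One
  \<open>N\<close> serves a whole neighbourhood of \<open>t0\<close>.\<close>

lemma curve_avoids_points:
  fixes X Y :: "(nat \<Rightarrow> real) \<Rightarrow> real"
  assumes qa: "quasianalytic (denjoy_carleman M :: nat \<Rightarrow> _ \<Rightarrow> ((nat \<Rightarrow> real) \<Rightarrow> 'f::real_normed_algebra_1) set)"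
    and U: "openin (Euclidean_space 1) U" and t0: "emb t0 \<in> U"
    and X: "X \<in> denjoy_carleman M 1 U" and Y: "Y \<in> denjoy_carleman M 1 U"
  obtains d N where "d > 0" "\<And>t k. \<bar>t - t0\<bar> < d \<Longrightarrow> N \<le> k \<Longrightarrow>
     (bpoint k / 2)\<^sup>2 \<le> (X (emb t) - apoint k)\<^sup>2 + (Y (emb t) - bpoint k)\<^sup>2"
proof -
  have sm: "X \<in> smooth_class 1 U" "Y \<in> smooth_class 1 U"
    using X Y by (simp_all add: denjoy_carleman_def)
  have "isCont (\<lambda>t. X (emb t)) t0" "isCont (\<lambda>t. Y (emb t)) t0"
    using smooth_class_1_has_deriv[OF sm(1) t0, of 0] smooth_class_1_has_deriv[OF sm(2) t0, of 0]
      has_vector_derivative_continuous by auto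
  then have cont: "\<forall>e>0. \<exists>d>0. \<forall>t. \<bar>t - t0\<bar> < d \<longrightarrow> \<bar>X (emb t) - X (emb t0)\<bar> < e"
    "\<forall>e>0. \<exists>d>0. \<forall>t. \<bar>t - t0\<bar> < d \<longrightarrow> \<bar>Y (emb t) - Y (emb t0)\<bar> < e"
    by (simp_all add: continuous_at_eps_delta dist_real_def)
  note result = that
  have far: thesis if e: "e > 0" and d: "d > 0"
    and far: "\<And>t. \<bar>t - t0\<bar> < d \<Longrightarrow> e \<le> \<bar>X (emb t)\<bar> \<or> e \<le> \<bar>Y (emb t)\<bar>" for e d
  proof -
    obtain N where N: "\<And>k. k \<ge> N \<Longrightarrow> apoint k \<le> e / 2"
      using eventually_apoint_le[of "e / 2"] e by auto
    show thesis
    proof (rule result[OF d])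
      fix t k assume tk: "\<bar>t - t0\<bar> < d" "N \<le> k"
      show "(bpoint k / 2)\<^sup>2 \<le> (X (emb t) - apoint k)\<^sup>2 + (Y (emb t) - bpoint k)\<^sup>2"
        by (rule avoid_if_coordinate_far[where d = e]) (use N[OF tk(2)] far[OF tk(1)] in auto)
    qed
  qed
  consider "X (emb t0) \<noteq> 0" | "Y (emb t0) \<noteq> 0" | "X (emb t0) = 0" "Y (emb t0) = 0" by blast
  then show thesis
  proof cases
    case 1
    then have e: "\<bar>X (emb t0)\<bar> / 2 > 0" by simp
    obtain d where d: "d > 0" "\<And>t. \<bar>t - t0\<bar> < d \<Longrightarrow> \<bar>X (emb t) - X (emb t0)\<bar> < \<bar>X (emb t0)\<bar> / 2"
      using cont(1) e by metis
    show thesis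
    proof (rule far[OF e d(1)])
      fix t assume "\<bar>t - t0\<bar> < d"
      from d(2)[OF this] show "\<bar>X (emb t0)\<bar> / 2 \<le> \<bar>X (emb t)\<bar> \<or> \<bar>X (emb t0)\<bar> / 2 \<le> \<bar>Y (emb t)\<bar>"
        by linarith
    qed
  next
    case 2
    then have e: "\<bar>Y (emb t0)\<bar> / 2 > 0" by simp
    obtain d where d: "d > 0" "\<And>t. \<bar>t - t0\<bar> < d \<Longrightarrow> \<bar>Y (emb t) - Y (emb t0)\<bar> < \<bar>Y (emb t0)\<bar> / 2"
      using cont(2) e by metis
    show thesis
    proof (rule far[OF e d(1)])
      fix t assume "\<bar>t - t0\<bar> < d"
      from d(2)[OF this] show "\<bar>Y (emb t0)\<bar> / 2 \<le> \<bar>X (emb t)\<bar> \<or> \<bar>Y (emb t0)\<bar> / 2 \<le> \<bar>Y (emb t)\<bar>"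
        by linarith
    qed
  next
    case 3
    obtain d1 A B where d1: "d1 > 0" "A > 0" "B > 0" "\<And>t. \<bar>t - t0\<bar> < d1 \<Longrightarrow> emb t \<in> U"
      "\<And>t n. \<bar>t - t0\<bar> < d1 \<Longrightarrow> norm ((partial_deriv 0 ^^ n) X (emb t)) \<le> A * B ^ n * fact n * M n"
      using denjoy_carleman_1_bounds[OF U X t0] by metis
    \<comment> \<open>The Denjoy-Carleman bound at order one gives the Lipschitz constant.\<close>
    define C where "C = max 1 (A * B * M 1)"
    have C: "C > 0" by (simp add: C_def)
    have XC: "\<bar>X (emb t)\<bar> \<le> C * \<bar>t - t0\<bar>" if t: "\<bar>t - t0\<bar> < d1" for t
    proof -
      have seg: "\<bar>s - t0\<bar> < d1" if "s \<in> closed_segment t t0" for s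
        using that t by (auto simp: closed_segment_eq_real_ivl split: if_splits)
      have "norm (X (emb t) - X (emb t0)) \<le> C * norm (t - t0)"
      proof (rule field_differentiable_bound[where S = "closed_segment t t0"])
        fix s assume s: "s \<in> closed_segment t t0"
        have "((\<lambda>t. (partial_deriv 0 ^^ 0) X (emb t)) has_real_derivative (partial_deriv 0 ^^ Suc 0) X (emb s)) (at s)"
          unfolding has_real_derivative_iff_has_vector_derivative
          by (rule smooth_class_1_has_deriv[OF sm(1) d1(4)[OF seg[OF s]]])
        then show "((\<lambda>t. X (emb t)) has_field_derivative (partial_deriv 0 ^^ Suc 0) X (emb s))
            (at s within closed_segment t t0)"
          by (simp add: has_field_derivative_at_within)
        show "norm ((partial_deriv 0 ^^ Suc 0) X (emb s)) \<le> C"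
          using d1(5)[OF seg[OF s], of "Suc 0"] by (simp add: C_def)
      qed auto
      then show ?thesis using 3 by simp
    qed
    from quasianalytic_zero_or_finite_order[OF qa U Y t0]
    show thesis
    proof cases
      case (1 d2)
      show thesis
      proof (rule that[of d2 0])
        fix t k assume "\<bar>t - t0\<bar> < d2"
        then have "Y (emb t) = 0" using 1 by blast
        moreover have "(bpoint k / 2)\<^sup>2 \<le> (bpoint k)\<^sup>2"
          using bpoint_pos[of k] by (intro power_mono) auto
        ultimately show "(bpoint k / 2)\<^sup>2 \<le> (X (emb t) - apoint k)\<^sup>2 + (Y (emb t) - bpoint k)\<^sup>2"
          by (simp add: add_increasing)
      qed (use 1 in auto)
    next
      case (2 d2 m \<kappa>)
      have "\<kappa> / (2 * C) ^ m / 2 > 0" using 2 C by simp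
      then obtain N where N: "\<And>k. k \<ge> N \<Longrightarrow> apoint k \<le> \<kappa> / (2 * C) ^ m / 2"
        using eventually_apoint_le by metis
      show thesis
      proof (rule that[of "min d1 d2" "max N (Suc m)"])
        fix t k assume t: "\<bar>t - t0\<bar> < min d1 d2" and k: "max N (Suc m) \<le> k"
        show "(bpoint k / 2)\<^sup>2 \<le> (X (emb t) - apoint k)\<^sup>2 + (Y (emb t) - bpoint k)\<^sup>2"
        proof (rule avoid_if_order[OF C _ 2(2)])
          show "\<bar>X (emb t)\<bar> \<le> C * \<bar>t - t0\<bar>" using XC t by simp
          show "\<kappa> * \<bar>t - t0\<bar> ^ m \<le> \<bar>Y (emb t)\<bar>" using 2(3) t by simp
          show "2 * apoint k \<le> \<kappa> / (2 * C) ^ m" using N[of k] k by simp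
        qed (use k in auto)
      qed (use d1 2 in auto)
    qed
  qed
qed

subsection \<open>Derivatives of the Gaussian\<close>

text \<open>Up to the sign \<open>(-1) ^ n\<close>, the \<open>n\<close>-th Hermite polynomial times
  the Gaussian; the recursion comes from differentiating \<open>g' = - 2 * t * g\<close>.\<close>

fun gauss_deriv :: "nat \<Rightarrow> real \<Rightarrow> real" where
  "gauss_deriv 0 t = exp (- t\<^sup>2)"
| "gauss_deriv (Suc 0) t = - 2 * t * exp (- t\<^sup>2)"
| "gauss_deriv (Suc (Suc n)) t = - 2 * t * gauss_deriv (Suc n) t - 2 * real (Suc n) * gauss_deriv n t"

lemma has_real_derivative_gauss_deriv:
  "(gauss_deriv n has_real_derivative gauss_deriv (Suc n) t) (at t)"
proof (induction n rule: less_induct)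
  case (less n)
  have ext: "gauss_deriv 0 = (\<lambda>t. exp (- t\<^sup>2))" "gauss_deriv (Suc 0) = (\<lambda>t. - 2 * t * exp (- t\<^sup>2))"
    "gauss_deriv (Suc (Suc m)) = (\<lambda>t. - 2 * t * gauss_deriv (Suc m) t - 2 * real (Suc m) * gauss_deriv m t)" for m
    by (auto simp: fun_eq_iff)
  consider "n = 0" | "n = Suc 0" | m where "n = Suc (Suc m)"
    by (metis not0_implies_Suc)
  then show ?case
  proof cases
    case 1
    then show ?thesis by (auto simp: ext(1) intro!: derivative_eq_intros)
  next
    case 2
    show ?thesis unfolding 2 ext(2)
      by (auto intro!: derivative_eq_intros simp: algebra_simps power2_eq_square)
  next
    case (3 m)
    note d1 = less.IH[of "Suc m"] and d0 = less.IH[of m]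
    have "((\<lambda>t. (- 2 * t) * gauss_deriv (Suc m) t - (2 * real (Suc m)) * gauss_deriv m t) has_real_derivative
       ((- 2) * gauss_deriv (Suc m) t + gauss_deriv (Suc (Suc m)) t * (- 2 * t)) -
       (2 * real (Suc m)) * gauss_deriv (Suc m) t) (at t)"
      by (intro DERIV_diff DERIV_mult DERIV_cmult d1 d0) (auto simp: 3 intro!: derivative_eq_intros)
    then show ?thesis
      unfolding 3 ext(3)[of m] by (rule DERIV_cong) (simp add: algebra_simps del: gauss_deriv.simps(1,2))
  qed
qed

text \<open>One term of the exponential series. It later trades powers of
  \<open>1 / (e k)\<^sup>2\<close> for powers of the inverse squared distance.\<close>

lemma power_le_fact_mult_exp:
  fixes x :: real
  assumes "0 \<le> x"
  shows "x ^ i \<le> fact i * exp x"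
proof -
  have "(\<Sum>n\<in>{i}. x ^ n /\<^sub>R fact n) \<le> (\<Sum>n. x ^ n /\<^sub>R fact n)"
    by (rule sum_le_suminf) (use assms sums_summable[OF exp_converges[of x]] in auto)
  then have "x ^ i / fact i \<le> exp x"
    by (simp add: exp_def divide_inverse mult.commute)
  then show ?thesis by (simp add: divide_le_eq mult.commute)
qed

text \<open>The weight \<open>\<bar>t\<bar> ^ j\<close> is there for the induction, since the
  recursion multiplies by \<open>t\<close>; the case \<open>j = 0\<close> is the one applied
  later.\<close>

lemma gauss_deriv_bounded:
  "\<exists>C. \<forall>t. \<bar>t\<bar> ^ j * \<bar>gauss_deriv n t\<bar> \<le> C"
proof (induction n arbitrary: j rule: less_induct)
  case (less n)
  have base: "\<bar>t\<bar> ^ j * exp (- t\<^sup>2) \<le> 1 + fact j" for t :: real and j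
  proof -
    have "\<bar>t\<bar> ^ j \<le> 1 + (t\<^sup>2) ^ j"
    proof (cases "\<bar>t\<bar> \<le> 1")
      case True
      then have "\<bar>t\<bar> ^ j \<le> 1" by (simp add: power_le_one)
      then show ?thesis by (simp add: add_increasing2)
    next
      case False
      then have "\<bar>t\<bar> ^ j \<le> \<bar>t\<bar> ^ (2 * j)" by (intro power_increasing) auto
      then show ?thesis by (simp add: power_mult)
    qed
    then have "\<bar>t\<bar> ^ j * exp (- t\<^sup>2) \<le> (1 + (t\<^sup>2) ^ j) * exp (- t\<^sup>2)"
      by (intro mult_right_mono) auto
    also have "\<dots> = exp (- t\<^sup>2) + (t\<^sup>2) ^ j * exp (- t\<^sup>2)" by (simp add: algebra_simps)
    also have "\<dots> \<le> 1 + (fact j * exp (t\<^sup>2)) * exp (- t\<^sup>2)"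
      by (intro add_mono mult_right_mono power_le_fact_mult_exp) auto
    also have "\<dots> = 1 + fact j" by (simp add: mult.assoc flip: exp_add)
    finally show ?thesis .
  qed
  consider "n = 0" | "n = Suc 0" | m where "n = Suc (Suc m)"
    by (metis not0_implies_Suc)
  then show ?case
  proof cases
    case 1
    then show ?thesis using base[of _ j] by auto
  next
    case 2
    have "\<bar>t\<bar> ^ j * \<bar>gauss_deriv n t\<bar> \<le> 2 * (1 + fact (Suc j))" for t
      using base[of t "Suc j"] by (simp add: 2 abs_mult mult_ac del: fact_Suc)
    then show ?thesis by blast
  next
    case (3 m)
    obtain C1 where C1: "\<And>t. \<bar>t\<bar> ^ Suc j * \<bar>gauss_deriv (Suc m) t\<bar> \<le> C1"
      using less.IH[of "Suc m" "Suc j"] 3 by auto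
    obtain C2 where C2: "\<And>t. \<bar>t\<bar> ^ j * \<bar>gauss_deriv m t\<bar> \<le> C2"
      using less.IH[of m j] 3 by auto
    have "\<bar>t\<bar> ^ j * \<bar>gauss_deriv n t\<bar> \<le> 2 * C1 + 2 * real (Suc m) * C2" for t
    proof -
      have "\<bar>gauss_deriv n t\<bar> \<le> 2 * \<bar>t\<bar> * \<bar>gauss_deriv (Suc m) t\<bar> + 2 * real (Suc m) * \<bar>gauss_deriv m t\<bar>"
        unfolding 3 gauss_deriv.simps(3)
        by (rule order_trans[OF abs_triangle_ineq4]) (simp add: abs_mult del: gauss_deriv.simps of_nat_Suc)
      then have "\<bar>t\<bar> ^ j * \<bar>gauss_deriv n t\<bar> \<le>
          \<bar>t\<bar> ^ j * (2 * \<bar>t\<bar> * \<bar>gauss_deriv (Suc m) t\<bar> + 2 * real (Suc m) * \<bar>gauss_deriv m t\<bar>)"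
        by (intro mult_left_mono) auto
      also have "\<dots> = 2 * (\<bar>t\<bar> ^ Suc j * \<bar>gauss_deriv (Suc m) t\<bar>) + 2 * real (Suc m) * (\<bar>t\<bar> ^ j * \<bar>gauss_deriv m t\<bar>)"
        by (simp add: algebra_simps del: gauss_deriv.simps)
      also have "\<dots> \<le> 2 * C1 + 2 * real (Suc m) * C2"
        by (intro add_mono mult_left_mono C1 C2) auto
      finally show ?thesis .
    qed
    then show ?thesis by blast
  qed
qed

text \<open>At \<open>0\<close> only the second term of the recursion survives. Odd derivatives
  vanish there, which is why the construction tests the order \<open>2 * k\<close>.\<close>

lemma gauss_deriv_even_0: "1 \<le> \<bar>gauss_deriv (2 * m) 0\<bar>"
proof (induction m)
  case (Suc m)
  have "1 * 1 \<le> (2 * real (Suc (2 * m))) * \<bar>gauss_deriv (2 * m) 0\<bar>"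
    using Suc by (intro mult_mono) auto
  then show ?case by (simp add: abs_mult del: of_nat_Suc)
qed simp

subsection \<open>The squared distance from a point to a curve\<close>

text \<open>Taylor coefficients of the squared distance, with the squares multiplied out so that
  \<open>a\<close> and \<open>b\<close> enter linearly in all orders but \<open>0\<close>.\<close>

definition dist_coeff :: "real \<Rightarrow> real \<Rightarrow> (nat \<Rightarrow> real) \<Rightarrow> (nat \<Rightarrow> real) \<Rightarrow> nat \<Rightarrow> real" where
  "dist_coeff a b x y n = (\<Sum>j\<le>n. x j * x (n - j)) + (\<Sum>j\<le>n. y j * y (n - j))
     - 2 * a * x n - 2 * b * y n + (if n = 0 then a\<^sup>2 + b\<^sup>2 else 0)"

lemma dist_coeff_0: "dist_coeff a b x y 0 = (x 0 - a)\<^sup>2 + (y 0 - b)\<^sup>2"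
  by (simp add: dist_coeff_def power2_eq_square algebra_simps)

lemma has_real_derivative_dist_coeff:
  assumes x: "\<And>n. (x n has_real_derivative real (Suc n) * x (Suc n) t) (at t)"
    and y: "\<And>n. (y n has_real_derivative real (Suc n) * y (Suc n) t) (at t)"
  shows "((\<lambda>t. dist_coeff a b (\<lambda>n. x n t) (\<lambda>n. y n t) n) has_real_derivative
     real (Suc n) * dist_coeff a b (\<lambda>n. x n t) (\<lambda>n. y n t) (Suc n)) (at t)"
proof -
  have "((\<lambda>t. (\<Sum>j\<le>n. x j t * x (n - j) t) + (\<Sum>j\<le>n. y j t * y (n - j) t)
     - 2 * a * x n t - 2 * b * y n t + (if n = 0 then a\<^sup>2 + b\<^sup>2 else 0)) has_real_derivative
     real (Suc n) * (\<Sum>j\<le>Suc n. x j t * x (Suc n - j) t) + real (Suc n) * (\<Sum>j\<le>Suc n. y j t * y (Suc n - j) t)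
     - 2 * a * (real (Suc n) * x (Suc n) t) - 2 * b * (real (Suc n) * y (Suc n) t) + 0) (at t)"
    by (intro DERIV_add DERIV_diff DERIV_cmult has_real_derivative_convolution x y DERIV_const)
  then show ?thesis
    unfolding dist_coeff_def
    by (rule DERIV_cong) (simp add: algebra_simps del: of_nat_Suc sum.atMost_Suc)
qed

text \<open>The centre enters only through its coordinates lying between \<open>0\<close> and
  \<open>1\<close>, so the constants are common to all centres. Order \<open>0\<close> is left to
  the base estimate for the exponential.\<close>

lemma dist_coeff_bound:
  assumes M: "weight_sequence M" and A: "0 \<le> A" and B: "0 \<le> B"
    and x: "\<And>n. \<bar>x n\<bar> \<le> A * B ^ n * M n" and y: "\<And>n. \<bar>y n\<bar> \<le> A * B ^ n * M n"
    and ab: "0 \<le> a" "a \<le> 1" "0 \<le> b" "b \<le> 1" and n: "1 \<le> n"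
  shows "\<bar>dist_coeff a b x y n\<bar> \<le> (2 * A\<^sup>2 + 4 * A) * (2 * B) ^ n * M n"
proof -
  have pos: "M n > 0" using M by (simp add: weight_sequence_def)
  have lin: "\<bar>2 * a * z\<bar> \<le> 2 * (A * (2 * B) ^ n * M n)"
    if a: "0 \<le> a" "a \<le> 1" and z: "\<bar>z\<bar> \<le> A * B ^ n * M n" for a z
  proof -
    have "\<bar>2 * a * z\<bar> = 2 * (a * \<bar>z\<bar>)" using a by (simp add: abs_mult)
    also have "\<dots> \<le> 2 * (1 * \<bar>z\<bar>)" using a by (intro mult_left_mono mult_right_mono) auto
    also have "\<dots> \<le> 2 * (A * B ^ n * M n)" using z by simp
    also have "\<dots> \<le> 2 * (A * (2 * B) ^ n * M n)"
      using A B pos by (intro mult_left_mono mult_right_mono power_mono) auto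
    finally show ?thesis .
  qed
  have "\<bar>dist_coeff a b x y n\<bar> \<le> \<bar>\<Sum>j\<le>n. x j * x (n - j)\<bar> + \<bar>\<Sum>j\<le>n. y j * y (n - j)\<bar>
      + \<bar>2 * a * x n\<bar> + \<bar>2 * b * y n\<bar>"
    using n unfolding dist_coeff_def by simp
  also have "\<dots> \<le> A\<^sup>2 * (2 * B) ^ n * M n + A\<^sup>2 * (2 * B) ^ n * M n
      + 2 * (A * (2 * B) ^ n * M n) + 2 * (A * (2 * B) ^ n * M n)"
    by (intro add_mono convolution_bound M A B x y lin ab)
  also have "\<dots> = (2 * A\<^sup>2 + 4 * A) * (2 * B) ^ n * M n" by (simp add: algebra_simps)
  finally show ?thesis .
qed

subsection \<open>The counterexample\<close>

text \<open>The bump at \<open>(apoint k, bpoint k)\<close> has height \<open>c k\<close> and width \<open>e k\<close>. By \<open>c_flat\<close> it is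
  harmless at distance at least \<open>bpoint k / 2\<close> from its centre, by \<open>c_smooth\<close> the sum of the bumps is
  smooth, and by \<open>c_big\<close> the derivative of order \<open>2 * k\<close> at the centre violates the estimates.\<close>

locale bumps =
  fixes M c e :: "nat \<Rightarrow> real"
  assumes weight: "weight_sequence M"
    and unbounded: "\<not> (\<exists>R. \<forall>n. M n \<le> R ^ n)"
    and c_pos: "\<And>k. 0 < c k" and e_pos: "\<And>k. 0 < e k" and e_le_1: "\<And>k. e k \<le> 1"
    and c_flat: "\<And>k i. c k * (1 / (bpoint k / 2)\<^sup>2) ^ i \<le> (1/2) ^ k * M i"
    and c_smooth: "\<And>k n. n < 2 * k \<Longrightarrow> c k / e k ^ n \<le> (1/2) ^ k"
    and c_big: "\<And>k. 1 \<le> k \<Longrightarrow> real k ^ (2 * k) * (fact (2 * k) * M (2 * k)) \<le> c k / e k ^ (2 * k)"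

lemma bumps_exist:
  assumes M: "weight_sequence M" and unb: "\<not> (\<exists>R. \<forall>n. M n \<le> R ^ n)"
  obtains c e where "bumps M c e"
proof -
  have "\<exists>L\<ge>1. \<forall>i. (1 / (bpoint k / 2)\<^sup>2) ^ i \<le> L * M i" for k
    using weight_sequence_dominates_powers[OF M unb, of "1 / (bpoint k / 2)\<^sup>2"] by metis
  then obtain L where L: "\<And>k. L k \<ge> 1" "\<And>k i. (1 / (bpoint k / 2)\<^sup>2) ^ i \<le> L k * M i" by metis
  have 1: "1 \<le> M n" for n using weight_sequence_ge_1[OF M] .
  \<comment> \<open>\<open>L\<close> depends on the centre alone. \<open>H\<close> is the size
    wanted at order \<open>2 * k\<close>, and the choices of \<open>e\<close> and \<open>c\<close>
    make \<open>c k / e k ^ (2 * k)\<close> equal to it for \<open>k \<ge> 1\<close>. The maximum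
    with \<open>1\<close> ensures \<open>e k \<le> 1\<close>.\<close>
  define H where "H k = max 1 (real k ^ (2 * k) * (fact (2 * k) * M (2 * k)))" for k
  define e where "e k = (1/2) ^ k / (L k * H k)" for k
  \<comment> \<open>For \<open>k = 0\<close> the truncated exponent is \<open>0\<close>;
    \<open>c_smooth\<close> is then void and \<open>c_big\<close> starts at
    \<open>1\<close>.\<close>
  define c where "c k = (1/2) ^ k * e k ^ (2 * k - 1) / L k" for k
  have H: "H k \<ge> 1" for k by (simp add: H_def)
  have L0: "L k > 0" for k using L(1)[of k] by simp
  have H0: "H k > 0" for k using H[of k] by simp
  have e0: "e k > 0" for k unfolding e_def using L0 H0 by simp
  have e1: "e k \<le> 1" for k
  proof -
    have "(1/2::real) ^ k \<le> 1" by (simp add: power_le_one)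
    also have "1 \<le> L k * H k" using mult_mono[OF L(1)[of k] H[of k]] L0[of k] by simp
    finally show ?thesis unfolding e_def using L0 H0 by simp
  qed
  have c0: "c k > 0" for k unfolding c_def using e0 L0 by simp
  have half: "(1/2::real) ^ k > 0" for k by simp
  have "bumps M c e"
  proof
    fix k i
    have "c k * (1 / (bpoint k / 2)\<^sup>2) ^ i \<le> c k * (L k * M i)"
      using c0[of k] L(2) by (intro mult_left_mono) (auto intro: less_imp_le)
    also have "\<dots> = (1/2) ^ k * (e k ^ (2 * k - 1) * M i)"
      using L0[of k] by (simp add: c_def)
    also have "\<dots> \<le> (1/2) ^ k * (1 * M i)"
      using e0[of k] e1[of k] 1[of i] by (intro mult_left_mono mult_right_mono power_le_one) auto
    finally show "c k * (1 / (bpoint k / 2)\<^sup>2) ^ i \<le> (1/2) ^ k * M i" by simp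
  next
    fix k n :: nat assume n: "n < 2 * k"
    then have "e k ^ (2 * k - 1) = e k ^ (2 * k - 1 - n) * e k ^ n"
      by (simp flip: power_add)
    then have "c k / e k ^ n = (1/2) ^ k * (e k ^ (2 * k - 1 - n) / L k)"
      using e0[of k] by (simp add: c_def)
    also have "\<dots> \<le> (1/2) ^ k * 1"
    proof (rule mult_left_mono)
      have "e k ^ (2 * k - 1 - n) \<le> 1" using e0[of k] e1[of k] by (intro power_le_one) auto
      then show "e k ^ (2 * k - 1 - n) / L k \<le> 1" using L(1)[of k] by (simp add: divide_le_eq)
    qed simp
    finally show "c k / e k ^ n \<le> (1/2) ^ k" by simp
  next
    fix k :: nat assume k: "1 \<le> k"
    have "2 * k = Suc (2 * k - 1)" using k by simp
    then have eq: "e k ^ (2 * k) = e k ^ (2 * k - 1) * e k" by (metis power_Suc2)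
    have "e k ^ (2 * k - 1) \<noteq> 0" using e0[of k] by simp
    then have "c k / e k ^ (2 * k) = (1/2) ^ k / (L k * e k)"
      unfolding c_def eq by (simp add: divide_divide_eq_left)
    also have "\<dots> = H k" using L0[of k] H0[of k] by (simp add: e_def)
    finally show "real k ^ (2 * k) * (fact (2 * k) * M (2 * k)) \<le> c k / e k ^ (2 * k)"
      by (simp add: H_def)
  qed (use M unb c0 e0 e1 in auto)
  then show thesis by (rule that)
qed

context bumps begin

section \<open>The sum of the bumps and its partial derivatives\<close>

definition bump_sum :: "(nat \<Rightarrow> real) \<Rightarrow> real" where
  "bump_sum x = (\<Sum>k. c k * exp (- (1 / (e k)\<^sup>2) * ((x 0 - apoint k)\<^sup>2 + (x 1 - bpoint k)\<^sup>2)))"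

text \<open>A Gaussian of a sum of two squares is a product of two one-variable Gaussians.
  Coordinates from \<open>2\<close> on contribute the constant \<open>1\<close>, so products over
  all \<open>p\<close> coordinates can be differentiated uniformly.\<close>

definition factor :: "nat \<Rightarrow> nat \<Rightarrow> nat \<Rightarrow> real \<Rightarrow> real" where
  "factor k j n t =
     (if j = 0 then gauss_deriv n ((t - apoint k) / e k) / e k ^ n
      else if j = 1 then gauss_deriv n ((t - bpoint k) / e k) / e k ^ n
      else if n = 0 then 1 else 0)"

lemma has_real_derivative_factor:
  "(factor k j n has_real_derivative factor k j (Suc n) t) (at t)"
proof -
  have "((\<lambda>t. gauss_deriv n ((t - a) / e k) / e k ^ n) has_real_derivative
      gauss_deriv (Suc n) ((t - a) / e k) / e k ^ Suc n) (at t)" for a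
  proof -
    have "((\<lambda>t. (t - a) / e k) has_real_derivative (1 - 0) / e k) (at t)"
      by (intro DERIV_cdivide DERIV_diff DERIV_ident DERIV_const)
    from DERIV_cdivide[OF DERIV_chain2[OF has_real_derivative_gauss_deriv this]]
    have "((\<lambda>t. gauss_deriv n ((t - a) / e k) / e k ^ n) has_real_derivative
       gauss_deriv (Suc n) ((t - a) / e k) * ((1 - 0) / e k) / e k ^ n) (at t)" .
    then show ?thesis by (rule DERIV_cong) simp
  qed
  from this[of "apoint k"] this[of "bpoint k"] show ?thesis
    unfolding factor_def[abs_def] by (cases "j = 0"; cases "j = 1") simp_all
qed

definition bump_deriv :: "nat \<Rightarrow> nat \<Rightarrow> nat list \<Rightarrow> (nat \<Rightarrow> real) \<Rightarrow> real" where
  "bump_deriv p k js x = (\<Prod>j<p. factor k j (count_list js j) (x j)) *\<^sub>R c k"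

lemma prod_split_two:
  fixes g :: "nat \<Rightarrow> real"
  assumes "2 \<le> p"
  shows "(\<Prod>j<p. g j) = g 0 * g 1 * (\<Prod>j\<in>{2..<p}. g j)"
proof -
  have "{..<p} = insert 0 (insert 1 {2..<p})" using assms by auto
  then show ?thesis by (simp add: mult.assoc)
qed

lemma bump_deriv_Nil:
  assumes "2 \<le> p"
  shows "bump_deriv p k [] x = c k * exp (- (1 / (e k)\<^sup>2) * ((x 0 - apoint k)\<^sup>2 + (x 1 - bpoint k)\<^sup>2))"
proof -
  have "(\<Prod>j\<in>{2..<p}. factor k j (count_list [] j) (x j)) = 1"
    by (rule prod.neutral) (simp add: factor_def)
  then show ?thesis
    unfolding bump_deriv_def prod_split_two[OF assms]
    by (simp add: factor_def mult.commute power_divide add_divide_distrib flip: exp_add)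
qed

lemma bump_deriv_bound:
  obtains C N where "0 \<le> C" "\<And>k x. \<bar>bump_deriv p k js x\<bar> \<le> C * (c k / e k ^ N)"
proof -
  have "\<exists>C. \<forall>t. \<bar>gauss_deriv n t\<bar> \<le> C" for n
    using gauss_deriv_bounded[of 0 n] by simp
  then obtain G' where G': "\<And>n t. \<bar>gauss_deriv n t\<bar> \<le> G' n" by metis
  define G where "G n = max 1 (G' n)" for n
  have G: "\<bar>gauss_deriv n t\<bar> \<le> G n" "1 \<le> G n" for n t
    using G'[of n t] by (auto simp: G_def)
  have fb: "\<bar>factor k j n t\<bar> \<le> G n * (1 / e k) ^ n" for k j n t
  proof -
    have "\<bar>gauss_deriv n s / e k ^ n\<bar> \<le> G n * (1 / e k) ^ n" for s
      using divide_right_mono[OF G(1)[of n s], of "e k ^ n"] e_pos[of k] by (simp add: power_divide)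
    \<comment> \<open>This lets the same bound cover the trivial factors of the coordinates from
      \<open>2\<close> on.\<close>
    moreover have "1 * 1 \<le> G n * (1 / e k) ^ n"
      using G(2)[of n] e_pos[of k] e_le_1[of k] by (intro mult_mono one_le_power) auto
    ultimately show ?thesis using G(2)[of 0] unfolding factor_def by simp
  qed
  define C where "C = (\<Prod>j<p. G (count_list js j))"
  define N where "N = (\<Sum>j<p. count_list js j)"
  show thesis
  proof (rule that)
    show "0 \<le> C" unfolding C_def using G(2) by (intro prod_nonneg) (meson order_trans zero_le_one)
    fix k x
    have "\<bar>bump_deriv p k js x\<bar> = (\<Prod>j<p. \<bar>factor k j (count_list js j) (x j)\<bar>) * c k"
      using c_pos[of k] by (simp add: bump_deriv_def abs_mult abs_prod)
    also have "\<dots> \<le> (\<Prod>j<p. G (count_list js j) * (1 / e k) ^ count_list js j) * c k"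
      by (intro mult_right_mono prod_mono conjI fb) (use c_pos[of k] in auto)
    also have "\<dots> = C * (c k / e k ^ N)"
      by (simp add: C_def N_def power_sum power_divide prod_dividef)
    finally show "\<bar>bump_deriv p k js x\<bar> \<le> C * (c k / e k ^ N)" .
  qed
qed

lemma summable_height: "summable (\<lambda>k. c k / e k ^ n)"
proof (rule summable_comparison_test_ev)
  show "\<forall>\<^sub>F k in sequentially. norm (c k / e k ^ n) \<le> (1/2) ^ k"
    using eventually_gt_at_top[of n]
  proof eventually_elim
    case (elim k)
    then show ?case using c_smooth[of n k] c_pos[of k] e_pos[of k] by simp
  qed
qed (auto intro: summable_geometric)

lemma
  assumes p: "2 \<le> p"
  shows bump_sum_smooth: "bump_sum \<in> smooth_class p (RR p)"
    and iterated_partial_bump_sum: "\<And>js x. set js \<subseteq> {..<p} \<Longrightarrow> x \<in> RR p \<Longrightarrow>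
      iterated_partial js bump_sum x = (\<Sum>k. bump_deriv p k js x)"
proof -
  have U: "openin (Euclidean_space p) (RR p)" by simp
  have f_eq: "bump_sum x = (\<Sum>k. bump_deriv p k [] x)" for x
    unfolding bump_sum_def bump_deriv_Nil[OF p] ..
  have Fd: "((\<lambda>t. bump_deriv p k js (x(i := t))) has_vector_derivative bump_deriv p k (i # js) x) (at (x i))"
    if "set js \<subseteq> {..<p}" "x \<in> RR p" "i < p" for k js x i
    unfolding bump_deriv_def
    by (rule prod_has_vector_derivative[where \<Phi> = "factor k", OF has_real_derivative_factor that(3)])
  have Fc: "continuous_on (RR p) (bump_deriv p k js)" if "set js \<subseteq> {..<p}" for k js
    unfolding bump_deriv_def
    by (rule continuous_on_prod_coordinates[where \<Phi> = "factor k", OF has_real_derivative_factor])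
  have Fb: "\<exists>V b. openin (Euclidean_space p) V \<and> x \<in> V \<and> V \<subseteq> RR p \<and> summable b \<and>
         (\<forall>k. \<forall>y\<in>V. norm (bump_deriv p k js y) \<le> b k)" if "set js \<subseteq> {..<p}" "x \<in> RR p" for js x
  proof -
    obtain C N where "\<And>k x. \<bar>bump_deriv p k js x\<bar> \<le> C * (c k / e k ^ N)"
      using bump_deriv_bound[of p js] by metis
    then show ?thesis
      using that U summable_mult[OF summable_height[of N], of C]
      by (intro exI[of _ "RR p"] exI[of _ "\<lambda>k. C * (c k / e k ^ N)"]) simp
  qed
  show "bump_sum \<in> smooth_class p (RR p)"
    by (rule smooth_class_suminf(1)[where F = "bump_deriv p", OF U]) (rule f_eq Fd Fc Fb; assumption)+
  show "iterated_partial js bump_sum x = (\<Sum>k. bump_deriv p k js x)"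
    if "set js \<subseteq> {..<p}" "x \<in> RR p" for js x
    by (rule smooth_class_suminf(2)[where F = "bump_deriv p", OF U _ _ _ _ that]) (rule f_eq Fd Fc Fb; assumption)+
qed

section \<open>The bumps along a curve\<close>

lemma bump_term_bound:
  assumes x: "\<And>n. \<bar>x n\<bar> \<le> A * B ^ n * M n" and y: "\<And>n. \<bar>y n\<bar> \<le> A * B ^ n * M n"
    and A: "0 \<le> A" and B: "0 \<le> B" and K: "0 \<le> K"
    and base: "\<And>i. c k * (1 / (e k)\<^sup>2) ^ i *
       exp (- (1 / (e k)\<^sup>2) * ((x 0 - apoint k)\<^sup>2 + (y 0 - bpoint k)\<^sup>2)) \<le> K * fact i * M i"
  shows "c k * \<bar>exp_coeff (1 / (e k)\<^sup>2) (dist_coeff (apoint k) (bpoint k) x y) n\<bar> \<le>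
     K * (2 * (2 * B) * (1 + (2 * A\<^sup>2 + 4 * A) * M 1)) ^ n * M n"
proof -
  have "c k * (1 / (e k)\<^sup>2) ^ 0 * \<bar>exp_coeff (1 / (e k)\<^sup>2) (dist_coeff (apoint k) (bpoint k) x y) n\<bar> \<le>
     K * (fact (n + 0) / fact n) * (2 * (2 * B) * (1 + (2 * A\<^sup>2 + 4 * A) * M 1)) ^ n * M (n + 0)"
  \<comment> \<open>Only the case \<open>i = 0\<close> is wanted; the other \<open>i\<close> served
    the induction. The width enters through \<open>base\<close> alone, so the geometric rate is the
    same for all bumps.\<close>
  proof (rule exp_coeff_bound[OF weight])
    show "\<bar>dist_coeff (apoint k) (bpoint k) x y j\<bar> \<le> (2 * A\<^sup>2 + 4 * A) * (2 * B) ^ j * M j" if "1 \<le> j" for j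
      by (rule dist_coeff_bound[OF weight A B x y _ _ _ _ that])
        (use apoint_pos[of k] apoint_le_1[of k] bpoint_pos[of k] bpoint_le_apoint[of k] in linarith)+
  qed (use A B K c_pos[of k] base dist_coeff_0 in \<open>auto intro: less_imp_le\<close>)
  then show ?thesis by simp
qed

text \<open>The exponential series at \<open>l * u\<close> eliminates \<open>l\<close>; the
  remaining powers of the inverse squared distance are absorbed by the height, through
  \<open>c_flat\<close>.\<close>

lemma base_far:
  assumes u: "(bpoint k / 2)\<^sup>2 \<le> u"
  shows "c k * (1 / (e k)\<^sup>2) ^ i * exp (- (1 / (e k)\<^sup>2) * u) \<le> (1/2) ^ k * fact i * M i"
proof -
  define l where "l = 1 / (e k)\<^sup>2"
  have l: "l > 0" using e_pos[of k] by (simp add: l_def)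
  have r: "(bpoint k / 2)\<^sup>2 > 0" using bpoint_pos[of k] by simp
  have u0: "u > 0" using r u by linarith
  have "l ^ i * u ^ i \<le> fact i * exp (l * u)"
    using power_le_fact_mult_exp[of "l * u" i] l u0 by (simp add: power_mult_distrib)
  then have "(l ^ i * u ^ i) * exp (- l * u) \<le> (fact i * exp (l * u)) * exp (- l * u)"
    by (intro mult_right_mono) auto
  also have "\<dots> = fact i" by (simp add: mult.assoc flip: exp_add)
  finally have "l ^ i * exp (- l * u) * u ^ i \<le> fact i" by (simp add: mult_ac)
  then have "l ^ i * exp (- l * u) \<le> fact i / u ^ i" using u0 by (simp add: le_divide_eq)
  also have "\<dots> \<le> fact i / ((bpoint k / 2)\<^sup>2) ^ i"
    using u r u0 by (intro divide_left_mono power_mono[of _ _ i] mult_pos_pos zero_less_power[of _ i]) simp_all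
  also have "\<dots> = fact i * (1 / (bpoint k / 2)\<^sup>2) ^ i"
    by (simp only: power_one_over) simp
  finally have "c k * (l ^ i * exp (- l * u)) \<le> c k * (fact i * (1 / (bpoint k / 2)\<^sup>2) ^ i)"
    using c_pos[of k] by (intro mult_left_mono) simp_all
  also have "\<dots> = fact i * (c k * (1 / (bpoint k / 2)\<^sup>2) ^ i)" by simp
  also have "\<dots> \<le> fact i * ((1/2) ^ k * M i)" by (intro mult_left_mono c_flat) auto
  finally show ?thesis by (simp add: l_def mult_ac)
qed

text \<open>For the finitely many bumps that a curve may come close to: the exponential is at most
  \<open>1\<close>, and \<open>M\<close> dominates the powers of \<open>1 / (e k)\<^sup>2\<close>,
  with a constant depending on \<open>k\<close>.\<close>

lemma base_near:
  obtains K where "0 \<le> K" "\<And>i u. 0 \<le> u \<Longrightarrow>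
    c k * (1 / (e k)\<^sup>2) ^ i * exp (- (1 / (e k)\<^sup>2) * u) \<le> K * fact i * M i"
proof -
  obtain L where L: "L \<ge> 1" "\<And>n. (1 / (e k)\<^sup>2) ^ n \<le> L * M n"
    using weight_sequence_dominates_powers[OF weight unbounded] by metis
  show thesis
  proof (rule that[of "c k * L"])
    show "0 \<le> c k * L" using c_pos[of k] L by simp
    fix i and u :: real assume u: "0 \<le> u"
    have 1: "1 \<le> M i" using weight_sequence_ge_1[OF weight] .
    have "c k * (1 / (e k)\<^sup>2) ^ i * exp (- (1 / (e k)\<^sup>2) * u) \<le> c k * (L * M i) * 1"
      using c_pos[of k] L u 1 by (intro mult_mono mult_left_mono) auto
    also have "\<dots> \<le> c k * (L * M i) * fact i"
      using c_pos[of k] L 1 by (intro mult_left_mono) auto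
    finally show "c k * (1 / (e k)\<^sup>2) ^ i * exp (- (1 / (e k)\<^sup>2) * u) \<le> c k * L * fact i * M i"
      by (simp add: mult_ac)
  qed
qed

text \<open>Near a given parameter all bumps from some \<open>N\<close> on are avoided and
  contribute at most \<open>(1/2) ^ k\<close> each; the earlier ones have individual constants. All
  share one geometric rate, so the sum obeys the estimates.\<close>

lemma bump_sum_curve:
  fixes X Y :: "(nat \<Rightarrow> real) \<Rightarrow> real"
  assumes qa: "quasianalytic (denjoy_carleman M :: nat \<Rightarrow> _ \<Rightarrow> ((nat \<Rightarrow> real) \<Rightarrow> 'f::real_normed_algebra_1) set)"
    and U: "openin (Euclidean_space 1) U"
    and X: "X \<in> denjoy_carleman M 1 U" and Y: "Y \<in> denjoy_carleman M 1 U"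
  shows "(\<lambda>s. \<Sum>k. c k * exp (- (1 / (e k)\<^sup>2) * ((X s - apoint k)\<^sup>2 + (Y s - bpoint k)\<^sup>2)))
     \<in> denjoy_carleman M 1 U"
proof -
  have sm: "X \<in> smooth_class 1 U" "Y \<in> smooth_class 1 U"
    using X Y by (simp_all add: denjoy_carleman_def)
  have Mpos: "M n > 0" for n using weight by (simp add: weight_sequence_def)
  define x where "x n t = (partial_deriv 0 ^^ n) X (emb t) / fact n" for n t
  define y where "y n t = (partial_deriv 0 ^^ n) Y (emb t) / fact n" for n t
  define v where "v k t = dist_coeff (apoint k) (bpoint k) (\<lambda>n. x n t) (\<lambda>n. y n t)" for k t
  \<comment> \<open>The factor \<open>fact n\<close> turns the Taylor coefficient of the
    \<open>k\<close>-th bump along the curve into its \<open>n\<close>-th derivative.\<close>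
  define E where "E k n t = fact n * (c k * exp_coeff (1 / (e k)\<^sup>2) (v k t) n)" for k n t
  have E': "(E k n has_vector_derivative E k (Suc n) t) (at t)" if t: "emb t \<in> U" for k n t
  proof -
    have x': "(x n has_real_derivative real (Suc n) * x (Suc n) t) (at t)" for n
      unfolding x_def[abs_def] by (rule has_real_derivative_normalized[OF sm(1) t])
    have y': "(y n has_real_derivative real (Suc n) * y (Suc n) t) (at t)" for n
      unfolding y_def[abs_def] by (rule has_real_derivative_normalized[OF sm(2) t])
    have "((\<lambda>t. v k t n) has_real_derivative real (Suc n) * v k t (Suc n)) (at t)" for n
      unfolding v_def by (rule has_real_derivative_dist_coeff[OF x' y'])
    from has_real_derivative_exp_coeff[where u = "\<lambda>n t. v k t n", OF this, of "1 / (e k)\<^sup>2" n]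
    have "((\<lambda>t. exp_coeff (1 / (e k)\<^sup>2) (v k t) n) has_real_derivative
        real (Suc n) * exp_coeff (1 / (e k)\<^sup>2) (v k t) (Suc n)) (at t)" .
    from DERIV_cmult[OF DERIV_cmult[OF this, of "c k"], of "fact n"]
    show ?thesis
      unfolding E_def[abs_def] has_real_derivative_iff_has_vector_derivative[symmetric]
      by (rule DERIV_cong) (simp add: fact_Suc mult_ac del: of_nat_Suc exp_coeff.simps)
  qed
  \<comment> \<open>The dependence on the bump and on the order are separated: a summable
    \<open>\<kappa>\<close> and a common rate \<open>D\<close> yield both termwise differentiability
    and the final estimate.\<close>
  have E_bound: "\<exists>d A D \<kappa>. d > 0 \<and> A > 0 \<and> D > 0 \<and> summable \<kappa> \<and> (\<Sum>k. \<kappa> k) \<le> A \<and>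
      (\<forall>t. \<bar>t - t0\<bar> < d \<longrightarrow> emb t \<in> U \<and> (\<forall>k n. norm (E k n t) \<le> \<kappa> k * (D ^ n * fact n * M n)))"
    if t0: "emb t0 \<in> U" for t0
  proof -
    obtain d1 A1 B1 where d1: "d1 > 0" "A1 > 0" "B1 > 0" "\<And>t. \<bar>t - t0\<bar> < d1 \<Longrightarrow> emb t \<in> U"
      "\<And>t n. \<bar>t - t0\<bar> < d1 \<Longrightarrow> norm ((partial_deriv 0 ^^ n) X (emb t)) \<le> A1 * B1 ^ n * fact n * M n"
      using denjoy_carleman_1_bounds[OF U X t0] by metis
    obtain d2 A2 B2 where d2: "d2 > 0" "A2 > 0" "B2 > 0"
      "\<And>t n. \<bar>t - t0\<bar> < d2 \<Longrightarrow> norm ((partial_deriv 0 ^^ n) Y (emb t)) \<le> A2 * B2 ^ n * fact n * M n"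
      using denjoy_carleman_1_bounds[OF U Y t0] by metis
    obtain d3 N where d3: "d3 > 0" "\<And>t k. \<bar>t - t0\<bar> < d3 \<Longrightarrow> N \<le> k \<Longrightarrow>
        (bpoint k / 2)\<^sup>2 \<le> (X (emb t) - apoint k)\<^sup>2 + (Y (emb t) - bpoint k)\<^sup>2"
      using curve_avoids_points[OF qa U t0 X Y] by metis
    define A where "A = max A1 A2"
    define B where "B = max B1 B2"
    define d where "d = min d1 (min d2 d3)"
    have A: "A > 0" and B: "B > 0" and d: "d > 0" using d1 d2 d3 by (simp_all add: A_def B_def d_def)
    have AB: "A1 * B1 ^ n * M n \<le> A * B ^ n * M n" "A2 * B2 ^ n * M n \<le> A * B ^ n * M n" for n
      using d1 d2 Mpos[of n] by (auto simp: A_def B_def intro!: mult_right_mono mult_mono power_mono)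
    have "\<exists>K\<ge>0. \<forall>i u. 0 \<le> u \<longrightarrow> c k * (1 / (e k)\<^sup>2) ^ i * exp (- (1 / (e k)\<^sup>2) * u) \<le> K * fact i * M i" for k
      using base_near[of k] by metis
    then obtain K where K: "\<And>k. 0 \<le> K k" "\<And>k i u. 0 \<le> u \<Longrightarrow>
        c k * (1 / (e k)\<^sup>2) ^ i * exp (- (1 / (e k)\<^sup>2) * u) \<le> K k * fact i * M i" by metis
    define \<kappa> where "\<kappa> k = (if k < N then K k else (1/2) ^ k)" for k
    define D where "D = 2 * (2 * B) * (1 + (2 * A\<^sup>2 + 4 * A) * M 1)"
    have D: "D > 0" unfolding D_def using A B Mpos[of 1] by (intro mult_pos_pos add_pos_pos) auto
    have "summable (\<lambda>k. (1/2::real) ^ k)" by (rule summable_geometric) auto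
    moreover have "\<forall>\<^sub>F k in sequentially. \<kappa> k = (1/2) ^ k"
      using eventually_ge_at_top[of N] by eventually_elim (simp add: \<kappa>_def)
    ultimately have \<kappa>: "summable \<kappa>" using summable_cong by metis
    have bound: "norm (E k n t) \<le> \<kappa> k * (D ^ n * fact n * M n)" if t: "\<bar>t - t0\<bar> < d" for k n t
    proof -
      have xb: "\<bar>x n t\<bar> \<le> A * B ^ n * M n" for n
      proof -
        have "\<bar>x n t\<bar> \<le> A1 * B1 ^ n * M n"
          using d1(5)[of t n] t by (simp add: x_def d_def divide_le_eq mult_ac)
        then show ?thesis using AB(1) order_trans by blast
      qed
      have yb: "\<bar>y n t\<bar> \<le> A * B ^ n * M n" for n
      proof -
        have "\<bar>y n t\<bar> \<le> A2 * B2 ^ n * M n"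
          using d2(4)[of t n] t by (simp add: y_def d_def divide_le_eq mult_ac)
        then show ?thesis using AB(2) order_trans by blast
      qed
      have x0: "x 0 t = X (emb t)" "y 0 t = Y (emb t)" by (simp_all add: x_def y_def)
      have "c k * \<bar>exp_coeff (1 / (e k)\<^sup>2) (v k t) n\<bar> \<le> \<kappa> k * D ^ n * M n"
        unfolding v_def D_def
      proof (rule bump_term_bound[OF xb yb])
        show "0 \<le> \<kappa> k" using K by (simp add: \<kappa>_def)
        show "c k * (1 / (e k)\<^sup>2) ^ i * exp (- (1 / (e k)\<^sup>2) * ((x 0 t - apoint k)\<^sup>2 + (y 0 t - bpoint k)\<^sup>2))
            \<le> \<kappa> k * fact i * M i" for i
        proof (cases "k < N")
          case True
          then show ?thesis using K(2)[of "(x 0 t - apoint k)\<^sup>2 + (y 0 t - bpoint k)\<^sup>2" k i] by (simp add: \<kappa>_def)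
        next
          case False
          then have "(bpoint k / 2)\<^sup>2 \<le> (x 0 t - apoint k)\<^sup>2 + (y 0 t - bpoint k)\<^sup>2"
            unfolding x0 using t by (intro d3(2)) (auto simp: d_def)
          from base_far[OF this, of i] False show ?thesis by (simp add: \<kappa>_def)
        qed
      qed (use A B in auto)
      then have "fact n * (c k * \<bar>exp_coeff (1 / (e k)\<^sup>2) (v k t) n\<bar>) \<le> fact n * (\<kappa> k * D ^ n * M n)"
        by (intro mult_left_mono) auto
      then show ?thesis using c_pos[of k] by (simp add: E_def abs_mult mult_ac)
    qed
    show ?thesis
      by (rule exI[of _ d], rule exI[of _ "max 1 (suminf \<kappa>)"], rule exI[of _ D], rule exI[of _ \<kappa>])
        (use d D \<kappa> bound d1(4) in \<open>simp add: d_def\<close>)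
  qed
  define H where "H n t = (\<Sum>k. E k n t)" for n t
  show ?thesis
  proof (rule denjoy_carleman_1I[where H = H, OF U])
    show "(\<Sum>k. c k * exp (- (1 / (e k)\<^sup>2) * ((X (emb t) - apoint k)\<^sup>2 + (Y (emb t) - bpoint k)\<^sup>2))) = H 0 t" for t
      by (simp add: H_def E_def v_def dist_coeff_0 x_def y_def)
  next
    fix n t0 assume "emb t0 \<in> U"
    from E_bound[OF this] obtain d A D \<kappa> where d: "d > 0" "D > 0" "summable \<kappa>"
      "\<And>t. \<bar>t - t0\<bar> < d \<Longrightarrow> emb t \<in> U"
      "\<And>t k n. \<bar>t - t0\<bar> < d \<Longrightarrow> norm (E k n t) \<le> \<kappa> k * (D ^ n * fact n * M n)" by metis
    have ball: "\<bar>t - t0\<bar> < d" if "t \<in> ball t0 d" for t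
      using that by (simp add: dist_real_def abs_minus_commute)
    show "(H n has_vector_derivative H (Suc n) t0) (at t0)"
      unfolding H_def[abs_def]
    proof (rule has_vector_derivative_suminf[where S = "ball t0 d" and F = "\<lambda>k. E k n" and F' = "\<lambda>k. E k (Suc n)"])
      show "(E k n has_vector_derivative E k (Suc n) t) (at t)" if "t \<in> ball t0 d" for k t
        by (rule E'[OF d(4)[OF ball[OF that]]])
      show "norm (E k n t0) \<le> \<kappa> k * (D ^ n * fact n * M n)" for k
        by (rule d(5)) (use d in simp)
      show "norm (E k (Suc n) t) \<le> \<kappa> k * (D ^ Suc n * fact (Suc n) * M (Suc n))" if "t \<in> ball t0 d" for k t
        by (rule d(5)[OF ball[OF that]])
    qed (use d in \<open>auto intro!: summable_mult2\<close>)
  next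
    fix t0 assume "emb t0 \<in> U"
    from E_bound[OF this] obtain d A D \<kappa> where d: "d > 0" "A > 0" "D > 0" "summable \<kappa>" "suminf \<kappa> \<le> A"
      "\<And>t. \<bar>t - t0\<bar> < d \<Longrightarrow> emb t \<in> U"
      "\<And>t k n. \<bar>t - t0\<bar> < d \<Longrightarrow> norm (E k n t) \<le> \<kappa> k * (D ^ n * fact n * M n)" by metis
    have "norm (H n t) \<le> A * D ^ n * fact n * M n" if t: "\<bar>t - t0\<bar> < d" for n t
    proof -
      have "norm (H n t) \<le> (\<Sum>k. \<kappa> k * (D ^ n * fact n * M n))"
        unfolding H_def by (rule norm_suminf_le[OF d(7)[OF t] summable_mult2[OF d(4)]])
      also have "\<dots> = suminf \<kappa> * (D ^ n * fact n * M n)"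
        by (rule suminf_mult2[OF d(4), symmetric])
      also have "\<dots> \<le> A * (D ^ n * fact n * M n)"
        using d Mpos[of n] by (intro mult_right_mono) auto
      finally show ?thesis by (simp add: mult_ac)
    qed
    then show "\<exists>d A B. d > 0 \<and> A > 0 \<and> B > 0 \<and>
       (\<forall>t n. emb t \<in> U \<and> \<bar>t - t0\<bar> < d \<longrightarrow> norm (H n t) \<le> A * B ^ n * fact n * M n)"
      using d by (intro exI[of _ d] exI[of _ A] exI[of _ D]) simp
  qed
qed

section \<open>Failure of the estimates at the origin\<close>

lemma apoint_separated:
  assumes "j \<noteq> k"
  shows "bpoint j / 2 \<le> \<bar>apoint k - apoint j\<bar>"
proof (cases "j < k")
  case True
  \<comment> \<open>First coordinates halve at each step, so two of them differ by at least half the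
    larger one.\<close>
  have "apoint k \<le> apoint (Suc j)"
    using True unfolding apoint_def by (intro power_decreasing) auto
  then have "apoint k \<le> apoint j / 2" by (simp add: apoint_def)
  then show ?thesis using bpoint_le_apoint[of j] by linarith
next
  case False
  then have "Suc k \<le> j" using assms by simp
  then have "apoint j \<le> apoint (Suc k)"
    unfolding apoint_def by (intro power_decreasing) auto
  then have "apoint j \<le> apoint k / 2" by (simp add: apoint_def)
  then show ?thesis using bpoint_le_apoint[of j] by linarith
qed

definition centre :: "nat \<Rightarrow> nat \<Rightarrow> real" where
  "centre k = (\<lambda>i. if i = 0 then apoint k else if i = 1 then bpoint k else 0)"

definition x_index :: "nat \<Rightarrow> nat \<Rightarrow> nat" where
  "x_index n = (\<lambda>i. if i = 0 then n else 0)"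

lemma bump_deriv_x_index:
  assumes "2 \<le> p"
  shows "bump_deriv p j (mi_list p (x_index n)) (centre k) = c j * (factor j 0 n (apoint k) * factor j 1 0 (bpoint k))"
proof -
  have "(\<Prod>i\<in>{2..<p}. factor j i (count_list (mi_list p (x_index n)) i) (centre k i)) = 1"
    by (rule prod.neutral) (auto simp: factor_def count_list_mi_list x_index_def)
  then show ?thesis
    using assms unfolding bump_deriv_def prod_split_two[OF assms]
    by (simp add: count_list_mi_list x_index_def centre_def)
qed

text \<open>The partial derivatives in direction \<open>x\<close> of the other bumps at the \<open>k\<close>-th centre are
  estimated along the horizontal line through it, which is one of the curves above.\<close>

lemma other_bumps_bound:
  assumes "j \<noteq> k"
  shows "\<bar>c j * (factor j 0 n (apoint k) * factor j 1 0 (bpoint k))\<bar> \<le>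
    (1/2) ^ j * ((4 * (1 + 6 * M 1)) ^ n * fact n * M n)"
proof -
  \<comment> \<open>Taylor coefficients of the horizontal line through the \<open>k\<close>-th
    centre, parametrised by its first coordinate.\<close>
  define x where "x n t = (if n = 0 then t else if n = 1 then 1 else 0 :: real)" for n :: nat and t :: real
  define y where "y n t = (if n = 0 then bpoint k else 0)" for n :: nat and t :: real
  define v where "v t = dist_coeff (apoint j) (bpoint j) (\<lambda>n. x n t) (\<lambda>n. y n t)" for t
  have x': "(x n has_real_derivative real (Suc n) * x (Suc n) t) (at t)" for n t
    unfolding x_def[abs_def] by (cases "n = 0") auto
  have y': "(y n has_real_derivative real (Suc n) * y (Suc n) t) (at t)" for n t
    unfolding y_def[abs_def] by simp
  have "((\<lambda>t. v t n) has_real_derivative real (Suc n) * v t (Suc n)) (at t)" for n t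
    unfolding v_def by (rule has_real_derivative_dist_coeff[OF x' y'])
  from has_real_derivative_exp_coeff[where u = "\<lambda>n t. v t n", OF this]
  have E': "((\<lambda>t. exp_coeff (1 / (e j)\<^sup>2) (v t) n) has_real_derivative
     real (Suc n) * exp_coeff (1 / (e j)\<^sup>2) (v t) (Suc n)) (at t)" for n t .
  \<comment> \<open>Both sides describe the same derivative, once by Hermite recursion and once by
    the exponential recursion; uniqueness of derivatives carries the equality from \<open>n\<close>
    to \<open>Suc n\<close>.\<close>
  have eq: "factor j 0 n t * factor j 1 0 (bpoint k) = fact n * exp_coeff (1 / (e j)\<^sup>2) (v t) n" for n t
  proof (induction n arbitrary: t)
    case 0
    show ?case
      by (simp add: factor_def v_def dist_coeff_0 x_def y_def power_divide add_divide_distrib flip: exp_add)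
  next
    case (Suc n)
    have "((\<lambda>t. factor j 0 n t * factor j 1 0 (bpoint k)) has_real_derivative
        factor j 0 (Suc n) t * factor j 1 0 (bpoint k)) (at t)"
      by (rule DERIV_cmult_right[OF has_real_derivative_factor])
    moreover have "((\<lambda>t. factor j 0 n t * factor j 1 0 (bpoint k)) has_real_derivative
        fact n * (real (Suc n) * exp_coeff (1 / (e j)\<^sup>2) (v t) (Suc n))) (at t)"
      unfolding Suc.IH by (rule DERIV_cmult[OF E'])
    ultimately have "factor j 0 (Suc n) t * factor j 1 0 (bpoint k) =
        fact n * (real (Suc n) * exp_coeff (1 / (e j)\<^sup>2) (v t) (Suc n))"
      by (rule DERIV_unique)
    then show ?case by (simp add: fact_Suc mult_ac del: of_nat_Suc exp_coeff.simps)
  qed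
  have M1: "1 \<le> M n" for n using weight_sequence_ge_1[OF weight] .
  have a: "\<bar>apoint k\<bar> \<le> 1" "\<bar>bpoint k\<bar> \<le> 1"
    using apoint_pos[of k] apoint_le_1[of k] bpoint_pos[of k] bpoint_le_apoint[of k] by linarith+
  have "c j * \<bar>exp_coeff (1 / (e j)\<^sup>2) (v (apoint k)) n\<bar> \<le>
      (1/2) ^ j * (2 * (2 * 1) * (1 + (2 * 1\<^sup>2 + 4 * 1) * M 1)) ^ n * M n"
    unfolding v_def
  \<comment> \<open>All coefficients of the line are at most \<open>1\<close>, hence
    \<open>A = B = 1\<close>, and the rate becomes \<open>4 * (1 + 6 * M 1)\<close>.\<close>
  proof (rule bump_term_bound)
    show "\<bar>x n (apoint k)\<bar> \<le> 1 * 1 ^ n * M n" for n using M1[of n] M1[of 0] a by (auto simp: x_def)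
    show "\<bar>y n (apoint k)\<bar> \<le> 1 * 1 ^ n * M n" for n using M1[of n] M1[of 0] a by (auto simp: y_def)
    fix i
    have "(bpoint j / 2)\<^sup>2 \<le> (apoint k - apoint j)\<^sup>2"
      using power_mono[OF apoint_separated[OF assms], of 2] bpoint_pos[of j] by simp
    then have "(bpoint j / 2)\<^sup>2 \<le> (x 0 (apoint k) - apoint j)\<^sup>2 + (y 0 (apoint k) - bpoint j)\<^sup>2"
      by (simp add: x_def y_def add_increasing2)
    from base_far[OF this, of i]
    show "c j * (1 / (e j)\<^sup>2) ^ i * exp (- (1 / (e j)\<^sup>2) * ((x 0 (apoint k) - apoint j)\<^sup>2 + (y 0 (apoint k) - bpoint j)\<^sup>2))
        \<le> (1/2) ^ j * fact i * M i" .
  qed auto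
  then have "fact n * (c j * \<bar>exp_coeff (1 / (e j)\<^sup>2) (v (apoint k)) n\<bar>) \<le>
      fact n * ((1/2) ^ j * (4 * (1 + 6 * M 1)) ^ n * M n)"
    by (intro mult_left_mono) auto
  then show ?thesis
    unfolding eq using c_pos[of j] by (simp add: abs_mult mult_ac)
qed

text \<open>The \<open>k\<close>-th bump alone contributes the first term by \<open>c_big\<close>;
  the others cannot cancel it, as their bounds form a geometric series with sum twice the common
  factor.\<close>

lemma bump_sum_deriv_large:
  assumes p: "2 \<le> p" and k: "1 \<le> k"
  shows "(real k ^ (2 * k) - 2 * (4 * (1 + 6 * M 1)) ^ (2 * k)) * (fact (2 * k) * M (2 * k))
    \<le> \<bar>mi_deriv p (x_index (2 * k)) bump_sum (centre k)\<bar>"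
proof -
  define n where "n = 2 * k"
  define Z where "Z = (4 * (1 + 6 * M 1)) ^ n * fact n * M n"
  define T where "T j = c j * (factor j 0 n (apoint k) * factor j 1 0 (bpoint k))" for j
  \<comment> \<open>The series with its \<open>k\<close>-th term removed, so that the whole sum is
    \<open>T k + suminf R\<close>.\<close>
  define R where "R j = (if j = k then 0 else T j)" for j
  have "centre k \<in> RR p" using p by (auto simp: RR_iff centre_def)
  then have deriv: "mi_deriv p (x_index n) bump_sum (centre k) = (\<Sum>j. T j)"
    using iterated_partial_bump_sum[OF p set_mi_list]
    by (simp add: mi_deriv_eq_iterated_partial bump_deriv_x_index[OF p] T_def)
  have Z: "Z \<ge> 0"
    unfolding Z_def using weight_sequence_ge_1[OF weight, of 1] weight_sequence_ge_1[OF weight, of n] by simp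
  have Rb: "norm (R j) \<le> (1/2) ^ j * Z" for j
    using other_bumps_bound[of j k n] Z by (simp add: R_def T_def Z_def)
  have geo: "summable (\<lambda>j. (1/2::real) ^ j * Z)"
    by (intro summable_mult2 summable_geometric) auto
  have R: "summable R"
    by (rule summable_comparison_test'[OF geo]) (use Rb in auto)
  have "\<bar>suminf R\<bar> \<le> (\<Sum>j. (1/2::real) ^ j * Z)"
    using norm_suminf_le[OF Rb geo] by simp
  also have "\<dots> = 2 * Z"
    using suminf_mult2[of "\<lambda>j. (1/2::real) ^ j" Z] suminf_geometric[of "1/2::real"] by (simp add: summable_geometric)
  finally have Rsum: "\<bar>suminf R\<bar> \<le> 2 * Z" .
  have "(\<lambda>j. if j = k then T j else 0) sums T k" by (rule sums_single)
  from sums_add[OF this summable_sums[OF R]]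
  have "(\<lambda>j. T j) sums (T k + suminf R)"
    by (rule sums_cong[THEN iffD1, rotated]) (simp add: R_def)
  then have "(\<Sum>j. T j) = T k + suminf R" by (simp add: sums_iff)
  moreover have "real k ^ n * (fact n * M n) \<le> \<bar>T k\<bar>"
  proof -
    have "real k ^ n * (fact n * M n) \<le> c k / e k ^ n" unfolding n_def by (rule c_big[OF k])
    also have "\<dots> \<le> c k / e k ^ n * \<bar>gauss_deriv n 0\<bar>"
    proof -
      have "c k / e k ^ n * 1 \<le> c k / e k ^ n * \<bar>gauss_deriv n 0\<bar>"
        unfolding n_def using gauss_deriv_even_0[of k] c_pos[of k] e_pos[of k] by (intro mult_left_mono) auto
      then show ?thesis by simp
    qed
    also have "\<dots> = \<bar>T k\<bar>"
      using c_pos[of k] e_pos[of k] by (simp add: T_def factor_def abs_mult)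
    finally show ?thesis .
  qed
  ultimately have "real k ^ n * (fact n * M n) - 2 * Z \<le> \<bar>mi_deriv p (x_index n) bump_sum (centre k)\<bar>"
    using Rsum unfolding deriv by linarith
  then show ?thesis by (simp add: n_def Z_def algebra_simps)
qed

text \<open>Every neighbourhood of the origin contains almost all centres, and there
  \<open>real k ^ (2 * k)\<close> outgrows any geometric rate.\<close>

lemma bump_sum_not_denjoy_carleman:
  assumes p: "2 \<le> p"
  shows "bump_sum \<notin> denjoy_carleman M p (RR p)"
proof
  assume "bump_sum \<in> denjoy_carleman M p (RR p)"
  moreover have 0: "(\<lambda>_. 0) \<in> RR p" by (simp add: RR_iff)
  ultimately obtain V A B where V: "openin (Euclidean_space p) V" "(\<lambda>_. 0) \<in> V" "0 < A" "0 < B"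
    and b: "\<And>\<alpha> y. y \<in> V \<Longrightarrow> norm (mi_deriv p \<alpha> bump_sum y)
       \<le> A * B ^ mi_size p \<alpha> * fact (mi_size p \<alpha>) * M (mi_size p \<alpha>)"
    using denjoy_carleman_bounds by metis
  obtain r where r: "r > 0" "coord_box p (\<lambda>_. 0) r \<subseteq> V" using coord_box_subset_open[OF V(1,2)] .
  obtain N where N: "\<And>k. k \<ge> N \<Longrightarrow> apoint k \<le> r / 2" using eventually_apoint_le[of "r / 2"] r by auto
  define D where "D = 4 * (1 + 6 * M 1)"
  define Q where "Q = max 1 (max B D)"
  have Q: "Q \<ge> 1" "B \<le> Q" "D \<le> Q" by (auto simp: Q_def)
  have D: "D \<ge> 0" using weight_sequence_ge_1[OF weight, of 1] by (simp add: D_def)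
  \<comment> \<open>The estimates would give
    \<open>real k ^ (2 * k) \<le> (A + 2) * Q ^ (2 * k)\<close>, whereas the right side is less than
    \<open>((A + 3) * Q) ^ (2 * k)\<close>.\<close>
  obtain k0 :: nat where k0: "(A + 3) * Q < real k0" using reals_Archimedean2 by blast
  define k where "k = max (max N 1) k0"
  have k: "N \<le> k" "1 \<le> k" "(A + 3) * Q \<le> real k" using k0 by (auto simp: k_def)
  have "centre k \<in> coord_box p (\<lambda>_. 0) r"
    using N[OF k(1)] apoint_pos[of k] bpoint_pos[of k] bpoint_le_apoint[of k] r(1) p
    by (auto simp: coord_box_def centre_def RR_iff)
  then have "centre k \<in> V" using r by blast
  have "(real k ^ (2 * k) - 2 * D ^ (2 * k)) * (fact (2 * k) * M (2 * k))
      \<le> \<bar>mi_deriv p (x_index (2 * k)) bump_sum (centre k)\<bar>"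
    unfolding D_def by (rule bump_sum_deriv_large[OF p k(2)])
  also have "\<dots> \<le> A * B ^ (2 * k) * fact (2 * k) * M (2 * k)"
  proof -
    have "mi_size p (x_index (2 * k)) = 2 * k"
      using p by (simp add: mi_size_def x_index_def)
    then show ?thesis using b[OF \<open>centre k \<in> V\<close>, of "x_index (2 * k)"] by simp
  qed
  also have "\<dots> = (A * B ^ (2 * k)) * (fact (2 * k) * M (2 * k))" by (simp only: mult.assoc)
  finally have "(real k ^ (2 * k) - 2 * D ^ (2 * k)) * (fact (2 * k) * M (2 * k)) \<le> (A * B ^ (2 * k)) * (fact (2 * k) * M (2 * k))" .
  moreover have "fact (2 * k) * M (2 * k) > 0"
    using weight_sequence_ge_1[OF weight, of "2 * k"] by simp
  ultimately have "real k ^ (2 * k) - 2 * D ^ (2 * k) \<le> A * B ^ (2 * k)"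
    by (simp only: mult_le_cancel_right_pos)
  moreover have "A * B ^ (2 * k) \<le> A * Q ^ (2 * k)"
    using V Q by (intro mult_left_mono power_mono) auto
  moreover have "D ^ (2 * k) \<le> Q ^ (2 * k)" using Q D by (intro power_mono) auto
  ultimately have le: "real k ^ (2 * k) \<le> (A + 2) * Q ^ (2 * k)" by (simp add: algebra_simps)
  have "(A + 2) * Q ^ (2 * k) < (A + 3) * Q ^ (2 * k)"
    using Q by (intro mult_strict_right_mono) auto
  also have "\<dots> \<le> (A + 3) ^ (2 * k) * Q ^ (2 * k)"
    using Q V k(2) by (intro mult_right_mono self_le_power) auto
  also have "\<dots> = ((A + 3) * Q) ^ (2 * k)" by (simp add: power_mult_distrib)
  also have "\<dots> \<le> real k ^ (2 * k)" using k(3) V Q by (intro power_mono) auto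
  finally show False using le by simp
qed

end

text \<open>Stated for a general scalar type so that the real and the complex case are
  instances.\<close>

lemma exists_counterexample:
  fixes p :: nat and M :: "nat \<Rightarrow> real"
  assumes p: "2 \<le> p" and M: "weight_sequence M"
    and qa: "quasianalytic (denjoy_carleman M :: nat \<Rightarrow> _ \<Rightarrow> ((nat \<Rightarrow> real) \<Rightarrow> 'f::{real_normed_algebra_1,banach}) set)"
    and na: "\<not> is_analytic_class (denjoy_carleman M :: nat \<Rightarrow> _ \<Rightarrow> ((nat \<Rightarrow> real) \<Rightarrow> 'f) set)"
  shows "\<exists>f :: (nat \<Rightarrow> real) \<Rightarrow> 'f. f \<in> smooth_class p (RR p) \<and>
    (\<forall>U \<gamma>. openin (Euclidean_space 1) U \<and> \<gamma> \<in> denjoy_carleman_curves M U p \<longrightarrow>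
      f \<circ> \<gamma> \<in> denjoy_carleman M 1 U) \<and>
    f \<notin> denjoy_carleman M p (RR p)"
proof -
  have "\<not> (\<exists>R. \<forall>n. M n \<le> R ^ n)"
    using na is_analytic_class_if_bounded[OF M, where 'f = 'f] by metis
  from bumps_exist[OF M this] obtain c e where "bumps M c e" by metis
  then interpret bumps M c e .
  have RR: "openin (Euclidean_space p) (RR p)" by simp
  let ?f = "\<lambda>x. of_real (bump_sum x) :: 'f"
  have "?f \<circ> \<gamma> \<in> denjoy_carleman M 1 U"
    if U: "openin (Euclidean_space 1) U" and \<gamma>: "\<gamma> \<in> denjoy_carleman_curves M U p" for U \<gamma>
  proof -
    have "(\<lambda>t. \<gamma> t 0) \<in> denjoy_carleman M 1 U" "(\<lambda>t. \<gamma> t 1) \<in> denjoy_carleman M 1 U"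
      using \<gamma> p by (auto simp: denjoy_carleman_curves_def)
    \<comment> \<open>Only the first two coordinates of the curve enter
      \<open>bump_sum\<close>.\<close>
    from bump_sum_curve[OF qa U this]
    have dc: "(\<lambda>s. bump_sum (\<gamma> s)) \<in> denjoy_carleman M 1 U"
      by (simp only: bump_sum_def)
    then have "(\<lambda>s. bump_sum (\<gamma> s)) \<in> smooth_class 1 U" by (simp add: denjoy_carleman_def)
    from denjoy_carleman_of_real_iff[OF U this, where 'f = 'f and M = M] dc
    show ?thesis by (simp add: o_def)
  qed
  then show ?thesis
    using smooth_class_of_real(1)[OF RR bump_sum_smooth[OF p], where 'f = 'f]
      denjoy_carleman_of_real_iff[OF RR bump_sum_smooth[OF p], where 'f = 'f and M = M]
      bump_sum_not_denjoy_carleman[OF p] by blast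
qed

theorem theorem1p3:
  fixes p :: nat and M :: "nat \<Rightarrow> real"
  assumes "p \<ge> 2" and "weight_sequence M"
  shows
    "(quasianalytic (denjoy_carleman M :: nat \<Rightarrow> _ \<Rightarrow> ((nat \<Rightarrow> real) \<Rightarrow> real) set) \<and>
      \<not> is_analytic_class (denjoy_carleman M :: nat \<Rightarrow> _ \<Rightarrow> ((nat \<Rightarrow> real) \<Rightarrow> real) set) \<longrightarrow>
      (\<exists>f :: (nat \<Rightarrow> real) \<Rightarrow> real. f \<in> smooth_class p (RR p) \<and>
        (\<forall>U \<gamma>. openin (Euclidean_space 1) U \<and> \<gamma> \<in> denjoy_carleman_curves M U p \<longrightarrow>
          f \<circ> \<gamma> \<in> denjoy_carleman M 1 U) \<and>
        f \<notin> denjoy_carleman M p (RR p))) \<and>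
     (quasianalytic (denjoy_carleman M :: nat \<Rightarrow> _ \<Rightarrow> ((nat \<Rightarrow> real) \<Rightarrow> complex) set) \<and>
      \<not> is_analytic_class (denjoy_carleman M :: nat \<Rightarrow> _ \<Rightarrow> ((nat \<Rightarrow> real) \<Rightarrow> complex) set) \<longrightarrow>
      (\<exists>f :: (nat \<Rightarrow> real) \<Rightarrow> complex. f \<in> smooth_class p (RR p) \<and>
        (\<forall>U \<gamma>. openin (Euclidean_space 1) U \<and> \<gamma> \<in> denjoy_carleman_curves M U p \<longrightarrow>
          f \<circ> \<gamma> \<in> denjoy_carleman M 1 U) \<and>
        f \<notin> denjoy_carleman M p (RR p)))"
proof -
  have "2 \<le> p" using assms(1) .
  note ex = exists_counterexample[OF this assms(2)]
  show ?thesis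
    by (intro conjI impI; elim conjE; rule ex; assumption)
qed

end
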